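(* Consider the adaptive algorithm AILFEM described in the context with arbitrary parameters $0<\theta\le 1$, $C_{\rm mark}\ge 1$, $\lambda_{\rm lin}>0$, $0<\rho<1$, $\alpha_{\min}>0$, $J_{\max}\in\mathbb N$, $\tau\ge0$, and arbitrary $u_0^{0,0}\in\mathcal X_0$. Then the following holds. (i) For any $0<C_{\rm nrg}'<C_{\rm nrg}^\star$, there exists $j_0'\in\mathbb N$ such that $$C_{\rm nrg}'\,|||u_\ell^{k,j}-u_\ell^{k-1,\underline j}|||^2\le\mathrm d^2(u_\ell^{k,j},u_\ell^{k-1,\underline j})\quad\text{for all }(\ell,k,j)\in\mathcal Q\text{ with }j\ge j_0'.$$ (ii) There exists an index $j_0\in\mathbb N$ such that $\underline j[\ell,k]\le j_0$ for all $(\ell,k,0)\in\mathcal Q$, i.e., the number of algebraic solver steps is finite and even uniformly bounded. Moreover, there exists $0<C_{\rm nrg}<C_{\rm nrg}^\star$ such that $$C_{\rm nrg}\,|||u_\ell^{k,\underline j}-u_\ell^{k-1,\underline j}|||^2\le\mathrm d^2(u_\ell^{k,\underline j},u_\ell^{k-1,\underline j})\quad\text{for all }(\ell,k,0)\in\mathcal Q\text{ with }k\ge1.$$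
   Context: **Problem.** $\Omega\subset\mathbb R^d$ ($d\ge1$) is a bounded Lipschitz domain, $\mathcal X=H^1_0(\Omega)$ with dual $\mathcal X'$, $|||v|||:=\|\nabla v\|_{L^2(\Omega)}$. $\mu:\mathbb R_{\ge0}\to\mathbb R_{\ge0}$ is $C^1$ and there are $0<\alpha\le L/3$ with $\alpha(t-s)\le\mu(t^2)t-\mu(s^2)s\le\frac L3(t-s)$ for all $t\ge s\ge0$. Data: $f\in L^2(\Omega)$, $\boldsymbol f\in[L^2(\Omega)]^d$. Set $\langle\mathcal Au,v\rangle:=\int_\Omega\mu(|\nabla u|^2)\nabla u\cdot\nabla v\,dx$, $F(v):=\int_\Omega fv\,dx+\int_\Omega\boldsymbol f\cdot\nabla v\,dx$. Then $\alpha|||u-v|||^2\le\langle\mathcal Au-\mathcal Av,u-v\rangle$ and $\langle\mathcal Au-\mathcal Av,w\rangle\le L|||u-v|||\,|||w|||$ for all $u,v,w\in\mathcal X$. For each closed subspace $\mathcal X_H\subseteq\mathcal X$, $u_H^\star\in\mathcal X_H$ is the unique solution of $\langle\mathcal Au_H^\star,v_H\rangle=F(v_H)$ for all $v_H\in\mathcal X_H$. Energy: $\mathcal E(v):=\frac12\int_\Omega\int_0^{|\nabla v|^2}\mu(t)\,dt\,dx-F(v)$; energy difference: $\mathrm d^2(v,w):=\mathcal E(w)-\mathcal E(v)$ (may be negative). **Meshes and spaces.** $\mathcal T_0$ is a conforming simplicial mesh of $\Omega$ (admissible for newest vertex bisection, NVB). $\mathtt{refine}(\mathcal T_H,\mathcal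 M_H)$ is the coarsest conforming NVB refinement of $\mathcal T_H$ in which at least all elements of $\mathcal M_H\subseteq\mathcal T_H$ are refined. For fixed $p\in\mathbb N$, $\mathcal X_H:=\{v\in H_0^1(\Omega): v|_T\text{ polynomial of degree}\le p\ \forall T\in\mathcal T_H\}$. Index $\ell$ refers to the mesh $\mathcal T_\ell$. **Linearization.** For each $u\in\mathcal X$, $a(u;\cdot,\cdot)$ is a symmetric bilinear form on $\mathcal X$ with $C_{\rm ell}|||v|||^2\le a(u;v,v)$ and $|a(u;v,w)|\le C_{\rm cnt}|||v|||\,|||w|||$, with $C_{\rm ell},C_{\rm cnt}>0$ independent of $u$. For $u_H\in\mathcal X_H$, $\Phi_H(u_H)\in\mathcal X_H$ is the unique solution of $a(u_H;\Phi_H(u_H),v_H)=a(u_H;u_H,v_H)+F(v_H)-\langle\mathcal Au_H,v_H\rangle$ for all $v_H\in\mathcal X_H$. It is assumed that there is $C_{\rm nrg}^\star>0$, independent of $\mathcal X_H$ and $u_H$, with $C_{\rm nrg}^\star|||\Phi_H(u_H)-u_H|||^2\le\mathrm d^2(\Phi_H(u_H),u_H)$ for all $u_H\in\mathcal X_H$. **Algebraic solver.** Given $u_H^{k,0}\in\mathcal X_H$ and $u_H^{k,\star}:=\Phi_H(u_H^{k,0})$, the solver is an iteration map $\Psi_H(u_H^{k,\star};\cdot):\mathcal X_H\to\mathcal X_H$ with iterates $u_H^{k,j}:=\Psi_H(u_H^{k,\star};u_H^{k,j-1})$ satisfying $|||u_H^{k,\star}-u_H^{k,j}|||\le q_{\rm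 alg}|||u_H^{k,\star}-u_H^{k,j-1}|||$ for all $j\ge1$, with $0<q_{\rm alg}<1$ independent of $\mathcal X_H$ and $u_H^{k,0}$. **Estimator.** For $T\in\mathcal T_H$, $v_H\in\mathcal X_H$, with $\boldsymbol A(\nabla v)=\mu(|\nabla v|^2)\nabla v$: $\eta_H(T,v_H)^2:=|T|^{2/d}\|f+\mathrm{div}(\boldsymbol A(\nabla v_H)-\boldsymbol f)\|_{L^2(T)}^2+|T|^{1/d}\|[\![(\boldsymbol A(\nabla v_H)-\boldsymbol f)\cdot n]\!]\|^2_{L^2(\partial T\cap\Omega)}$ (assumed well defined and finite), where $[\![\cdot]\!]$ is the jump across faces; $\eta_H(\mathcal U,v_H):=(\sum_{T\in\mathcal U}\eta_H(T,v_H)^2)^{1/2}$ for $\mathcal U\subseteq\mathcal T_H$, $\eta_H(v_H):=\eta_H(\mathcal T_H,v_H)$. **Algorithm AILFEM.** Input: $\mathcal T_0$, $u_0^{0,0}=u_0^{0,\underline j}=u_0^{0,\star}\in\mathcal X_0$, $\theta,C_{\rm mark},\lambda_{\rm lin},\rho,\tau$, and initial values of the variables $\alpha_{\min}>0$, $J_{\max}\in\mathbb N$. For $\ell=0,1,\dots$: (i) For $k=1,2,\dots$: (a) set $u_\ell^{k,0}:=u_\ell^{k-1,\underline j}$ and $u_\ell^{k,\star}:=\Phi_\ell(u_\ell^{k-1,\underline j})$ (not computed). (b) For $j=1,2,\dots$: compute $u_\ell^{k,j}$ from $u_\ell^{k,j-1}$ by one solver step; if $\eta_\ell(u_\ell^{k,j})+|||u_\ell^{k,j}-u_\ell^{k-1,\underline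 j}|||+|||u_\ell^{k,j}-u_\ell^{k,j-1}|||\le\tau$, set $\underline\ell:=\ell$, $\underline k[\underline\ell]:=k$, $\underline j[\underline\ell,\underline k]:=j$ and terminate the algorithm; set $\alpha_\ell^{k,j}:=\mathrm d^2(u_\ell^{k,j},u_\ell^{k-1,\underline j})/|||u_\ell^{k,j}-u_\ell^{k-1,\underline j}|||^2$; leave the $j$-loop as soon as $\alpha_\ell^{k,j}\ge\alpha_{\min}$, or $u_\ell^{k,j}=u_\ell^{k-1,\underline j}$, or [$\alpha_\ell^{k,j}>0$ and $j>J_{\max}$]. (c) Set $\underline j[\ell,k]:=j$. (d) If $\underline j[\ell,k]>J_{\max}$, update $J_{\max}\leftarrow\underline j[\ell,k]$ and $\alpha_{\min}\leftarrow\rho\,\alpha_{\min}$. Leave the $k$-loop as soon as $\mathrm d^2(u_\ell^{k,\underline j},u_\ell^{k-1,\underline j})\le\lambda_{\rm lin}\,\eta_\ell(u_\ell^{k,\underline j})^2$. (ii) Set $\underline k[\ell]:=k$. (iii) Choose $\mathcal M_\ell\subseteq\mathcal T_\ell$ with $\theta\,\eta_\ell(u_\ell^{\underline k,\underline j})^2\le\eta_\ell(\mathcal M_\ell,u_\ell^{\underline k,\underline j})^2$ whose cardinality is at most $C_{\rm mark}$ times the minimal cardinality of sets with this property. (iv) $\mathcal T_{\ell+1}:=\mathtt{refine}(\mathcal T_\ell,\mathcal M_\ell)$, $u_{\ell+1}^{0,0}:=u_{\ell+1}^{0,\underline j}:=u_{\ell+1}^{0,\star}:=u_\ell^{\underline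 k,\underline j}$. **Indices.** $\mathbb N=\{1,2,\dots\}$. $\mathcal Q\subset\mathbb N_0^3$ is the set of triples $(\ell,k,j)$ used by the algorithm (i.e., $u_\ell^{k,j}$ is defined). $\underline\ell,\underline k[\ell],\underline j[\ell,k]$ are the suprema (possibly $\infty$) of the indices $\ell$, of $k$ for given $\ell$, and of $j$ for given $(\ell,k)$, occurring in $\mathcal Q$; $\underline j[\ell,0]=0$ (so $j\ge1$ implies $k\ge1$). Arguments are omitted if clear: $u_\ell^{k,\underline j}=u_\ell^{k,\underline j[\ell,k]}$, $u_\ell^{\underline k,\underline j}=u_\ell^{\underline k[\ell],\underline j[\ell,\underline k[\ell]]}$.
   Formalization: The last bound in (ii) excludes a pair (ℓ,k) where, with τ>0, the tolerance test terminates the algorithm at an iterate different from the previous one with d² ≤ 0; there the bound fails for every C_nrg>0, so the claim as written is false. *)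

theory Defs
  imports "HOL-Analysis.Analysis" "HOL-Library.Extended_Nat"
begin

section \<open>Sobolev spaces\<close>

text \<open>
  The ambient space is a type of class \<^class>\<open>euclidean_space\<close>, so that \<open>d = DIM('a)\<close>.
  Elements of \<open>L\<^sup>2(\<Omega>)\<close>, \<open>H\<^sup>1(\<Omega>)\<close> and \<open>H\<^sup>1\<^sub>0(\<Omega>)\<close> are represented by functions on the
  whole type of which only the values in \<open>\<Omega>\<close> (up to null sets) matter.
\<close>

definition sq_int :: "'a::euclidean_space set \<Rightarrow> ('a \<Rightarrow> 'b::euclidean_space) \<Rightarrow> bool" where
  "sq_int \<Omega> u \<longleftrightarrow> u \<in> borel_measurable (lebesgue_on \<Omega>) \<and>
     integrable (lebesgue_on \<Omega>) (\<lambda>x. (norm (u x))\<^sup>2)"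

definition eq_ae :: "'a::euclidean_space set \<Rightarrow> ('a \<Rightarrow> real) \<Rightarrow> ('a \<Rightarrow> real) \<Rightarrow> bool" where
  "eq_ae \<Omega> u v \<longleftrightarrow> (AE x in lebesgue_on \<Omega>. u x = v x)"

primrec Ck :: "nat \<Rightarrow> ('a::euclidean_space \<Rightarrow> real) \<Rightarrow> bool" where
  "Ck 0 \<phi> \<longleftrightarrow> continuous_on UNIV \<phi>"
| "Ck (Suc k) \<phi> \<longleftrightarrow> (\<forall>x. \<phi> differentiable (at x)) \<and>
     (\<forall>b\<in>Basis. Ck k (\<lambda>x. frechet_derivative \<phi> (at x) b))"

definition test_fun :: "'a::euclidean_space set \<Rightarrow> ('a \<Rightarrow> real) \<Rightarrow> bool" where
  "test_fun \<Omega> \<phi> \<longleftrightarrow> (\<forall>k. Ck k \<phi>) \<and> compact (closure {x. \<phi> x \<noteq> 0}) \<and>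
     closure {x. \<phi> x \<noteq> 0} \<subseteq> \<Omega>"

definition gradient :: "('a::euclidean_space \<Rightarrow> real) \<Rightarrow> 'a \<Rightarrow> 'a" where
  "gradient \<phi> x = (\<Sum>b\<in>Basis. frechet_derivative \<phi> (at x) b *\<^sub>R b)"

definition is_weak_grad :: "'a::euclidean_space set \<Rightarrow> ('a \<Rightarrow> real) \<Rightarrow> ('a \<Rightarrow> 'a) \<Rightarrow> bool" where
  "is_weak_grad \<Omega> u g \<longleftrightarrow> (\<forall>\<phi>. test_fun \<Omega> \<phi> \<longrightarrow>
     (LINT x|lebesgue_on \<Omega>. u x *\<^sub>R gradient \<phi> x) = - (LINT x|lebesgue_on \<Omega>. \<phi> x *\<^sub>R g x))"

definition H1 :: "'a::euclidean_space set \<Rightarrow> ('a \<Rightarrow> real) set" where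
  "H1 \<Omega> = {u. sq_int \<Omega> u \<and> (\<exists>g. sq_int \<Omega> g \<and> is_weak_grad \<Omega> u g)}"

definition wgrad :: "'a::euclidean_space set \<Rightarrow> ('a \<Rightarrow> real) \<Rightarrow> 'a \<Rightarrow> 'a" where
  "wgrad \<Omega> u = (SOME g. sq_int \<Omega> g \<and> is_weak_grad \<Omega> u g)"

definition H10 :: "'a::euclidean_space set \<Rightarrow> ('a \<Rightarrow> real) set" where
  "H10 \<Omega> = {u \<in> H1 \<Omega>. \<exists>\<phi>. (\<forall>n::nat. test_fun \<Omega> (\<phi> n)) \<and>
     (\<lambda>n. (LINT x|lebesgue_on \<Omega>. (u x - \<phi> n x)\<^sup>2)
        + (LINT x|lebesgue_on \<Omega>. (norm (wgrad \<Omega> u x - gradient (\<phi> n) x))\<^sup>2)) \<longlonglongrightarrow> 0}"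

definition is_weak_div :: "'a::euclidean_space set \<Rightarrow> ('a \<Rightarrow> 'a) \<Rightarrow> ('a \<Rightarrow> real) \<Rightarrow> bool" where
  "is_weak_div U \<sigma> h \<longleftrightarrow> (\<forall>\<phi>. test_fun U \<phi> \<longrightarrow>
     (LINT x|lebesgue_on U. \<sigma> x \<bullet> gradient \<phi> x) = - (LINT x|lebesgue_on U. h x * \<phi> x))"

definition wdiv :: "'a::euclidean_space set \<Rightarrow> ('a \<Rightarrow> 'a) \<Rightarrow> 'a \<Rightarrow> real" where
  "wdiv U \<sigma> = (SOME h. sq_int U h \<and> is_weak_div U \<sigma> h)"

text \<open>Locally and after a rotation, a Lipschitz domain is the region above the graph of a
  Lipschitz function of the coordinates orthogonal to \<open>e\<close>.\<close>

definition bounded_lipschitz_domain :: "'a::euclidean_space set \<Rightarrow> bool" where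
  "bounded_lipschitz_domain \<Omega> \<longleftrightarrow> open \<Omega> \<and> connected \<Omega> \<and> \<Omega> \<noteq> {} \<and> bounded \<Omega> \<and>
     (\<forall>x\<in>frontier \<Omega>. \<exists>e r C (\<gamma> :: 'a \<Rightarrow> real). norm e = 1 \<and> 0 < r \<and> C-lipschitz_on UNIV \<gamma> \<and>
        \<Omega> \<inter> ball x r = {y \<in> ball x r. \<gamma> (y - (y \<bullet> e) *\<^sub>R e) < y \<bullet> e})"


section \<open>The nonlinear problem\<close>

record 'a problem =
  Omega :: "'a set"
  mu :: "real \<Rightarrow> real"
  src :: "'a \<Rightarrow> real"    \<comment> \<open>the scalar datum \<open>f\<close>\<close>
  vsrc :: "'a \<Rightarrow> 'a"    \<comment> \<open>the vector datum \<open>\<^bold>f\<close>\<close>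

definition C1_on_nonneg :: "(real \<Rightarrow> real) \<Rightarrow> bool" where
  "C1_on_nonneg m \<longleftrightarrow> (\<exists>m'. continuous_on {0..} m' \<and>
     (\<forall>t\<ge>0. (m has_real_derivative m' t) (at t within {0..})))"

definition Xspace :: "'a::euclidean_space problem \<Rightarrow> ('a \<Rightarrow> real) set" where
  "Xspace P = H10 (Omega P)"

definition enorm :: "'a::euclidean_space problem \<Rightarrow> ('a \<Rightarrow> real) \<Rightarrow> real" where
  "enorm P v = sqrt (LINT x|lebesgue_on (Omega P). (norm (wgrad (Omega P) v x))\<^sup>2)"

definition flux :: "'a::euclidean_space problem \<Rightarrow> ('a \<Rightarrow> real) \<Rightarrow> 'a \<Rightarrow> 'a" where
  "flux P v x = mu P ((norm (wgrad (Omega P) v x))\<^sup>2) *\<^sub>R wgrad (Omega P) v x"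

definition Aop :: "'a::euclidean_space problem \<Rightarrow> ('a \<Rightarrow> real) \<Rightarrow> ('a \<Rightarrow> real) \<Rightarrow> real" where
  "Aop P u v = (LINT x|lebesgue_on (Omega P). flux P u x \<bullet> wgrad (Omega P) v x)"

definition load :: "'a::euclidean_space problem \<Rightarrow> ('a \<Rightarrow> real) \<Rightarrow> real" where
  "load P v = (LINT x|lebesgue_on (Omega P). src P x * v x)
           + (LINT x|lebesgue_on (Omega P). vsrc P x \<bullet> wgrad (Omega P) v x)"

definition energy :: "'a::euclidean_space problem \<Rightarrow> ('a \<Rightarrow> real) \<Rightarrow> real" where
  "energy P v = 1/2 * (LINT x|lebesgue_on (Omega P).
       integral {0..(norm (wgrad (Omega P) v x))\<^sup>2} (mu P)) - load P v"

text \<open>This is the quantity written as a square; it may be negative.\<close>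

definition dsq :: "'a::euclidean_space problem \<Rightarrow> ('a \<Rightarrow> real) \<Rightarrow> ('a \<Rightarrow> real) \<Rightarrow> real" where
  "dsq P v w = energy P w - energy P v"


section \<open>Meshes and newest vertex bisection\<close>

text \<open>
  Newest vertex bisection acts on tagged simplices \<open>([x\<^sub>0, \<dots>, x\<^sub>d], \<gamma>)\<close> with a type
  \<open>\<gamma> < d\<close>. The refinement edge joins \<open>x\<^sub>0\<close> and \<open>x\<^sub>d\<close>, and the two children are given by the
  rule of Maubach and Traxler in the form used by Stevenson.
\<close>

type_synonym 'a elt = "'a list \<times> nat"
type_synonym 'a mesh = "'a elt set"

definition verts :: "'a elt \<Rightarrow> 'a set" where
  "verts t = set (fst t)"

definition elt_set :: "'a::euclidean_space elt \<Rightarrow> 'a set" where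
  "elt_set t = convex hull (verts t)"

definition tagged_simplex :: "'a::euclidean_space elt \<Rightarrow> bool" where
  "tagged_simplex t \<longleftrightarrow> length (fst t) = DIM('a) + 1 \<and> distinct (fst t) \<and>
     \<not> affine_dependent (verts t) \<and> snd t < DIM('a)"

definition children :: "'a::euclidean_space elt \<Rightarrow> 'a mesh" where
  "children t = (let xs = fst t; g = snd t; m = midpoint (hd xs) (last xs);
       ys = butlast (tl xs); g' = (g + 1) mod DIM('a)
     in {(hd xs # m # ys, g'), (last xs # m # take g ys @ rev (drop g ys), g')})"

definition conforming :: "'a::euclidean_space mesh \<Rightarrow> bool" where
  "conforming T \<longleftrightarrow> (\<forall>t\<in>T. \<forall>t'\<in>T. elt_set t \<inter> elt_set t' = convex hull (verts t \<inter> verts t'))"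

definition conforming_mesh_of :: "'a::euclidean_space set \<Rightarrow> 'a mesh \<Rightarrow> bool" where
  "conforming_mesh_of \<Omega> T \<longleftrightarrow> finite T \<and> (\<forall>t\<in>T. tagged_simplex t) \<and>
     (\<Union>t\<in>T. elt_set t) = closure \<Omega> \<and>
     (\<forall>t\<in>T. \<forall>t'\<in>T. t \<noteq> t' \<longrightarrow> interior (elt_set t) \<inter> interior (elt_set t') = {}) \<and>
     conforming T"

definition nvb_step :: "'a::euclidean_space mesh \<Rightarrow> 'a mesh \<Rightarrow> bool" where
  "nvb_step T T' \<longleftrightarrow> (\<exists>t\<in>T. T' = (T - {t}) \<union> children t)"

definition nvb_le :: "'a::euclidean_space mesh \<Rightarrow> 'a mesh \<Rightarrow> bool" where
  "nvb_le T T' \<longleftrightarrow> nvb_step\<^sup>*\<^sup>* T T'"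

definition nvb_meshes :: "'a::euclidean_space mesh \<Rightarrow> 'a mesh set" where
  "nvb_meshes T0 = {T. nvb_le T0 T \<and> conforming T}"

definition is_refine :: "'a::euclidean_space mesh \<Rightarrow> 'a mesh \<Rightarrow> 'a mesh \<Rightarrow> bool" where
  "is_refine T M T' \<longleftrightarrow> T' \<in> nvb_meshes T \<and> T' \<inter> M = {} \<and>
     (\<forall>T''. T'' \<in> nvb_meshes T \<and> T'' \<inter> M = {} \<longrightarrow> nvb_le T' T'')"

definition refine :: "'a::euclidean_space mesh \<Rightarrow> 'a mesh \<Rightarrow> 'a mesh" where
  "refine T M = (THE T'. is_refine T M T')"

text \<open>
  Admissibility of the initial mesh means that the coarsest conforming refinement is well defined
  on all meshes generated from it. Every admissibility condition from the literature (none on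
  the tags for \<open>d \<le> 2\<close>, matching conditions for \<open>d \<ge> 3\<close>) implies this.
\<close>

definition nvb_admissible :: "'a::euclidean_space mesh \<Rightarrow> bool" where
  "nvb_admissible T0 \<longleftrightarrow> (\<forall>T\<in>nvb_meshes T0. \<forall>M\<subseteq>T. \<exists>!T'. is_refine T M T')"

definition poly_fun :: "nat \<Rightarrow> ('a::euclidean_space \<Rightarrow> real) \<Rightarrow> bool" where
  "poly_fun p q \<longleftrightarrow> (\<exists>c. \<forall>x. q x =
     (\<Sum>m | m \<in> Basis \<rightarrow>\<^sub>E {..p} \<and> sum m Basis \<le> p. c m * (\<Prod>b\<in>Basis. (x \<bullet> b) ^ m b)))"

definition fe_space :: "'a::euclidean_space problem \<Rightarrow> nat \<Rightarrow> 'a mesh \<Rightarrow> ('a \<Rightarrow> real) set" where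
  "fe_space P p T = {v \<in> Xspace P.
     \<forall>t\<in>T. \<exists>q. poly_fun p q \<and> eq_ae (elt_set t) v q}"


section \<open>Linearization and algebraic solver\<close>

definition sym_bilinear_on :: "('a \<Rightarrow> real) set \<Rightarrow> (('a \<Rightarrow> real) \<Rightarrow> ('a \<Rightarrow> real) \<Rightarrow> real) \<Rightarrow> bool" where
  "sym_bilinear_on X b \<longleftrightarrow>
     (\<forall>v\<in>X. \<forall>w\<in>X. b v w = b w v) \<and>
     (\<forall>v\<in>X. \<forall>v'\<in>X. \<forall>w\<in>X. \<forall>r s. b (\<lambda>x. r * v x + s * v' x) w = r * b v w + s * b v' w)"

text \<open>Uniqueness of the solution (in the sense of equality almost everywhere) follows from
  ellipticity.\<close>

definition linearized_solution :: "'a::euclidean_space problem \<Rightarrow>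
    (('a \<Rightarrow> real) \<Rightarrow> ('a \<Rightarrow> real) \<Rightarrow> ('a \<Rightarrow> real) \<Rightarrow> real) \<Rightarrow>
    ('a \<Rightarrow> real) set \<Rightarrow> ('a \<Rightarrow> real) \<Rightarrow> ('a \<Rightarrow> real) \<Rightarrow> bool" where
  "linearized_solution P a XH u w \<longleftrightarrow> w \<in> XH \<and>
     (\<forall>v\<in>XH. a u w v = a u u v + load P v - Aop P u v)"

definition contractive_solver :: "'a::euclidean_space problem \<Rightarrow> nat \<Rightarrow> 'a mesh \<Rightarrow>
    ('a mesh \<Rightarrow> ('a \<Rightarrow> real) \<Rightarrow> 'a \<Rightarrow> real) \<Rightarrow>
    ('a mesh \<Rightarrow> ('a \<Rightarrow> real) \<Rightarrow> ('a \<Rightarrow> real) \<Rightarrow> 'a \<Rightarrow> real) \<Rightarrow> real \<Rightarrow> bool" where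
  "contractive_solver P p T \<Phi> \<Psi> q \<longleftrightarrow>
     (\<forall>u\<in>fe_space P p T.
        (\<forall>v\<in>fe_space P p T. \<Psi> T (\<Phi> T u) v \<in> fe_space P p T) \<and>
        (\<forall>j. enorm P (\<Phi> T u - (\<Psi> T (\<Phi> T u) ^^ Suc j) u)
              \<le> q * enorm P (\<Phi> T u - (\<Psi> T (\<Phi> T u) ^^ j) u)))"


section \<open>Error estimator\<close>

text \<open>
  The surface measure on the hyperplane through \<open>c\<close> with unit normal \<open>n\<close>: a subset is measured by
  the volume of the right prism of height one above it. For \<open>d = 1\<close> it is the counting
  measure of a point.
\<close>

definition hyperplane_measure :: "'a::euclidean_space \<Rightarrow> 'a \<Rightarrow> 'a measure" where
  "hyperplane_measure c n =
     distr (restrict_space lborel {y. 0 \<le> (y - c) \<bullet> n \<and> (y - c) \<bullet> n \<le> 1}) borel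
       (\<lambda>y. y - ((y - c) \<bullet> n) *\<^sub>R n)"

text \<open>A face is given by its \<open>d\<close> vertices. The orientation of the normal is immaterial, since
  jumps only enter squared.\<close>

definition unit_normal :: "'a::euclidean_space set \<Rightarrow> 'a" where
  "unit_normal E = (SOME n. norm n = 1 \<and> (\<forall>x\<in>E. \<forall>y\<in>E. (x - y) \<bullet> n = 0))"

definition face_measure :: "'a::euclidean_space set \<Rightarrow> 'a measure" where
  "face_measure E = hyperplane_measure (SOME c. c \<in> E) (unit_normal E)"

text \<open>The trace on the boundary from the inside of \<open>t\<close>, as a limit of averages. This limit is
  the usual trace for continuous fields and, surface-almost everywhere, for Sobolev fields.\<close>

definition trace_avg :: "'a::euclidean_space elt \<Rightarrow> ('a \<Rightarrow> 'a) \<Rightarrow> 'a \<Rightarrow> real \<Rightarrow> 'a" where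
  "trace_avg t \<sigma> x r =
     (1 / measure lebesgue (interior (elt_set t) \<inter> ball x r)) *\<^sub>R
       (LINT y|lebesgue_on (interior (elt_set t) \<inter> ball x r). \<sigma> y)"

definition has_trace :: "'a::euclidean_space elt \<Rightarrow> ('a \<Rightarrow> 'a) \<Rightarrow> 'a \<Rightarrow> bool" where
  "has_trace t \<sigma> x \<longleftrightarrow> (\<exists>l. (trace_avg t \<sigma> x \<longlongrightarrow> l) (at_right 0))"

definition etrace :: "'a::euclidean_space elt \<Rightarrow> ('a \<Rightarrow> 'a) \<Rightarrow> 'a \<Rightarrow> 'a" where
  "etrace t \<sigma> x = Lim (at_right 0) (trace_avg t \<sigma> x)"

definition neighbour :: "'a::euclidean_space mesh \<Rightarrow> 'a elt \<Rightarrow> 'a set \<Rightarrow> 'a elt" where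
  "neighbour T t E = (THE t'. t' \<in> T \<and> t' \<noteq> t \<and> E \<subseteq> verts t')"

definition normal_jump :: "'a::euclidean_space mesh \<Rightarrow> 'a elt \<Rightarrow> 'a set \<Rightarrow> ('a \<Rightarrow> 'a) \<Rightarrow> 'a \<Rightarrow> real" where
  "normal_jump T t E \<sigma> x = (etrace t \<sigma> x - etrace (neighbour T t E) \<sigma> x) \<bullet> unit_normal E"

definition faces :: "'a elt \<Rightarrow> 'a set set" where
  "faces t = (\<lambda>z. verts t - {z}) ` verts t"

definition total_flux :: "'a::euclidean_space problem \<Rightarrow> ('a \<Rightarrow> real) \<Rightarrow> 'a \<Rightarrow> 'a" where
  "total_flux P v x = flux P v x - vsrc P x"

text \<open>Up to surface null sets, the part of the boundary of \<open>t\<close> inside \<open>\<Omega>\<close> is the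
  disjoint union of the sets \<open>(convex hull E) \<inter> \<Omega>\<close> over the faces \<open>E\<close> of \<open>t\<close>; these are
  empty for boundary faces.\<close>

definition eta_elt_sq :: "'a::euclidean_space problem \<Rightarrow> 'a mesh \<Rightarrow> 'a elt \<Rightarrow> ('a \<Rightarrow> real) \<Rightarrow> real" where
  "eta_elt_sq P T t v =
     measure lebesgue (elt_set t) powr (2 / DIM('a)) *
       (LINT x|lebesgue_on (interior (elt_set t)).
          (src P x + wdiv (interior (elt_set t)) (total_flux P v) x)\<^sup>2)
   + measure lebesgue (elt_set t) powr (1 / DIM('a)) *
       (\<Sum>E\<in>faces t. LINT x:convex hull E \<inter> Omega P|face_measure E.
          (normal_jump T t E (total_flux P v) x)\<^sup>2)"

definition eta :: "'a::euclidean_space problem \<Rightarrow> 'a mesh \<Rightarrow> 'a mesh \<Rightarrow> ('a \<Rightarrow> real) \<Rightarrow> real" where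
  "eta P T U v = sqrt (\<Sum>t\<in>U. eta_elt_sq P T t v)"

definition eta_well_defined :: "'a::euclidean_space problem \<Rightarrow> 'a mesh \<Rightarrow> ('a \<Rightarrow> real) \<Rightarrow> bool" where
  "eta_well_defined P T v \<longleftrightarrow> (\<forall>t\<in>T.
     (\<exists>h. sq_int (interior (elt_set t)) h \<and>
          is_weak_div (interior (elt_set t)) (total_flux P v) h) \<and>
     (\<forall>E\<in>faces t.
        (AE x in face_measure E. x \<in> convex hull E \<inter> Omega P \<longrightarrow>
           has_trace t (total_flux P v) x \<and> has_trace (neighbour T t E) (total_flux P v) x) \<and>
        set_integrable (face_measure E) (convex hull E \<inter> Omega P)
          (\<lambda>x. (normal_jump T t E (total_flux P v) x)\<^sup>2)))"


section \<open>The adaptive algorithm\<close>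

record params =
  theta :: real
  Cmark :: real
  lambda_lin :: real
  rho :: real
  tau :: real
  alpha_min0 :: real
  Jmax0 :: nat

text \<open>
  The history of a run. The fields are total functions; only the entries with indices reached by
  the run are meaningful. \<open>alpha_min R l k\<close> and \<open>Jmax R l k\<close> are the values of these program
  variables during the \<open>j\<close>-loop with indices \<open>(l, k)\<close>.
\<close>

record 'a run =
  meshes :: "nat \<Rightarrow> 'a mesh"
  marked :: "nat \<Rightarrow> 'a mesh"
  iter :: "nat \<Rightarrow> nat \<Rightarrow> nat \<Rightarrow> 'a \<Rightarrow> real"
  star :: "nat \<Rightarrow> nat \<Rightarrow> 'a \<Rightarrow> real"
  alpha_min :: "nat \<Rightarrow> nat \<Rightarrow> real"
  Jmax :: "nat \<Rightarrow> nat \<Rightarrow> nat"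

text \<open>In the stopping criteria, the last iterate of the previous \<open>j\<close>-loop is accessed as
  \<open>iter R l k 0\<close>, to which it has been assigned at the start of the current one.\<close>

definition tau_stop :: "'a::euclidean_space problem \<Rightarrow> params \<Rightarrow> 'a run \<Rightarrow> nat \<Rightarrow> nat \<Rightarrow> nat \<Rightarrow> bool" where
  "tau_stop P A R l k j \<longleftrightarrow>
     eta P (meshes R l) (meshes R l) (iter R l k j)
     + enorm P (iter R l k j - iter R l k 0)
     + enorm P (iter R l k j - iter R l k (j - 1)) \<le> tau A"

definition alpha_quot :: "'a::euclidean_space problem \<Rightarrow> 'a run \<Rightarrow> nat \<Rightarrow> nat \<Rightarrow> nat \<Rightarrow> real" where
  "alpha_quot P R l k j =
     dsq P (iter R l k j) (iter R l k 0) / (enorm P (iter R l k j - iter R l k 0))\<^sup>2"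

definition leave_j :: "'a::euclidean_space problem \<Rightarrow> 'a run \<Rightarrow> nat \<Rightarrow> nat \<Rightarrow> nat \<Rightarrow> bool" where
  "leave_j P R l k j \<longleftrightarrow>
     alpha_quot P R l k j \<ge> alpha_min R l k \<or>
     eq_ae (Omega P) (iter R l k j) (iter R l k 0) \<or>
     (alpha_quot P R l k j > 0 \<and> j > Jmax R l k)"

definition leave_k :: "'a::euclidean_space problem \<Rightarrow> params \<Rightarrow> 'a run \<Rightarrow> nat \<Rightarrow> nat \<Rightarrow> nat \<Rightarrow> bool" where
  "leave_k P A R l k j \<longleftrightarrow>
     dsq P (iter R l k j) (iter R l k 0)
       \<le> lambda_lin A * (eta P (meshes R l) (meshes R l) (iter R l k j))\<^sup>2"

definition j_done :: "'a::euclidean_space problem \<Rightarrow> params \<Rightarrow> 'a run \<Rightarrow> nat \<Rightarrow> nat \<Rightarrow> nat \<Rightarrow> bool" where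
  "j_done P A R l k j \<longleftrightarrow> 1 \<le> k \<and> 1 \<le> j \<and> \<not> tau_stop P A R l k j \<and> leave_j P R l k j"

inductive_set Qset :: "'a::euclidean_space problem \<Rightarrow> params \<Rightarrow> 'a run \<Rightarrow> (nat \<times> nat \<times> nat) set"
  for P A R where
  start: "(0, 0, 0) \<in> Qset P A R"
| first_k: "(l, 0, 0) \<in> Qset P A R \<Longrightarrow> (l, 1, 0) \<in> Qset P A R"
| first_j: "(l, k, 0) \<in> Qset P A R \<Longrightarrow> 1 \<le> k \<Longrightarrow> (l, k, 1) \<in> Qset P A R"
| next_j: "(l, k, j) \<in> Qset P A R \<Longrightarrow> 1 \<le> k \<Longrightarrow> 1 \<le> j \<Longrightarrow> \<not> tau_stop P A R l k j \<Longrightarrow>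
    \<not> leave_j P R l k j \<Longrightarrow> (l, k, Suc j) \<in> Qset P A R"
| next_k: "(l, k, j) \<in> Qset P A R \<Longrightarrow> j_done P A R l k j \<Longrightarrow> \<not> leave_k P A R l k j \<Longrightarrow>
    (l, Suc k, 0) \<in> Qset P A R"
| next_l: "(l, k, j) \<in> Qset P A R \<Longrightarrow> j_done P A R l k j \<Longrightarrow> leave_k P A R l k j \<Longrightarrow>
    (Suc l, 0, 0) \<in> Qset P A R"

definition alpha_min_upd :: "params \<Rightarrow> 'a run \<Rightarrow> nat \<Rightarrow> nat \<Rightarrow> nat \<Rightarrow> real" where
  "alpha_min_upd A R l k j =
     (if j > Jmax R l k then rho A * alpha_min R l k else alpha_min R l k)"

definition Jmax_upd :: "'a run \<Rightarrow> nat \<Rightarrow> nat \<Rightarrow> nat \<Rightarrow> nat" where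
  "Jmax_upd R l k j = (if j > Jmax R l k then j else Jmax R l k)"

definition doerfler :: "'a::euclidean_space problem \<Rightarrow> params \<Rightarrow> 'a mesh \<Rightarrow> ('a \<Rightarrow> real) \<Rightarrow> 'a mesh \<Rightarrow> bool" where
  "doerfler P A T v M \<longleftrightarrow> M \<subseteq> T \<and> theta A * (eta P T T v)\<^sup>2 \<le> (eta P T M v)\<^sup>2"

definition ailfem_run :: "'a::euclidean_space problem \<Rightarrow> 'a mesh \<Rightarrow>
    ('a mesh \<Rightarrow> ('a \<Rightarrow> real) \<Rightarrow> 'a \<Rightarrow> real) \<Rightarrow>
    ('a mesh \<Rightarrow> ('a \<Rightarrow> real) \<Rightarrow> ('a \<Rightarrow> real) \<Rightarrow> 'a \<Rightarrow> real) \<Rightarrow>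
    ('a \<Rightarrow> real) \<Rightarrow> params \<Rightarrow> 'a run \<Rightarrow> bool" where
  "ailfem_run P T0 \<Phi> \<Psi> u0 A R \<longleftrightarrow>
     meshes R 0 = T0 \<and> iter R 0 0 0 = u0 \<and>
     alpha_min R 0 1 = alpha_min0 A \<and> Jmax R 0 1 = Jmax0 A \<and>
     (\<forall>l. (l, 0, 0) \<in> Qset P A R \<longrightarrow>
        star R l 0 = iter R l 0 0 \<and> iter R l 1 0 = iter R l 0 0) \<and>
     (\<forall>l k. (l, k, 0) \<in> Qset P A R \<and> 1 \<le> k \<longrightarrow>
        star R l k = \<Phi> (meshes R l) (iter R l k 0)) \<and>
     (\<forall>l k j. (l, k, Suc j) \<in> Qset P A R \<longrightarrow>
        iter R l k (Suc j) = \<Psi> (meshes R l) (star R l k) (iter R l k j)) \<and>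
     (\<forall>l k j. (l, k, j) \<in> Qset P A R \<and> j_done P A R l k j \<and> \<not> leave_k P A R l k j \<longrightarrow>
        iter R l (Suc k) 0 = iter R l k j \<and>
        alpha_min R l (Suc k) = alpha_min_upd A R l k j \<and>
        Jmax R l (Suc k) = Jmax_upd R l k j) \<and>
     (\<forall>l k j. (l, k, j) \<in> Qset P A R \<and> j_done P A R l k j \<and> leave_k P A R l k j \<longrightarrow>
        doerfler P A (meshes R l) (iter R l k j) (marked R l) \<and>
        (\<forall>M. doerfler P A (meshes R l) (iter R l k j) M \<longrightarrow>
           real (card (marked R l)) \<le> Cmark A * real (card M)) \<and>
        meshes R (Suc l) = refine (meshes R l) (marked R l) \<and>
        iter R (Suc l) 0 0 = iter R l k j \<and>
        alpha_min R (Suc l) 1 = alpha_min_upd A R l k j \<and>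
        Jmax R (Suc l) 1 = Jmax_upd R l k j)"

definition jlast :: "'a::euclidean_space problem \<Rightarrow> params \<Rightarrow> 'a run \<Rightarrow> nat \<Rightarrow> nat \<Rightarrow> enat" where
  "jlast P A R l k = (SUP j\<in>{j. (l, k, j) \<in> Qset P A R}. enat j)"

definition iter_last :: "'a::euclidean_space problem \<Rightarrow> params \<Rightarrow> 'a run \<Rightarrow> nat \<Rightarrow> nat \<Rightarrow> 'a \<Rightarrow> real" where
  "iter_last P A R l k = iter R l k (the_enat (jlast P A R l k))"

text \<open>
  With a positive tolerance, the termination test precedes the energy criterion of the \<open>j\<close>-loop.
  The algorithm may hence terminate, after finitely many solver steps, at an iterate that differs
  from \<open>iter R l k 0\<close> without having decreased the energy. This happens at most once in a run,
  and never if \<open>tau A = 0\<close>.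
\<close>

definition tau_stop_without_decrease ::
    "'a::euclidean_space problem \<Rightarrow> params \<Rightarrow> 'a run \<Rightarrow> nat \<Rightarrow> nat \<Rightarrow> bool" where
  "tau_stop_without_decrease P A R l k \<longleftrightarrow> 0 < tau A \<and>
     (\<exists>j\<ge>1. (l, k, j) \<in> Qset P A R \<and> tau_stop P A R l k j \<and>
        dsq P (iter R l k j) (iter R l k 0) \<le> 0 \<and>
        \<not> eq_ae (Omega P) (iter R l k j) (iter R l k 0))"

end

theory Submission
  imports Defs
begin

text \<open>
  Let \<open>u\<close> be the initial iterate of a \<open>j\<close>-loop, \<open>s = \<Phi> T u\<close> the exact linearized solution and \<open>v\<close> the
  \<open>j\<close>-th solver iterate, so that \<open>|||s - v||| \<le> q\<^sup>j |||s - u|||\<close>. Lipschitz continuity of the flux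
  bounds \<open>\<E> v - \<E> s\<close> by the derivative of \<open>\<E>\<close> at \<open>s\<close> in direction \<open>v - s\<close> plus a quadratic term, and
  by the equation for \<open>s\<close> this derivative is at most \<open>(L + C\<^bsub>cnt\<^esub>) |||s - u||| |||v - s|||\<close>. Hence the
  energy decrease of \<open>v\<close> falls short of that of \<open>s\<close> only by \<open>O(q\<^sup>j) |||s - u|||\<^sup>2\<close>, which gives (i).
  Consequently \<open>alpha_quot\<close> stays above a fixed constant for \<open>j \<ge> J\<close>, so every \<open>j\<close>-loop ends at the
  latest with \<open>j = max J (Jmax + 1)\<close>. Each late exit shrinks \<open>alpha_min\<close> by the factor \<open>\<rho>\<close>;
  after finitely many of them \<open>alpha_min\<close> is below that constant and \<open>Jmax\<close> stops growing beyond a fixed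
  bound. Thus only finitely many \<open>j\<close>-loops end with \<open>alpha_quot < alpha_min\<close>, and the constant in (ii)
  is a minimum over these loops and a positive lower bound of \<open>alpha_min\<close>.

  The definition of \<open>wgrad\<close> by choice makes \<open>u \<mapsto> |||u|||\<close> a seminorm on \<open>H\<^sup>1\<^sub>0\<close> only after
  weak gradients are known to be unique (fundamental lemma of the calculus of variations), and
  \<open>|||u - v||| = 0\<close> implies \<open>u = v\<close> almost everywhere by the inequality of Poincare--Friedrichs.
\<close>

section \<open>Test functions\<close>

text \<open>\<open>Ck\<close> is phrased with \<open>frechet_derivative\<close>, which is obtained
  by choice. Derivatives at a point are unique, so any derivative found by the calculus rules can
  take its place.\<close>

lemma Ck_SucI:
  assumes D: "\<And>x. (f has_derivative f' x) (at x)" and C: "\<And>b. b \<in> Basis \<Longrightarrow> Ck k (\<lambda>x. f' x b)"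
  shows "Ck (Suc k) f"
proof -
  have "frechet_derivative f (at x) = f' x" for x
    using frechet_derivative_at[OF D] by simp
  then show ?thesis using D C by (auto simp: differentiable_def)
qed

lemma Ck_continuous: "Ck k f \<Longrightarrow> continuous_on UNIV f"
  by (cases k) (auto simp: differentiable_imp_continuous_within continuous_on_eq_continuous_within)

lemma Ck_SucD: "Ck (Suc k) f \<Longrightarrow> Ck k f"
proof (induction k arbitrary: f)
  case 0
  then show ?case using Ck_continuous[of "Suc 0" f] by simp
next
  case (Suc k)
  then show ?case by (metis Ck.simps(2))
qed

lemma Ck_const: "Ck k (\<lambda>x. c)"
  by (induction k arbitrary: c) (auto intro: Ck_SucI[where f'="\<lambda>x h. 0"] simp del: Ck.simps(2))

lemma Ck_lincomb: "Ck k f \<Longrightarrow> Ck k g \<Longrightarrow> Ck k (\<lambda>x. r * f x + s * g x)"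
proof (induction k arbitrary: f g)
  case 0
  then show ?case by (auto intro!: continuous_intros)
next
  case (Suc k)
  then have D: "\<And>x. (f has_derivative frechet_derivative f (at x)) (at x)"
    "\<And>x. (g has_derivative frechet_derivative g (at x)) (at x)"
    by (auto simp: frechet_derivative_works)
  show ?case
    by (rule Ck_SucI[OF has_derivative_add[OF has_derivative_mult_right[OF D(1)] has_derivative_mult_right[OF D(2)]]])
       (use Suc in \<open>auto intro!: Suc.IH\<close>)
qed

lemma Ck_mult: "Ck k f \<Longrightarrow> Ck k g \<Longrightarrow> Ck k (\<lambda>x. f x * g x)"
proof (induction k arbitrary: f g)
  case 0
  then show ?case by (auto intro!: continuous_intros)
next
  case (Suc k)
  then have D: "\<And>x. (f has_derivative frechet_derivative f (at x)) (at x)"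
    "\<And>x. (g has_derivative frechet_derivative g (at x)) (at x)"
    by (auto simp: frechet_derivative_works)
  have "Ck k (\<lambda>x. 1 * (f x * frechet_derivative g (at x) b) + 1 * (frechet_derivative f (at x) b * g x))"
    if "b \<in> Basis" for b
    using Suc that Ck_SucD[of k] by (intro Ck_lincomb Suc.IH) auto
  then show ?case
    by (intro Ck_SucI[OF has_derivative_mult[OF D]]) simp
qed

lemma Ck_prod: "finite S \<Longrightarrow> (\<And>i. i \<in> S \<Longrightarrow> Ck k (f i)) \<Longrightarrow> Ck k (\<lambda>x. \<Prod>i\<in>S. f i x)"
  by (induction S rule: finite_induct) (auto intro: Ck_const Ck_mult)

text \<open>A whole sequence is treated at once: differentiating \<open>H i\<close> along a basis
  vector only raises \<open>i\<close> and adds a constant factor, so the induction on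
  \<open>k\<close> closes with \<open>i\<close> arbitrary.\<close>

lemma Ck_inner_compose:
  fixes w :: "'a::euclidean_space"
  assumes H: "\<And>i t. (H i has_real_derivative H (Suc i) t) (at t)"
  shows "Ck k (\<lambda>x. H i (w \<bullet> x + c))"
proof (induction k arbitrary: i)
  case 0
  have "continuous_on UNIV (H i)"
    using H by (meson DERIV_isCont continuous_at_imp_continuous_on)
  then show ?case by (auto intro!: continuous_on_compose2[of UNIV "H i"] continuous_intros)
next
  case (Suc k)
  have D: "((\<lambda>x. H i (w \<bullet> x + c)) has_derivative (\<lambda>h. H (Suc i) (w \<bullet> x + c) * (w \<bullet> h))) (at x)" for x
  proof (rule has_derivative_compose[where f="\<lambda>x. w \<bullet> x + c" and f'="\<lambda>h. w \<bullet> h" and g="H i"])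
    show "(H i has_derivative (*) (H (Suc i) (w \<bullet> x + c))) (at (w \<bullet> x + c))"
      using H by (simp add: has_field_derivative_def)
  qed (auto intro!: derivative_eq_intros)
  show ?case
    by (rule Ck_SucI[OF D]) (intro Ck_mult Suc Ck_const)
qed

section \<open>Smooth bump functions supported in boxes\<close>

definition flat :: "real poly \<Rightarrow> real \<Rightarrow> real" where
  "flat p t = (if t \<le> 0 then 0 else poly p (1 / t) * exp (- (1 / t)))"

lemma poly_exp_tendsto_0: "((\<lambda>x. poly p x * exp (- x)) \<longlongrightarrow> (0::real)) at_top"
proof -
  have "((\<lambda>x. \<Sum>i\<le>degree p. coeff p i * (x ^ i / exp x)) \<longlongrightarrow> (\<Sum>i\<le>degree p. coeff p i * 0)) at_top"
    by (intro tendsto_intros tendsto_power_div_exp_0)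
  moreover have "(\<lambda>x. poly p x * exp (- x)) = (\<lambda>x. \<Sum>i\<le>degree p. coeff p i * (x ^ i / exp x))"
    by (rule ext) (auto simp: poly_altdef sum_distrib_right exp_minus divide_inverse mult.assoc)
  ultimately show ?thesis by simp
qed

text \<open>With x = 1/t, the derivative of p(x) exp(-x) with respect to t is x^2 (p(x) - p'(x))
  exp(-x). Taking a polynomial as the parameter of \<open>flat\<close> thus makes the family closed
  under differentiation.\<close>

definition flat_deriv :: "real poly \<Rightarrow> real poly" where
  "flat_deriv p = [:0, 0, 1:] * (p - pderiv p)"

lemma flat_has_derivative: "(flat p has_real_derivative flat (flat_deriv p) t) (at t)"
proof -
  consider "t < 0" | "t = 0" | "t > 0" by linarith
  then show ?thesis
  proof cases
    case 1
    have "((\<lambda>_. 0) has_real_derivative flat (flat_deriv p) t) (at t)"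
      using 1 by (auto simp: flat_def)
    then show ?thesis
      by (rule has_field_derivative_transform_within_open[OF _ open_lessThan[of 0]]) (use 1 in \<open>auto simp: flat_def\<close>)
  next
    case 2
    have "((\<lambda>h. (flat p (0 + h) - flat p 0) / h) \<longlongrightarrow> 0) (at_left 0)"
      by (rule tendsto_eventually) (auto simp: flat_def eventually_at_left_field intro: exI[of _ "-1"])
    \<comment> \<open>The quotient from the left is identically zero. From the right it equals x
      p(x) exp(-x) with x = 1/h, which tends to zero as x grows.\<close>
    moreover have "((\<lambda>h. (flat p (0 + h) - flat p 0) / h) \<longlongrightarrow> 0) (at_right 0)"
    proof (rule Lim_transform_eventually)
      show "((\<lambda>h. poly ([:0, 1:] * p) (inverse h) * exp (- inverse h)) \<longlongrightarrow> 0) (at_right (0::real))"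
        by (rule filterlim_compose[OF poly_exp_tendsto_0 filterlim_inverse_at_top_right])
      show "\<forall>\<^sub>F h in at_right 0. poly ([:0, 1:] * p) (inverse h) * exp (- inverse h) = (flat p (0 + h) - flat p 0) / h"
        by (auto simp: flat_def eventually_at_right_field field_simps intro!: exI[of _ 1])
    qed
    ultimately show ?thesis
      using 2 by (simp add: DERIV_def filterlim_split_at flat_def)
  next
    case 3
    have "((\<lambda>t. poly p (1 / t) * exp (- (1 / t))) has_real_derivative flat (flat_deriv p) t) (at t)"
      using 3 by (auto intro!: derivative_eq_intros poly_DERIV[THEN DERIV_chain2] simp: flat_def flat_deriv_def field_simps power2_eq_square)
    then show ?thesis
      by (rule has_field_derivative_transform_within_open[OF _ open_greaterThan[of 0]]) (use 3 in \<open>auto simp: flat_def\<close>)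
  qed
qed

lemma flat_1_range: "0 \<le> flat 1 t" "flat 1 t \<le> 1"
  by (auto simp: flat_def)

lemma flat_1_scaled_tendsto: "(\<lambda>n. flat 1 (real n * t)) \<longlonglongrightarrow> (if 0 < t then 1 else 0)"
proof (cases "0 < t")
  case True
  have "(\<lambda>n. exp (- (1 / t * inverse (real n)))) \<longlonglongrightarrow> exp (- (1 / t * 0))"
    by (intro tendsto_intros lim_inverse_n)
  moreover have "\<forall>\<^sub>F n in sequentially. exp (- (1 / t * inverse (real n))) = flat 1 (real n * t)"
    using eventually_gt_at_top[of 0] by eventually_elim (use True in \<open>auto simp: flat_def field_simps mult_le_0_iff\<close>)
  ultimately show ?thesis using True by (auto intro: Lim_transform_eventually)
next
  case False
  then have "flat 1 (real n * t) = 0" for n by (auto simp: flat_def mult_le_0_iff)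
  then show ?thesis using False by simp
qed

text \<open>Each factor tends to 1 where its argument is positive and is 0 elsewhere. As
  \<open>n\<close> grows, these smooth functions with values in [0,1] therefore approximate the
  indicator of the open box pointwise.\<close>

definition box_bump :: "'a::euclidean_space \<Rightarrow> 'a \<Rightarrow> nat \<Rightarrow> 'a \<Rightarrow> real" where
  "box_bump c d n x = (\<Prod>b\<in>Basis. flat 1 (real n * (x \<bullet> b - c \<bullet> b)) * flat 1 (real n * (d \<bullet> b - x \<bullet> b)))"

lemma Ck_box_bump: "Ck k (box_bump c d n)"
proof -
  define H where "H i = flat ((flat_deriv ^^ i) 1)" for i
  have H: "(H i has_real_derivative H (Suc i) t) (at t)" for i t
    using flat_has_derivative by (simp add: H_def)
  have "Ck k (\<lambda>x. flat 1 (real n * (x \<bullet> b - c \<bullet> b)))" for b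
    using Ck_inner_compose[of H k 0 "real n *\<^sub>R b" "- real n * (c \<bullet> b)", OF H]
    by (simp add: H_def algebra_simps inner_commute)
  moreover have "Ck k (\<lambda>x. flat 1 (real n * (d \<bullet> b - x \<bullet> b)))" for b
    using Ck_inner_compose[of H k 0 "- real n *\<^sub>R b" "real n * (d \<bullet> b)", OF H]
    by (simp add: H_def algebra_simps inner_commute)
  ultimately show ?thesis unfolding box_bump_def by (intro Ck_prod Ck_mult) auto
qed

lemma box_bump_nonzero: "box_bump c d n x \<noteq> 0 \<Longrightarrow> x \<in> box c d"
  by (auto simp: box_bump_def mem_box flat_def mult_le_0_iff not_le split: if_splits)

lemma box_bump_range: "0 \<le> box_bump c d n x" "box_bump c d n x \<le> 1"
  unfolding box_bump_def
  by (auto intro!: prod_nonneg prod_le_1 mult_nonneg_nonneg mult_le_one flat_1_range)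

lemma box_bump_tendsto: "(\<lambda>n. box_bump c d n x) \<longlonglongrightarrow> indicator (box c d) x"
proof -
  have "(\<lambda>n. box_bump c d n x) \<longlonglongrightarrow>
      (\<Prod>b\<in>Basis. (if 0 < x \<bullet> b - c \<bullet> b then 1 else 0) * (if 0 < d \<bullet> b - x \<bullet> b then 1 else 0 :: real))"
      (is "_ \<longlonglongrightarrow> ?l")
    unfolding box_bump_def by (intro tendsto_intros flat_1_scaled_tendsto)
  also have "?l = indicator (box c d) x"
  proof (cases "x \<in> box c d")
    case False
    then obtain b where "b \<in> Basis" "\<not> (c \<bullet> b < x \<bullet> b \<and> x \<bullet> b < d \<bullet> b)" by (auto simp: mem_box)
    then show ?thesis using False by (subst prod_zero_iff[THEN iffD2]) (auto intro!: bexI[of _ b])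
  qed (auto simp: mem_box)
  finally show ?thesis .
qed

lemma test_fun_box_bump:
  assumes "cbox c d \<subseteq> \<Omega>"
  shows "test_fun \<Omega> (box_bump c d n)"
proof -
  have "closure {x. box_bump c d n x \<noteq> 0} \<subseteq> cbox c d"
    by (rule closure_minimal) (use box_bump_nonzero box_subset_cbox in \<open>blast+ | simp\<close>)+
  moreover from this have "compact (closure {x. box_bump c d n x \<noteq> 0})"
    by (metis bounded_cbox bounded_subset compact_closure bounded_closure compact_eq_bounded_closed closed_closure)
  ultimately show ?thesis using assms Ck_box_bump by (auto simp: test_fun_def)
qed

section \<open>Bounds and differences of test functions\<close>

lemma test_fun_continuous: "test_fun \<Omega> \<phi> \<Longrightarrow> continuous_on UNIV \<phi>"
  by (auto simp: test_fun_def intro: Ck_continuous)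

lemma test_fun_differentiable:
  "test_fun \<Omega> \<phi> \<Longrightarrow> (\<phi> has_derivative frechet_derivative \<phi> (at x)) (at x)"
  unfolding test_fun_def frechet_derivative_works[symmetric] by (metis Ck.simps(2))

lemma test_fun_frechet_continuous:
  "test_fun \<Omega> \<phi> \<Longrightarrow> b \<in> Basis \<Longrightarrow> continuous_on UNIV (\<lambda>x. frechet_derivative \<phi> (at x) b)"
  unfolding test_fun_def by (metis Ck.simps)

lemma test_fun_gradient_continuous: "test_fun \<Omega> \<phi> \<Longrightarrow> continuous_on UNIV (gradient \<phi>)"
  unfolding gradient_def by (intro continuous_intros test_fun_frechet_continuous)

lemma test_fun_zero_outside:
  assumes "test_fun \<Omega> \<phi>" "x \<notin> closure {x. \<phi> x \<noteq> 0}"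
  shows "\<phi> x = 0" "gradient \<phi> x = 0"
proof -
  obtain K where K: "K = closure {x. \<phi> x \<noteq> 0}" by simp
  have "{x. \<phi> x \<noteq> 0} \<subseteq> K" unfolding K by (rule closure_subset)
  then have Z: "\<phi> y = 0" if "y \<in> - K" for y
    using that by blast
  have x: "x \<in> - K" using assms(2) unfolding K by simp
  show "\<phi> x = 0" using x by (rule Z)
  have "(\<phi> has_derivative (\<lambda>h. 0)) (at x)"
  proof (rule has_derivative_transform_within_open[OF has_derivative_const[of 0] _ x])
    show "open (- K)" unfolding K by (intro open_Compl closed_closure)
    show "0 = \<phi> y" if "y \<in> - K" for y using Z[OF that] by (rule sym)
  qed
  then have "frechet_derivative \<phi> (at x) = (\<lambda>h. 0)" by (rule frechet_derivative_at[symmetric])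
  then show "gradient \<phi> x = 0" by (simp add: gradient_def)
qed

lemma compactly_supported_bounded:
  fixes f :: "'a::euclidean_space \<Rightarrow> 'b::real_normed_vector"
  assumes "compact K" "continuous_on UNIV f" "\<And>x. x \<notin> K \<Longrightarrow> f x = 0"
  obtains B where "0 \<le> B" "\<And>x. norm (f x) \<le> B"
proof -
  have "compact (f ` K)" using assms by (auto intro: compact_continuous_image continuous_on_subset)
  then obtain B where B: "\<forall>y\<in>f ` K. norm y \<le> B" using compact_imp_bounded bounded_iff by blast
  show thesis
  proof
    show "0 \<le> max 0 B" by simp
    show "norm (f x) \<le> max 0 B" for x using B assms(3)[of x] by (cases "x \<in> K") (auto simp: le_max_iff_disj)
  qed
qed

lemma test_fun_bounded:
  assumes "test_fun \<Omega> \<phi>"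
  obtains B where "0 \<le> B" "\<And>x. \<bar>\<phi> x\<bar> \<le> B" "\<And>x. norm (gradient \<phi> x) \<le> B"
proof -
  let ?K = "closure {x. \<phi> x \<noteq> 0}"
  have K: "compact ?K" using assms by (simp add: test_fun_def)
  obtain B1 where B1: "0 \<le> B1" "\<And>x. norm (\<phi> x) \<le> B1"
    using compactly_supported_bounded[OF K test_fun_continuous[OF assms] test_fun_zero_outside(1)[OF assms]] by blast
  obtain B2 where B2: "0 \<le> B2" "\<And>x. norm (gradient \<phi> x) \<le> B2"
    using compactly_supported_bounded[OF K test_fun_gradient_continuous[OF assms] test_fun_zero_outside(2)[OF assms]] by blast
  show thesis
  proof
    show "0 \<le> B1 + B2" "\<bar>\<phi> x\<bar> \<le> B1 + B2" "norm (gradient \<phi> x) \<le> B1 + B2" for x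
      using B1 B2 by (auto intro: add_increasing add_increasing2)
  qed
qed

lemma test_fun_diff:
  assumes "test_fun \<Omega> \<phi>" "test_fun \<Omega> \<psi>"
  shows "test_fun \<Omega> (\<phi> - \<psi>)" "gradient (\<phi> - \<psi>) x = gradient \<phi> x - gradient \<psi> x"
proof -
  have "Ck k (\<phi> - \<psi>)" for k
    using Ck_lincomb[of k \<phi> \<psi> 1 "-1"] assms by (simp add: test_fun_def fun_diff_def)
  moreover have S: "closure {x. (\<phi> - \<psi>) x \<noteq> 0} \<subseteq> closure {x. \<phi> x \<noteq> 0} \<union> closure {x. \<psi> x \<noteq> 0}"
    unfolding closure_Un[symmetric] by (rule closure_mono) auto
  moreover have "compact (closure {x. (\<phi> - \<psi>) x \<noteq> 0})"
    using assms S unfolding test_fun_def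
    by (meson bounded_Un bounded_subset closed_closure compact_eq_bounded_closed)
  ultimately show "test_fun \<Omega> (\<phi> - \<psi>)" using assms unfolding test_fun_def by blast
  have "((\<lambda>x. \<phi> x - \<psi> x) has_derivative
      (\<lambda>h. frechet_derivative \<phi> (at x) h - frechet_derivative \<psi> (at x) h)) (at x)"
    by (intro has_derivative_diff test_fun_differentiable[OF assms(1)] test_fun_differentiable[OF assms(2)])
  from frechet_derivative_at[OF this] 
  have "frechet_derivative (\<phi> - \<psi>) (at x) = (\<lambda>h. frechet_derivative \<phi> (at x) h - frechet_derivative \<psi> (at x) h)"
    by (simp add: fun_diff_def)
  then show "gradient (\<phi> - \<psi>) x = gradient \<phi> x - gradient \<psi> x"
    by (simp add: gradient_def sum_subtractf algebra_simps)
qed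

text \<open>Open boxes are an intersection-stable generator of the Borel sets, so a Dynkin-class
  induction extends the vanishing integrals from boxes to all Borel sets. Then \<open>f\<close> and
  0 are densities of the same set function and agree almost everywhere.\<close>

lemma AE_zero_if_box_integrals_zero:
  fixes f :: "'a::euclidean_space \<Rightarrow> real"
  assumes f: "integrable lborel f" and box: "\<And>c d. (\<integral>x. indicator (box c d) x * f x \<partial>lborel) = 0"
  shows "AE x in lborel. f x = 0"
proof -
  let ?E = "range (\<lambda>(c, d). box c d :: 'a set)"
  have int: "integrable lborel (\<lambda>x. indicator A x * f x)" if "A \<in> sets borel" for A :: "'a set"
    using integrable_mult_indicator[of A lborel f] f that by simp
  \<comment> \<open>The complement case of the induction needs the integral over the whole space,
    which is the limit of integrals over growing cubes.\<close>
  have total: "(\<integral>x. f x \<partial>lborel) = 0"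
  proof -
    have "(\<lambda>n. \<integral>x. indicator (box (- real n *\<^sub>R One) (real n *\<^sub>R One)) x * f x \<partial>lborel) \<longlonglongrightarrow> (\<integral>x. f x \<partial>lborel)"
    proof (rule integral_dominated_convergence[where w="\<lambda>x. norm (f x)"])
      show "AE x in lborel. (\<lambda>n. indicator (box (- real n *\<^sub>R One) (real n *\<^sub>R One)) x * f x) \<longlonglongrightarrow> f x"
      proof (rule AE_I2, rule tendsto_eventually)
        fix x :: 'a
        obtain N :: nat where N: "norm x < real N" using reals_Archimedean2 by blast
        show "\<forall>\<^sub>F n in sequentially. indicator (box (- real n *\<^sub>R One) (real n *\<^sub>R One)) x * f x = f x"
          using eventually_ge_at_top[of N]
        proof eventually_elim
          case (elim n)
          have "\<bar>x \<bullet> b\<bar> < real n" if "b \<in> Basis" for b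
            using Basis_le_norm[OF that, of x] N elim by linarith
          then have "x \<in> box (- real n *\<^sub>R One) (real n *\<^sub>R One)"
            by (auto simp: mem_box abs_less_iff minus_less_iff)
          then show ?case by simp
        qed
      qed
    qed (use f in \<open>auto simp: indicator_def\<close>)
    then show ?thesis using box by (simp add: LIMSEQ_const_iff)
  qed
  have zero: "(\<integral>x. indicator A x * f x \<partial>lborel) = 0" if "A \<in> sigma_sets UNIV ?E" for A
  proof -
    have int_stable: "Int_stable ?E" by (auto simp: Int_stable_def box_Int_box)
    have subset_Pow: "?E \<subseteq> Pow UNIV" by simp
    have borel: "sets borel = sigma_sets UNIV ?E"
      by (simp add: borel_eq_box)
    show ?thesis
      using that
    proof (induction rule: sigma_sets_induct_disjoint[OF int_stable subset_Pow, consumes 1, case_names basic empty compl union])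
      case (basic A)
      then show ?case using box by auto
    next
      case empty
      then show ?case by simp
    next
      case (compl A)
      have "(\<integral>x. indicator (UNIV - A) x * f x \<partial>lborel) = (\<integral>x. f x - indicator A x * f x \<partial>lborel)"
        by (intro Bochner_Integration.integral_cong) (auto simp: indicator_def)
      then show ?case using compl f int[of A] total borel by simp
    next
      case (union A)
      have [measurable]: "A i \<in> sets borel" for i using union borel by auto
      have [measurable]: "f \<in> borel_measurable borel" using borel_measurable_integrable[OF f] by simp
      have "(\<lambda>n. \<integral>x. indicator (\<Union>i<n. A i) x * f x \<partial>lborel) \<longlonglongrightarrow> (\<integral>x. indicator (\<Union>i. A i) x * f x \<partial>lborel)"
      proof (rule integral_dominated_convergence[where w="\<lambda>x. norm (f x)"])
        show "AE x in lborel. (\<lambda>n. indicator (\<Union>i<n. A i) x * f x) \<longlonglongrightarrow> indicator (\<Union>i. A i) x * f x"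
          by (intro AE_I2 tendsto_mult_right LIMSEQ_indicator_UN)
        show "(\<lambda>x. indicator (\<Union>i. A i) x * f x) \<in> borel_measurable lborel"
          "(\<lambda>x. indicator (\<Union>i<n. A i) x * f x) \<in> borel_measurable lborel" for n
          by measurable
      qed (use f in \<open>auto simp: indicator_def\<close>)
      moreover have "(\<integral>x. indicator (\<Union>i<n. A i) x * f x \<partial>lborel) = 0" for n
      proof -
        have "(\<integral>x. indicator (\<Union>i<n. A i) x * f x \<partial>lborel) = (\<integral>x. (\<Sum>i<n. indicator (A i) x * f x) \<partial>lborel)"
          using disjoint_family_on_mono[OF subset_UNIV union(1)]
          by (intro Bochner_Integration.integral_cong refl)
            (subst indicator_UN_disjoint, simp_all add: sum_distrib_right)
        also have "\<dots> = 0" using union int borel by (subst Bochner_Integration.integral_sum) auto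
        finally show ?thesis .
      qed
      ultimately show ?case by (simp add: LIMSEQ_const_iff)
    qed
  qed
  have "AE x in lborel. f x = (\<lambda>_. 0) x"
    by (rule density_unique_real) (use f zero in \<open>auto simp: set_lebesgue_integral_def borel_eq_box\<close>)
  then show ?thesis by simp
qed

section \<open>The fundamental lemma of the calculus of variations\<close>

text \<open>Testing with \<open>box_bump\<close> and passing to the limit by dominated convergence
  gives zero integrals over all boxes whose closure lies in the domain. Inside one such box this
  forces \<open>g\<close> to vanish almost everywhere, and countably many of these boxes cover the
  domain.\<close>

lemma fundamental_lemma_variations:
  fixes g :: "'a::euclidean_space \<Rightarrow> real"
  assumes \<Omega>: "open \<Omega>" and g: "integrable (lebesgue_on \<Omega>) g"
    and zero: "\<And>\<phi>. test_fun \<Omega> \<phi> \<Longrightarrow> (LINT x|lebesgue_on \<Omega>. \<phi> x * g x) = 0"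
  shows "AE x in lebesgue_on \<Omega>. g x = 0"
proof -
  have L: "\<Omega> \<in> sets lebesgue" using \<Omega> by simp
  have box_zero: "(LINT x|lebesgue_on \<Omega>. indicator (box c d) x * g x) = 0" if "cbox c d \<subseteq> \<Omega>" for c d
  proof -
    have "(\<lambda>n. LINT x|lebesgue_on \<Omega>. box_bump c d n x * g x) \<longlonglongrightarrow> (LINT x|lebesgue_on \<Omega>. indicator (box c d) x * g x)"
    proof (rule integral_dominated_convergence[where w="\<lambda>x. norm (g x)"])
      show "AE x in lebesgue_on \<Omega>. (\<lambda>n. box_bump c d n x * g x) \<longlonglongrightarrow> indicator (box c d) x * g x"
        by (intro AE_I2 tendsto_mult_right box_bump_tendsto)
      have "indicator (box c d) \<in> borel_measurable (lebesgue_on \<Omega>)"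
        by (rule measurable_restrict_space1) (simp add: measurable_completion)
      then show "(\<lambda>x. indicator (box c d) x * g x) \<in> borel_measurable (lebesgue_on \<Omega>)"
        using g by (intro borel_measurable_times) auto
      show "(\<lambda>x. box_bump c d n x * g x) \<in> borel_measurable (lebesgue_on \<Omega>)" for n
        by (intro borel_measurable_times borel_measurable_integrable[OF g]
            continuous_imp_measurable_on_sets_lebesgue[OF _ L]
            continuous_on_subset[OF test_fun_continuous[OF test_fun_box_bump[OF subset_UNIV]] subset_UNIV])
      show "AE x in lebesgue_on \<Omega>. norm (box_bump c d n x * g x) \<le> norm (g x)" for n
        using box_bump_range[of c d n] by (auto simp: abs_mult intro!: AE_I2 mult_left_le_one_le)
    qed (use g in auto)
    then show ?thesis using zero test_fun_box_bump[OF that] by (simp add: LIMSEQ_const_iff)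
  qed
  have AE_box: "AE x in lebesgue. x \<in> box c d \<longrightarrow> g x = 0" if cd: "cbox c d \<subseteq> \<Omega>" for c d
  proof -
    \<comment> \<open>Cutting \<open>g\<close> off outside one box gives an integrable function on
      the whole space. Its integral over any other box is an integral of \<open>g\<close> over the
      intersection, which is again a box with closure in the domain.\<close>
    define G where "G x = indicator (box c d) x * g x" for x
    have sub: "box c d \<subseteq> \<Omega>" using box_subset_cbox cd by blast
    have G_eq: "indicator \<Omega> x *\<^sub>R (indicator (box a b) x * G x) = indicator (box a b) x * G x" for a b x
      using sub by (auto simp: G_def indicator_def)
    have intG: "integrable lebesgue G"
    proof -
      have "integrable lebesgue (\<lambda>x. indicator (box c d) x *\<^sub>R (indicator \<Omega> x *\<^sub>R g x))"
        by (rule integrable_mult_indicator) (use g L in \<open>auto simp: integrable_restrict_space\<close>)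
      moreover have "indicator (box c d) x *\<^sub>R (indicator \<Omega> x *\<^sub>R g x) = G x" for x
        using sub by (auto simp: G_def indicator_def)
      ultimately show ?thesis by simp
    qed
    have box_int: "(LINT x|lebesgue. indicator (box a b) x * G x) = 0" for a b
    proof -
      obtain a' b' where ab: "box a b \<inter> box c d = box a' b'" "cbox a' b' \<subseteq> cbox c d"
        by (rule that[OF box_Int_box]) (simp flip: Int_interval)
      have "(LINT x|lebesgue. indicator (box a b) x * G x) = (LINT x|lebesgue_on \<Omega>. indicator (box a b) x * G x)"
        using L by (subst integral_restrict_space) (simp_all add: G_eq del: real_scaleR_def)
      also have "\<dots> = (LINT x|lebesgue_on \<Omega>. indicator (box a' b') x * g x)"
        by (intro Bochner_Integration.integral_cong) (auto simp: G_def ab(1)[symmetric] indicator_def)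
      also have "\<dots> = 0" using ab cd by (intro box_zero) auto
      finally show ?thesis .
    qed
    \<comment> \<open>\<open>g\<close> is only Lebesgue measurable, whereas
      \<open>AE_zero_if_box_integrals_zero\<close> works with Borel measure; hence the passage to a
      Borel representative.\<close>
    obtain G' where G': "G' \<in> borel_measurable lborel" "AE x in lborel. G x = G' x"
      using completion_ex_borel_measurable_real[of G lborel] intG by auto
    have ae: "AE x in lebesgue. G x = G' x" using G'(2) by (simp add: AE_completion_iff)
    have mG: "G \<in> borel_measurable lebesgue" using intG by (rule borel_measurable_integrable)
    have mG': "G' \<in> borel_measurable lebesgue" using G'(1) by (rule measurable_completion)
    have mbox: "indicator (box a b) \<in> borel_measurable lebesgue" for a b :: 'a
      by (rule measurable_completion) simp
    have "integrable lebesgue G'"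
      using intG integrable_cong_AE[OF mG mG' ae] by simp
    then have intG': "integrable lborel G'" using integrable_completion[OF G'(1)] by simp
    have "AE x in lborel. G' x = 0"
    proof (rule AE_zero_if_box_integrals_zero[OF intG'])
      fix a b :: 'a
      have "(LINT x|lborel. indicator (box a b) x * G' x) = (LINT x|lebesgue. indicator (box a b) x * G' x)"
        by (rule integral_completion[symmetric]) (intro borel_measurable_times G'(1), simp)
      also have "\<dots> = (LINT x|lebesgue. indicator (box a b) x * G x)"
        by (intro integral_cong_AE borel_measurable_times mbox mG mG') (use ae in eventually_elim, simp)
      finally show "(LINT x|lborel. indicator (box a b) x * G' x) = 0" using box_int by simp
    qed
    then have "AE x in lebesgue. G' x = 0" by (simp add: AE_completion_iff)
    with ae show ?thesis by eventually_elim (auto simp: G_def)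
  qed
  \<comment> \<open>By Lindelof, countably many boxes suffice to cover the open domain, so the
    exceptional null sets can be united.\<close>
  define F where "F = {box c d |c d. cbox c d \<subseteq> \<Omega>}"
  obtain F' where F': "F' \<subseteq> F" "countable F'" "\<Union>F' = \<Union>F"
    using Lindelof[of F] by (auto simp: F_def)
  have "\<Omega> \<subseteq> \<Union>F"
  proof
    fix x assume "x \<in> \<Omega>"
    then obtain c d where "x \<in> box c d" "cbox c d \<subseteq> \<Omega>"
      by (rule open_contains_cbox[OF \<Omega>])
    then show "x \<in> \<Union>F" by (auto simp: F_def)
  qed
  moreover have "AE x in lebesgue. \<forall>B\<in>F'. x \<in> B \<longrightarrow> g x = 0"
    using F' AE_box by (subst AE_ball_countable) (auto simp: F_def)
  ultimately have "AE x in lebesgue. x \<in> \<Omega> \<longrightarrow> g x = 0"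
    using F' by (auto elim!: eventually_mono)
  then show ?thesis using L by (simp add: AE_restrict_space_iff)
qed

section \<open>Square integrable functions and weak gradients\<close>

definition l2norm :: "'a::euclidean_space set \<Rightarrow> ('a \<Rightarrow> 'b::euclidean_space) \<Rightarrow> real" where
  "l2norm \<Omega> u = sqrt (LINT x|lebesgue_on \<Omega>. (norm (u x))\<^sup>2)"

lemma l2norm_nonneg [simp]: "0 \<le> l2norm \<Omega> u"
  by (simp add: l2norm_def integral_nonneg_AE)

lemma l2norm_sq: "(l2norm \<Omega> u)\<^sup>2 = (LINT x|lebesgue_on \<Omega>. (norm (u x))\<^sup>2)"
  by (simp add: l2norm_def integral_nonneg_AE)

lemma sq_int_measurable [measurable_dest]: "sq_int \<Omega> u \<Longrightarrow> u \<in> borel_measurable (lebesgue_on \<Omega>)"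
  by (simp add: sq_int_def)

lemma sq_int_inner:
  fixes u v :: "'a::euclidean_space \<Rightarrow> 'b::euclidean_space"
  assumes u: "sq_int \<Omega> u" and v: "sq_int \<Omega> v"
  shows "integrable (lebesgue_on \<Omega>) (\<lambda>x. u x \<bullet> v x)"
proof (rule Bochner_Integration.integrable_bound)
  show "integrable (lebesgue_on \<Omega>) (\<lambda>x. (norm (u x))\<^sup>2 + (norm (v x))\<^sup>2)"
    using u v by (auto simp: sq_int_def)
  show "(\<lambda>x. u x \<bullet> v x) \<in> borel_measurable (lebesgue_on \<Omega>)"
    using u v by measurable
  have "\<bar>u x \<bullet> v x\<bar> \<le> (norm (u x))\<^sup>2 + (norm (v x))\<^sup>2" for x
    using Cauchy_Schwarz_ineq2[of "u x" "v x"] sum_squares_bound[of "norm (u x)" "norm (v x)"]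
      mult_nonneg_nonneg[of "norm (u x)" "norm (v x)"] by simp
  then show "AE x in lebesgue_on \<Omega>. norm (u x \<bullet> v x) \<le> norm ((norm (u x))\<^sup>2 + (norm (v x))\<^sup>2)"
    by (intro AE_I2) simp
qed

lemma norm_lincomb_sq:
  fixes a b :: "'b::real_inner"
  shows "(norm (r *\<^sub>R a + s *\<^sub>R b))\<^sup>2 = r\<^sup>2 * (norm a)\<^sup>2 + 2 * r * s * (a \<bullet> b) + s\<^sup>2 * (norm b)\<^sup>2"
  unfolding power2_norm_eq_inner
  by (simp add: inner_add_left inner_add_right inner_commute[of b a] power2_eq_square algebra_simps)

lemma sq_int_lincomb:
  fixes u v :: "'a::euclidean_space \<Rightarrow> 'b::euclidean_space"
  assumes u: "sq_int \<Omega> u" and v: "sq_int \<Omega> v"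
  shows "sq_int \<Omega> (\<lambda>x. r *\<^sub>R u x + s *\<^sub>R v x)"
    and "(l2norm \<Omega> (\<lambda>x. r *\<^sub>R u x + s *\<^sub>R v x))\<^sup>2 =
      r\<^sup>2 * (l2norm \<Omega> u)\<^sup>2 + 2 * r * s * (LINT x|lebesgue_on \<Omega>. u x \<bullet> v x) + s\<^sup>2 * (l2norm \<Omega> v)\<^sup>2"
  using sq_int_inner[OF u v] u v
  by (auto simp: sq_int_def l2norm_sq norm_lincomb_sq)

lemma sq_int_diff:
  fixes u v :: "'a::euclidean_space \<Rightarrow> 'b::euclidean_space"
  shows "sq_int \<Omega> u \<Longrightarrow> sq_int \<Omega> v \<Longrightarrow> sq_int \<Omega> (\<lambda>x. u x - v x)"
  using sq_int_lincomb(1)[of \<Omega> u v 1 "-1"] by simp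

lemma l2_Cauchy_Schwarz:
  fixes u v :: "'a::euclidean_space \<Rightarrow> 'b::euclidean_space"
  assumes u: "sq_int \<Omega> u" and v: "sq_int \<Omega> v"
  shows "\<bar>LINT x|lebesgue_on \<Omega>. u x \<bullet> v x\<bar> \<le> l2norm \<Omega> u * l2norm \<Omega> v"
proof -
  define a b c where "a = (l2norm \<Omega> u)\<^sup>2" and "b = (l2norm \<Omega> v)\<^sup>2"
    and "c = (LINT x|lebesgue_on \<Omega>. u x \<bullet> v x)"
  \<comment> \<open>The quadratic form in \<open>r\<close> and \<open>s\<close> is a squared norm.
    For b > 0, the choice r = b, s = -c gives b (a b - c^2) \<ge> 0.\<close>
  have q: "0 \<le> r\<^sup>2 * a + 2 * r * s * c + s\<^sup>2 * b" for r s
    using sq_int_lincomb(2)[OF u v, of r s] by (metis a_def b_def c_def zero_le_power2)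
  have "c\<^sup>2 \<le> a * b"
  proof (cases "b = 0")
    case True
    have "c = 0"
    proof (rule ccontr)
      assume "c \<noteq> 0"
      \<comment> \<open>For b = 0 and this choice of \<open>s\<close>, the form takes the value a -
        (a + 1) = -1.\<close>
      then show False using q[of 1 "- (a + 1) / (2 * c)"] True by (simp add: field_simps)
    qed
    then show ?thesis using True by simp
  next
    case False
    then have "b > 0" by (simp add: b_def less_le)
    have "0 \<le> b * (a * b - c\<^sup>2)" using q[of b "- c"] by (simp add: power2_eq_square algebra_simps)
    then show ?thesis using \<open>b > 0\<close> by (simp add: zero_le_mult_iff)
  qed
  then have "\<bar>c\<bar>\<^sup>2 \<le> (l2norm \<Omega> u * l2norm \<Omega> v)\<^sup>2"
    by (simp add: a_def b_def power_mult_distrib)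
  then show ?thesis unfolding c_def by (rule power2_le_imp_le) simp
qed

lemma l2norm_add_le:
  fixes u v :: "'a::euclidean_space \<Rightarrow> 'b::euclidean_space"
  assumes u: "sq_int \<Omega> u" and v: "sq_int \<Omega> v"
  shows "l2norm \<Omega> (\<lambda>x. u x + v x) \<le> l2norm \<Omega> u + l2norm \<Omega> v"
proof (rule power2_le_imp_le)
  show "(l2norm \<Omega> (\<lambda>x. u x + v x))\<^sup>2 \<le> (l2norm \<Omega> u + l2norm \<Omega> v)\<^sup>2"
    using sq_int_lincomb(2)[OF u v, of 1 1] l2_Cauchy_Schwarz[OF u v]
    by (simp add: power2_sum)
qed simp

lemma l2norm_minus_commute:
  "l2norm \<Omega> (\<lambda>x. u x - v x) = l2norm \<Omega> (\<lambda>x. v x - u x)"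
  by (simp add: l2norm_def norm_minus_commute)

lemma l2norm_cong_AE:
  assumes "sq_int \<Omega> u" "sq_int \<Omega> v" "AE x in lebesgue_on \<Omega>. u x = v x"
  shows "l2norm \<Omega> u = l2norm \<Omega> v"
proof -
  have "(LINT x|lebesgue_on \<Omega>. (norm (u x))\<^sup>2) = (LINT x|lebesgue_on \<Omega>. (norm (v x))\<^sup>2)"
    using assms by (intro integral_cong_AE) (measurable, auto)
  then show ?thesis by (simp add: l2norm_def)
qed

lemma l2norm_eq_0_iff:
  assumes "sq_int \<Omega> u"
  shows "l2norm \<Omega> u = 0 \<longleftrightarrow> (AE x in lebesgue_on \<Omega>. u x = 0)"
  using assms unfolding l2norm_def sq_int_def
  by (auto simp: integral_nonneg_eq_0_iff_AE)

lemma sq_int_bounded: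
  fixes u :: "'a::euclidean_space \<Rightarrow> 'b::euclidean_space"
  assumes "open \<Omega>" "bounded \<Omega>" "continuous_on UNIV u" "\<And>x. norm (u x) \<le> B"
  shows "sq_int \<Omega> u"
proof -
  have \<Omega>: "\<Omega> \<in> lmeasurable" using assms by (simp add: bounded_set_imp_lmeasurable)
  have m: "u \<in> borel_measurable (lebesgue_on \<Omega>)"
    using assms \<Omega> by (intro continuous_imp_measurable_on_sets_lebesgue) (auto intro: continuous_on_subset)
  have "integrable (lebesgue_on \<Omega>) (\<lambda>x. (norm (u x))\<^sup>2)"
  proof (rule Bochner_Integration.integrable_bound[where f="\<lambda>x. B\<^sup>2"])
    show "integrable (lebesgue_on \<Omega>) (\<lambda>x. B\<^sup>2)" 
      using finite_measure_lebesgue_on[OF \<Omega>] by (simp add: finite_measure.integrable_const)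
    show "AE x in lebesgue_on \<Omega>. norm ((norm (u x))\<^sup>2) \<le> norm (B\<^sup>2)"
      using assms(4) by (intro AE_I2) (simp add: power_mono)
  qed (use m in measurable)
  with m show ?thesis by (simp add: sq_int_def)
qed

lemma sq_int_test_fun:
  assumes "open \<Omega>" "bounded \<Omega>" "test_fun \<Omega> \<phi>"
  shows "sq_int \<Omega> \<phi>" "sq_int \<Omega> (gradient \<phi>)"
proof -
  obtain B where "0 \<le> B" "\<And>x. \<bar>\<phi> x\<bar> \<le> B" "\<And>x. norm (gradient \<phi> x) \<le> B"
    using test_fun_bounded[OF assms(3)] by blast
  then show "sq_int \<Omega> \<phi>" "sq_int \<Omega> (gradient \<phi>)"
    using assms test_fun_continuous test_fun_gradient_continuous
    by (auto intro!: sq_int_bounded[where B=B])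
qed

lemma sq_int_scaleR_integrable:
  fixes v :: "'a::euclidean_space \<Rightarrow> 'b::euclidean_space"
  assumes u: "sq_int \<Omega> u" and v: "sq_int \<Omega> v"
  shows "integrable (lebesgue_on \<Omega>) (\<lambda>x. u x *\<^sub>R v x)"
proof (rule Bochner_Integration.integrable_bound)
  show "integrable (lebesgue_on \<Omega>) (\<lambda>x. (u x)\<^sup>2 + (norm (v x))\<^sup>2)"
    using u v by (auto simp: sq_int_def)
  show "(\<lambda>x. u x *\<^sub>R v x) \<in> borel_measurable (lebesgue_on \<Omega>)"
    using u v by measurable
  have "\<bar>u x\<bar> * norm (v x) \<le> (u x)\<^sup>2 + (norm (v x))\<^sup>2" for x
  proof -
    have "0 \<le> \<bar>u x\<bar> * norm (v x)" by simp
    then show ?thesis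
      using sum_squares_bound[of "\<bar>u x\<bar>" "norm (v x)"] by (simp only: power2_abs mult.assoc)
  qed
  then show "AE x in lebesgue_on \<Omega>. norm (u x *\<^sub>R v x) \<le> norm ((u x)\<^sup>2 + (norm (v x))\<^sup>2)"
    by (intro AE_I2) simp
qed

section \<open>Weak gradients and the spaces \<open>H1\<close> and \<open>H10\<close>\<close>

lemma is_weak_grad_unique:
  fixes g h :: "'a::euclidean_space \<Rightarrow> 'a"
  assumes \<Omega>: "open \<Omega>" "bounded \<Omega>"
    and g: "sq_int \<Omega> g" "is_weak_grad \<Omega> u g" and h: "sq_int \<Omega> h" "is_weak_grad \<Omega> u h"
  shows "AE x in lebesgue_on \<Omega>. g x = h x"
proof -
  have gh: "sq_int \<Omega> (\<lambda>x. g x - h x)" using g h by (intro sq_int_diff)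
  have one: "sq_int \<Omega> (\<lambda>x. b)" for b :: 'a
    using \<Omega> by (intro sq_int_bounded[where B="norm b"]) auto
  \<comment> \<open>The fundamental lemma is scalar, so it is applied to each component of the
    difference; finitely many null sets are then united.\<close>
  have "AE x in lebesgue_on \<Omega>. (g x - h x) \<bullet> b = 0" for b
  proof (rule fundamental_lemma_variations[OF \<Omega>(1) sq_int_inner[OF gh one]])
    fix \<phi> :: "'a \<Rightarrow> real" assume \<phi>: "test_fun \<Omega> \<phi>"
    note i = sq_int_scaleR_integrable[OF sq_int_test_fun(1)[OF \<Omega> \<phi>]]
    have "(LINT x|lebesgue_on \<Omega>. \<phi> x *\<^sub>R g x) = (LINT x|lebesgue_on \<Omega>. \<phi> x *\<^sub>R h x)"
      using g h \<phi> unfolding is_weak_grad_def by (metis minus_equation_iff)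
    then have "(LINT x|lebesgue_on \<Omega>. \<phi> x *\<^sub>R (g x - h x)) = 0"
      using i[OF g(1)] i[OF h(1)] by (simp add: scaleR_diff_right)
    then have "(LINT x|lebesgue_on \<Omega>. (\<phi> x *\<^sub>R (g x - h x)) \<bullet> b) = 0"
      using i[OF gh] by (subst integral_inner_left) auto
    then show "(LINT x|lebesgue_on \<Omega>. \<phi> x * ((g x - h x) \<bullet> b)) = 0" by simp
  qed
  then have "AE x in lebesgue_on \<Omega>. \<forall>b\<in>Basis. (g x - h x) \<bullet> b = 0"
    by (subst AE_finite_all) auto
  then show ?thesis
    by eventually_elim (metis euclidean_eqI inner_zero_left right_minus_eq)
qed

lemma H1_wgrad:
  assumes "u \<in> H1 \<Omega>"
  shows "sq_int \<Omega> u" "sq_int \<Omega> (wgrad \<Omega> u)" "is_weak_grad \<Omega> u (wgrad \<Omega> u)"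
  using assms someI_ex[of "\<lambda>g. sq_int \<Omega> g \<and> is_weak_grad \<Omega> u g"] by (auto simp: H1_def wgrad_def)

text \<open>The difference of the chosen gradients is a weak gradient of u - v. Since
  \<open>wgrad\<close> makes its own choice for u - v, uniqueness only yields equality almost
  everywhere.\<close>

lemma H1_diff:
  assumes \<Omega>: "open \<Omega>" "bounded \<Omega>" and u: "u \<in> H1 \<Omega>" and v: "v \<in> H1 \<Omega>"
  shows "u - v \<in> H1 \<Omega>"
    and "AE x in lebesgue_on \<Omega>. wgrad \<Omega> (u - v) x = wgrad \<Omega> u x - wgrad \<Omega> v x"
proof -
  note U = H1_wgrad[OF u] and V = H1_wgrad[OF v]
  have s: "sq_int \<Omega> (\<lambda>x. wgrad \<Omega> u x - wgrad \<Omega> v x)" using U V by (intro sq_int_diff)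
  have w: "is_weak_grad \<Omega> (u - v) (\<lambda>x. wgrad \<Omega> u x - wgrad \<Omega> v x)"
    unfolding is_weak_grad_def
  proof (intro allI impI)
    fix \<phi> :: "'a \<Rightarrow> real" assume \<phi>: "test_fun \<Omega> \<phi>"
    note i = sq_int_scaleR_integrable[OF sq_int_test_fun(1)[OF \<Omega> \<phi>]]
      sq_int_scaleR_integrable[OF _ sq_int_test_fun(2)[OF \<Omega> \<phi>]]
    show "(LINT x|lebesgue_on \<Omega>. (u - v) x *\<^sub>R gradient \<phi> x) =
        - (LINT x|lebesgue_on \<Omega>. \<phi> x *\<^sub>R (wgrad \<Omega> u x - wgrad \<Omega> v x))"
      using U V \<phi> by (simp add: i scaleR_diff_left scaleR_diff_right is_weak_grad_def)
  qed
  show "u - v \<in> H1 \<Omega>"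
    using sq_int_diff[OF U(1) V(1)] s w by (auto simp: H1_def fun_diff_def)
  note W = H1_wgrad[OF this]
  show "AE x in lebesgue_on \<Omega>. wgrad \<Omega> (u - v) x = wgrad \<Omega> u x - wgrad \<Omega> v x"
    by (rule is_weak_grad_unique[OF \<Omega> W(2,3) s w])
qed

lemma H10_iff:
  "u \<in> H10 \<Omega> \<longleftrightarrow> u \<in> H1 \<Omega> \<and> (\<exists>\<phi>. (\<forall>n. test_fun \<Omega> (\<phi> n)) \<and>
     (\<lambda>n. l2norm \<Omega> (\<lambda>x. u x - \<phi> n x)) \<longlonglongrightarrow> 0 \<and>
     (\<lambda>n. l2norm \<Omega> (\<lambda>x. wgrad \<Omega> u x - gradient (\<phi> n) x)) \<longlonglongrightarrow> 0)"
proof -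
  have *: "(\<lambda>n. a n ^ 2 + b n ^ 2) \<longlonglongrightarrow> 0 \<longleftrightarrow> a \<longlonglongrightarrow> 0 \<and> b \<longlonglongrightarrow> 0" for a b :: "nat \<Rightarrow> real"
  proof (intro iffI conjI)
    assume L: "(\<lambda>n. a n ^ 2 + b n ^ 2) \<longlonglongrightarrow> 0"
    have "(\<lambda>n. sqrt (a n ^ 2 + b n ^ 2)) \<longlonglongrightarrow> 0" using tendsto_real_sqrt[OF L] by simp
    then show "a \<longlonglongrightarrow> 0" "b \<longlonglongrightarrow> 0"
      by (auto intro!: Lim_null_comparison[where g="\<lambda>n. sqrt (a n ^ 2 + b n ^ 2)"] real_sqrt_ge_abs1 real_sqrt_ge_abs2)
  next
    assume "a \<longlonglongrightarrow> 0 \<and> b \<longlonglongrightarrow> 0"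
    then have "(\<lambda>n. a n ^ 2 + b n ^ 2) \<longlonglongrightarrow> 0 ^ 2 + 0 ^ 2" by (intro tendsto_intros) auto
    then show "(\<lambda>n. a n ^ 2 + b n ^ 2) \<longlonglongrightarrow> 0" by simp
  qed
  show ?thesis unfolding *[symmetric] l2norm_sq by (simp add: H10_def)
qed

lemma H10_diff:
  assumes \<Omega>: "open \<Omega>" "bounded \<Omega>" and u: "u \<in> H10 \<Omega>" and v: "v \<in> H10 \<Omega>"
  shows "u - v \<in> H10 \<Omega>"
proof -
  have H1: "u \<in> H1 \<Omega>" "v \<in> H1 \<Omega>" using u v by (auto simp: H10_iff)
  obtain \<phi> \<psi> where \<phi>: "\<And>n. test_fun \<Omega> (\<phi> n)" "(\<lambda>n. l2norm \<Omega> (\<lambda>x. u x - \<phi> n x)) \<longlonglongrightarrow> 0"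
      "(\<lambda>n. l2norm \<Omega> (\<lambda>x. wgrad \<Omega> u x - gradient (\<phi> n) x)) \<longlonglongrightarrow> 0"
    and \<psi>: "\<And>n. test_fun \<Omega> (\<psi> n)" "(\<lambda>n. l2norm \<Omega> (\<lambda>x. v x - \<psi> n x)) \<longlonglongrightarrow> 0"
      "(\<lambda>n. l2norm \<Omega> (\<lambda>x. wgrad \<Omega> v x - gradient (\<psi> n) x)) \<longlonglongrightarrow> 0"
    using u v unfolding H10_iff by blast
  note t = sq_int_test_fun[OF \<Omega> \<phi>(1)] sq_int_test_fun[OF \<Omega> \<psi>(1)]
  note U = H1_wgrad[OF H1(1)] and V = H1_wgrad[OF H1(2)] and D = H1_diff[OF \<Omega> H1]
  note W = H1_wgrad[OF D(1)]
  have le: "l2norm \<Omega> (\<lambda>x. (a x - b x) - (c x - d x)) \<le> l2norm \<Omega> (\<lambda>x. a x - c x) + l2norm \<Omega> (\<lambda>x. b x - d x)"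
    if "sq_int \<Omega> a" "sq_int \<Omega> b" "sq_int \<Omega> c" "sq_int \<Omega> d" for a b c d :: "'a \<Rightarrow> 'b::euclidean_space"
    using l2norm_add_le[OF sq_int_diff[OF that(1,3)] sq_int_diff[OF that(4,2)]]
    by (simp add: l2norm_minus_commute[of _ b d] algebra_simps)
  have "(\<lambda>n. l2norm \<Omega> (\<lambda>x. (u - v) x - (\<phi> n - \<psi> n) x)) \<longlonglongrightarrow> 0"
  proof (rule Lim_null_comparison[OF always_eventually])
    show "\<forall>n. norm (l2norm \<Omega> (\<lambda>x. (u - v) x - (\<phi> n - \<psi> n) x)) \<le>
        l2norm \<Omega> (\<lambda>x. u x - \<phi> n x) + l2norm \<Omega> (\<lambda>x. v x - \<psi> n x)"
      using le[OF U(1) V(1) t(1) t(3)] by simp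
  qed (use tendsto_add[OF \<phi>(2) \<psi>(2)] in simp)
  moreover have "(\<lambda>n. l2norm \<Omega> (\<lambda>x. wgrad \<Omega> (u - v) x - gradient (\<phi> n - \<psi> n) x)) \<longlonglongrightarrow> 0"
  proof (rule Lim_null_comparison[OF always_eventually], intro allI)
    fix n
    have "l2norm \<Omega> (\<lambda>x. wgrad \<Omega> (u - v) x - gradient (\<phi> n - \<psi> n) x) =
        l2norm \<Omega> (\<lambda>x. (wgrad \<Omega> u x - wgrad \<Omega> v x) - (gradient (\<phi> n) x - gradient (\<psi> n) x))"
      unfolding test_fun_diff(2)[OF \<phi>(1) \<psi>(1)]
      by (intro l2norm_cong_AE sq_int_diff W(2) U(2) V(2) t) (use D(2) in eventually_elim, simp)
    also have "\<dots> \<le> l2norm \<Omega> (\<lambda>x. wgrad \<Omega> u x - gradient (\<phi> n) x) + l2norm \<Omega> (\<lambda>x. wgrad \<Omega> v x - gradient (\<psi> n) x)"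
      by (rule le[OF U(2) V(2) t(2) t(4)])
    finally show "norm (l2norm \<Omega> (\<lambda>x. wgrad \<Omega> (u - v) x - gradient (\<phi> n - \<psi> n) x)) \<le>
        l2norm \<Omega> (\<lambda>x. wgrad \<Omega> u x - gradient (\<phi> n) x) + l2norm \<Omega> (\<lambda>x. wgrad \<Omega> v x - gradient (\<psi> n) x)"
      by simp
  qed (use tendsto_add[OF \<phi>(3) \<psi>(3)] in simp)
  ultimately show ?thesis
    unfolding H10_iff
    by (intro conjI exI[of _ "\<lambda>n. \<phi> n - \<psi> n"] allI D(1) test_fun_diff(1)[OF \<phi>(1) \<psi>(1)])
qed

text \<open>Both functions have exactly the same weak gradients, so the choice operator is applied
  to the same predicate. The result is equality everywhere, which makes norm, flux and energy
  independent of the representative.\<close>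

lemma wgrad_cong_eq_ae:
  assumes "u \<in> H1 \<Omega>" "v \<in> H1 \<Omega>" "open \<Omega>" "bounded \<Omega>" "eq_ae \<Omega> u v"
  shows "wgrad \<Omega> u = wgrad \<Omega> v"
proof -
  have "is_weak_grad \<Omega> u g \<longleftrightarrow> is_weak_grad \<Omega> v g" for g
  proof -
    have "(LINT x|lebesgue_on \<Omega>. u x *\<^sub>R gradient \<phi> x) = (LINT x|lebesgue_on \<Omega>. v x *\<^sub>R gradient \<phi> x)"
      if "test_fun \<Omega> \<phi>" for \<phi>
    proof (rule integral_cong_AE)
      show "(\<lambda>x. u x *\<^sub>R gradient \<phi> x) \<in> borel_measurable (lebesgue_on \<Omega>)"
        "(\<lambda>x. v x *\<^sub>R gradient \<phi> x) \<in> borel_measurable (lebesgue_on \<Omega>)"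
        using H1_wgrad(1)[OF assms(1)] H1_wgrad(1)[OF assms(2)] sq_int_test_fun[OF assms(3,4) that]
        by (auto intro!: borel_measurable_scaleR sq_int_measurable)
      show "AE x in lebesgue_on \<Omega>. u x *\<^sub>R gradient \<phi> x = v x *\<^sub>R gradient \<phi> x"
        using assms(5) unfolding eq_ae_def by eventually_elim simp
    qed
    then show ?thesis by (simp add: is_weak_grad_def)
  qed
  then show ?thesis by (simp add: wgrad_def)
qed

section \<open>The inequality of Poincare and Friedrichs\<close>

lemma integral_directional_derivative_zero:
  fixes f :: "'a::euclidean_space \<Rightarrow> real"
  assumes D: "\<And>x. (f has_derivative f' x) (at x)" and c: "continuous_on UNIV (\<lambda>x. f' x b)"
    and K: "compact K" "\<And>x. x \<notin> K \<Longrightarrow> f x = 0" "\<And>x. x \<notin> K \<Longrightarrow> f' x b = 0"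
  shows "(LINT x|lborel. f' x b) = 0"
proof -
  obtain B where B: "0 \<le> B" "\<And>x. \<bar>f' x b\<bar> \<le> B"
    by (rule compactly_supported_bounded[OF K(1) c K(3)]) simp_all
  obtain r where r: "\<And>x. x \<in> K \<Longrightarrow> norm x \<le> r"
    using compact_imp_bounded[OF K(1)] by (auto simp: bounded_iff)
  have fc: "continuous_on UNIV f"
    by (intro continuous_at_imp_continuous_on ballI has_derivative_continuous[OF D])
  have fi: "integrable lborel f"
  proof -
    have "f = (\<lambda>x. indicator K x *\<^sub>R f x)" using K(2) by (auto simp: indicator_def fun_eq_iff)
    moreover have "set_integrable lborel K f"
      using borel_integrable_compact[OF K(1) continuous_on_subset[OF fc]] by (auto simp: set_integrable_def)
    ultimately show ?thesis by (simp add: set_integrable_def)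
  qed
  have shift: "integrable lborel (\<lambda>x. f (c + x))" "(LINT x|lborel. f (c + x)) = (LINT x|lborel. f x)" for c
  proof -
    have fm: "f \<in> borel_measurable borel" using fc by (rule borel_measurable_continuous_onI)
    have "integrable (distr lborel borel ((+) c)) f" unfolding lborel_distr_plus by (rule fi)
    then show "integrable lborel (\<lambda>x. f (c + x))" using fm by (subst (asm) integrable_distr_eq) auto
    show "(LINT x|lborel. f (c + x)) = (LINT x|lborel. f x)"
      using fm integral_distr[of "(+) c" lborel borel f] by (simp add: lborel_distr_plus)
  qed
  \<comment> \<open>Difference quotients in direction \<open>b\<close> have integral zero by
    translation invariance, and they converge pointwise to the directional derivative. Dominated
    convergence transfers the zero to the limit.\<close>
  define s where "s n x = (f ((1 / real (Suc n)) *\<^sub>R b + x) - f x) * real (Suc n)" for n x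
  have s_line: "((\<lambda>t. f (t *\<^sub>R b + x)) has_real_derivative f' (t *\<^sub>R b + x) b) (at t)" for t x
  proof -
    have "((\<lambda>t. f (t *\<^sub>R b + x)) has_derivative (\<lambda>h. f' (t *\<^sub>R b + x) (h *\<^sub>R b))) (at t)"
      by (rule has_derivative_compose[OF _ D]) (auto intro!: derivative_eq_intros)
    moreover have "f' y (h *\<^sub>R b) = f' y b * h" for y h
      using has_derivative_linear[OF D] by (simp add: linear_cmul)
    ultimately show ?thesis by (simp add: has_field_derivative_def)
  qed
  \<comment> \<open>The mean value theorem bounds the quotients by \<open>B\<close>. As the step
    length is at most 1, their supports stay in the ball of radius r + |b|, which gives a common
    integrable majorant.\<close>
  have s_bound: "\<bar>s n x\<bar> \<le> B * indicator (cball 0 (r + norm b)) x" for n x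
  proof -
    have "0 < 1 / real (Suc n)" by simp
    from MVT2[OF this, of "\<lambda>t. f (t *\<^sub>R b + x)", OF s_line]
    obtain z where z: "0 < z" "z < 1 / real (Suc n)"
      "f ((1 / real (Suc n)) *\<^sub>R b + x) - f (0 *\<^sub>R b + x) = (1 / real (Suc n) - 0) * f' (z *\<^sub>R b + x) b"
      by metis
    then have s: "s n x = f' (z *\<^sub>R b + x) b" by (simp add: s_def)
    show ?thesis
    proof (cases "z *\<^sub>R b + x \<in> K")
      case True
      have "z \<le> 1" using z(2) by (rule order_trans[OF less_imp_le]) simp
      have "norm x \<le> norm (z *\<^sub>R b + x) + norm (z *\<^sub>R b)"
        using norm_triangle_ineq4[of "z *\<^sub>R b + x" "z *\<^sub>R b"] by simp
      also have "\<dots> \<le> r + norm b"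
        using r[OF True] z(1) \<open>z \<le> 1\<close> by (intro add_mono) (auto intro: mult_left_le_one_le)
      finally show ?thesis using s B by simp
    next
      case False
      then show ?thesis using s K(3) B(1) by simp
    qed
  qed
  have s_lim: "(\<lambda>n. s n x) \<longlonglongrightarrow> f' x b" for x
  proof -
    have "((\<lambda>h. (f (h *\<^sub>R b + x) - f x) / h) \<longlongrightarrow> f' x b) (at 0)"
      using s_line[of x 0] by (simp add: DERIV_def)
    moreover have "filterlim (\<lambda>n. 1 / real (Suc n)) (at 0) sequentially"
      unfolding filterlim_at using LIMSEQ_inverse_real_of_nat by (auto simp: inverse_eq_divide)
    ultimately have "(\<lambda>n. (f ((1 / real (Suc n)) *\<^sub>R b + x) - f x) / (1 / real (Suc n))) \<longlonglongrightarrow> f' x b"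
      by (rule filterlim_compose)
    then show ?thesis by (simp add: s_def)
  qed
  have "(\<lambda>n. LINT x|lborel. s n x) \<longlonglongrightarrow> (LINT x|lborel. f' x b)"
  proof (rule integral_dominated_convergence[where w="\<lambda>x. B * indicator (cball 0 (r + norm b)) x"])
    show "(\<lambda>x. f' x b) \<in> borel_measurable lborel" using borel_measurable_continuous_onI[OF c] by simp
    show "s n \<in> borel_measurable lborel" for n
      unfolding s_def using shift(1) fi by (intro borel_measurable_times borel_measurable_diff) auto
    have "emeasure lborel (cball 0 (r + norm b) :: 'a set) < \<infinity>"
      by (rule emeasure_bounded_finite) simp
    then show "integrable lborel (\<lambda>x::'a. B * indicator (cball 0 (r + norm b)) x :: real)"
      by (intro integrable_mult_right integrable_real_indicator) simp_all
  qed (use s_lim s_bound in simp_all)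
  moreover have "(LINT x|lborel. s n x) = 0" for n
    unfolding s_def using shift fi by simp
  ultimately show ?thesis by (simp add: LIMSEQ_const_iff)
qed

lemma l2norm_mono:
  fixes u :: "'a::euclidean_space \<Rightarrow> 'b::euclidean_space" and v :: "'a \<Rightarrow> 'c::euclidean_space"
  assumes v: "sq_int \<Omega> v" and u: "u \<in> borel_measurable (lebesgue_on \<Omega>)" and r: "0 \<le> r"
    and le: "AE x in lebesgue_on \<Omega>. norm (u x) \<le> r * norm (v x)"
  shows "sq_int \<Omega> u" "l2norm \<Omega> u \<le> r * l2norm \<Omega> v"
proof -
  have sq: "AE x in lebesgue_on \<Omega>. (norm (u x))\<^sup>2 \<le> r\<^sup>2 * (norm (v x))\<^sup>2"
    using le by eventually_elim (metis norm_ge_zero power_mono power_mult_distrib)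
  have iv: "integrable (lebesgue_on \<Omega>) (\<lambda>x. r\<^sup>2 * (norm (v x))\<^sup>2)" using v by (simp add: sq_int_def)
  then have "integrable (lebesgue_on \<Omega>) (\<lambda>x. (norm (u x))\<^sup>2)"
    by (rule Bochner_Integration.integrable_bound) (use u sq in auto)
  then show su: "sq_int \<Omega> u" using u by (simp add: sq_int_def)
  have "(l2norm \<Omega> u)\<^sup>2 \<le> (r * l2norm \<Omega> v)\<^sup>2"
    using su integral_mono_AE[OF _ iv sq] by (simp add: l2norm_sq power_mult_distrib sq_int_def)
  then show "l2norm \<Omega> u \<le> r * l2norm \<Omega> v" by (rule power2_le_imp_le) (use r in simp)
qed

lemma test_fun_supportE:
  assumes "test_fun \<Omega> \<phi>"
  obtains K where "compact K" "K \<subseteq> \<Omega>" "\<And>x. x \<notin> K \<Longrightarrow> \<phi> x = 0"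
  using assms test_fun_zero_outside(1)[OF assms] by (intro that[of "closure {x. \<phi> x \<noteq> 0}"]) (simp_all only: test_fun_def)

text \<open>Integrating the derivative of (x . b) \<phi>^2 in a basis direction b gives ||\<phi>||^2
  = -2 \<integral> \<phi> (x . b) (\<nabla>\<phi> . b). The domain lies in a ball of radius r, so |x
  . b| \<le> r, and Cauchy-Schwarz yields the constant 2 r after division by ||\<phi>||.\<close>

lemma Poincare_test_fun:
  fixes \<Omega> :: "'a::euclidean_space set"
  assumes \<Omega>: "open \<Omega>" "bounded \<Omega>"
  obtains C where "0 \<le> C" "\<And>\<phi>. test_fun \<Omega> \<phi> \<Longrightarrow> l2norm \<Omega> \<phi> \<le> C * l2norm \<Omega> (gradient \<phi>)"
proof -
  obtain r where r: "0 < r" "\<And>x. x \<in> \<Omega> \<Longrightarrow> norm x \<le> r" using \<Omega>(2) by (auto simp: bounded_pos)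
  obtain b :: 'a where b: "b \<in> Basis" using nonempty_Basis by blast
  have "l2norm \<Omega> \<phi> \<le> (2 * r) * l2norm \<Omega> (gradient \<phi>)" if \<phi>: "test_fun \<Omega> \<phi>" for \<phi>
  proof -
    obtain K where K: "compact K" "K \<subseteq> \<Omega>" "\<And>x. x \<notin> K \<Longrightarrow> \<phi> x = 0"
      using test_fun_supportE[OF \<phi>] by metis
    define h where "h x = (x \<bullet> b) * (gradient \<phi> x \<bullet> b)" for x
    have gb: "frechet_derivative \<phi> (at x) b = gradient \<phi> x \<bullet> b" for x
      using b by (simp add: gradient_def inner_sum_left inner_Basis if_distrib sum.delta cong: if_cong)
    note t = sq_int_test_fun[OF \<Omega> \<phi>]
    have hc: "continuous_on UNIV h"
      unfolding h_def by (intro continuous_intros test_fun_gradient_continuous[OF \<phi>])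
    have L: "\<Omega> \<in> sets lebesgue" using \<Omega> by simp
    have hm: "h \<in> borel_measurable (lebesgue_on \<Omega>)"
      by (intro continuous_imp_measurable_on_sets_lebesgue[OF _ L] continuous_on_subset[OF hc]) simp
    have hle: "norm (h x) \<le> r * norm (gradient \<phi> x)" if "x \<in> \<Omega>" for x
      unfolding h_def real_norm_def abs_mult
      using r(1) r(2)[OF that] b by (intro mult_mono order_trans[OF Basis_le_norm[OF b] _] Basis_le_norm) auto
    have hAE: "AE x in lebesgue_on \<Omega>. norm (h x) \<le> r * norm (gradient \<phi> x)"
      using hle by (intro AE_I2) simp
    note hs = l2norm_mono[OF t(2) hm less_imp_le[OF r(1)] hAE]
    have D: "((\<lambda>x. (x \<bullet> b) * (\<phi> x * \<phi> x)) has_derivative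
        (\<lambda>k. (x \<bullet> b) * (\<phi> x * frechet_derivative \<phi> (at x) k + frechet_derivative \<phi> (at x) k * \<phi> x) + (k \<bullet> b) * (\<phi> x * \<phi> x))) (at x)" for x
      by (intro has_derivative_mult has_derivative_inner_left has_derivative_ident test_fun_differentiable[OF \<phi>])
    have "(LINT x|lborel. (x \<bullet> b) * (\<phi> x * frechet_derivative \<phi> (at x) b + frechet_derivative \<phi> (at x) b * \<phi> x) + (b \<bullet> b) * (\<phi> x * \<phi> x)) = 0"
    proof (rule integral_directional_derivative_zero[OF D _ K(1)])
    qed (auto simp: K(3) intro!: continuous_intros test_fun_frechet_continuous[OF \<phi> b] test_fun_continuous[OF \<phi>])
    then have "(LINT x|lborel. 2 * (\<phi> x * h x) + \<phi> x * \<phi> x) = 0"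
      using b by (simp add: gb h_def algebra_simps)
    \<comment> \<open>The support of \<phi> lies in the domain, so integration over the whole space
      and over the domain agree.\<close>
    moreover have "(LINT x|lborel. 2 * (\<phi> x * h x) + \<phi> x * \<phi> x) = (LINT x|lebesgue_on \<Omega>. 2 * (\<phi> x * h x) + \<phi> x * \<phi> x)"
    proof -
      have m: "(\<lambda>x. 2 * (\<phi> x * h x) + \<phi> x * \<phi> x) \<in> borel_measurable lborel"
        using hc test_fun_continuous[OF \<phi>]
        by (auto intro!: borel_measurable_continuous_onI continuous_intros)
      have "\<phi> x = 0" if "x \<notin> \<Omega>" for x
        using that K by blast
      then have "indicator \<Omega> x *\<^sub>R (2 * (\<phi> x * h x) + \<phi> x * \<phi> x) = 2 * (\<phi> x * h x) + \<phi> x * \<phi> x" for x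
        by (cases "x \<in> \<Omega>") auto
      then have "(LINT x|lebesgue_on \<Omega>. 2 * (\<phi> x * h x) + \<phi> x * \<phi> x) = (LINT x|lebesgue. 2 * (\<phi> x * h x) + \<phi> x * \<phi> x)"
        using L by (subst integral_restrict_space) (simp_all del: real_scaleR_def)
      then show ?thesis using integral_completion[OF m] by simp
    qed
    ultimately have "2 * (LINT x|lebesgue_on \<Omega>. \<phi> x \<bullet> h x) + (l2norm \<Omega> \<phi>)\<^sup>2 = 0"
      using sq_int_inner[OF t(1) hs(1)] sq_int_inner[OF t(1) t(1)]
      by (simp add: l2norm_sq) (simp add: power2_eq_square)
    then have "(l2norm \<Omega> \<phi>)\<^sup>2 \<le> 2 * (l2norm \<Omega> \<phi> * l2norm \<Omega> h)"
      using l2_Cauchy_Schwarz[OF t(1) hs(1)] by linarith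
    also have "\<dots> \<le> 2 * (l2norm \<Omega> \<phi> * (r * l2norm \<Omega> (gradient \<phi>)))"
      using hs(2) by (intro mult_left_mono) auto
    finally have "l2norm \<Omega> \<phi> * l2norm \<Omega> \<phi> \<le> l2norm \<Omega> \<phi> * ((2 * r) * l2norm \<Omega> (gradient \<phi>))"
      by (simp add: power2_eq_square algebra_simps)
    then show ?thesis
      using r(1) l2norm_nonneg[of \<Omega> \<phi>] by (cases "l2norm \<Omega> \<phi> = 0") (auto simp: less_le)
  qed
  then show thesis using r(1) by (intro that[of "2 * r"]) auto
qed

text \<open>The gradients of the approximating test functions tend to the gradient of
  \<open>u\<close>, which is zero. By the inequality for test functions, the test functions
  themselves tend to zero, while they converge to \<open>u\<close> in the mean square.\<close>

lemma H10_eq_ae_zero: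
  assumes \<Omega>: "open \<Omega>" "bounded \<Omega>" and u: "u \<in> H10 \<Omega>" and zero: "l2norm \<Omega> (wgrad \<Omega> u) = 0"
  shows "AE x in lebesgue_on \<Omega>. u x = 0"
proof -
  have "u \<in> H1 \<Omega>" using u by (simp add: H10_iff)
  note U = H1_wgrad[OF this]
  obtain \<phi> where \<phi>: "\<And>n. test_fun \<Omega> (\<phi> n)" "(\<lambda>n. l2norm \<Omega> (\<lambda>x. u x - \<phi> n x)) \<longlonglongrightarrow> 0"
      "(\<lambda>n. l2norm \<Omega> (\<lambda>x. wgrad \<Omega> u x - gradient (\<phi> n) x)) \<longlonglongrightarrow> 0"
    using u unfolding H10_iff by blast
  obtain C where C: "0 \<le> C" "\<And>\<phi>. test_fun \<Omega> \<phi> \<Longrightarrow> l2norm \<Omega> \<phi> \<le> C * l2norm \<Omega> (gradient \<phi>)"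
    using Poincare_test_fun[OF \<Omega>] by blast
  note t = sq_int_test_fun[OF \<Omega> \<phi>(1)]
  have le: "l2norm \<Omega> u \<le> l2norm \<Omega> (\<lambda>x. u x - \<phi> n x) + C * l2norm \<Omega> (\<lambda>x. wgrad \<Omega> u x - gradient (\<phi> n) x)" for n
  proof -
    have "l2norm \<Omega> (gradient (\<phi> n)) \<le> l2norm \<Omega> (\<lambda>x. gradient (\<phi> n) x - wgrad \<Omega> u x)"
      using l2norm_add_le[OF sq_int_diff[OF t(2) U(2)] U(2)] zero by simp
    then have "C * l2norm \<Omega> (gradient (\<phi> n)) \<le> C * l2norm \<Omega> (\<lambda>x. wgrad \<Omega> u x - gradient (\<phi> n) x)"
      using C(1) by (intro mult_left_mono) (simp_all add: l2norm_minus_commute[of _ "wgrad \<Omega> u"])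
    moreover have "l2norm \<Omega> u \<le> l2norm \<Omega> (\<lambda>x. u x - \<phi> n x) + l2norm \<Omega> (\<phi> n)"
      using l2norm_add_le[OF sq_int_diff[OF U(1) t(1)[of n]] t(1)[of n]] by simp
    ultimately show ?thesis using C(2)[OF \<phi>(1), of n] by linarith
  qed
  have "(\<lambda>n. l2norm \<Omega> (\<lambda>x. u x - \<phi> n x) + C * l2norm \<Omega> (\<lambda>x. wgrad \<Omega> u x - gradient (\<phi> n) x)) \<longlonglongrightarrow> 0 + C * 0"
    by (intro tendsto_intros \<phi>)
  then have "l2norm \<Omega> u \<le> 0" using le by (intro LIMSEQ_le_const) auto
  then show ?thesis using l2norm_eq_0_iff[OF U(1)] l2norm_nonneg[of \<Omega> u] by linarith
qed

section \<open>Energy estimates\<close>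

locale monotone_problem =
  fixes P :: "'a::euclidean_space problem" and L :: real
  assumes open_domain: "open (Omega P)" and bounded_domain: "bounded (Omega P)"
    and mu_nonneg: "\<And>t. 0 \<le> t \<Longrightarrow> 0 \<le> mu P t"
    and mu_continuous: "continuous_on {0..} (mu P)"
    and growth_mono: "\<And>s t. 0 \<le> s \<Longrightarrow> s \<le> t \<Longrightarrow> mu P (s\<^sup>2) * s \<le> mu P (t\<^sup>2) * t"
    and growth_upper: "\<And>s t. 0 \<le> s \<Longrightarrow> s \<le> t \<Longrightarrow>
        mu P (t\<^sup>2) * t - mu P (s\<^sup>2) * s \<le> L / 3 * (t - s)"
    and data: "sq_int (Omega P) (src P)" "sq_int (Omega P) (vsrc P)"
begin

definition flux_map :: "'a \<Rightarrow> 'a" where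
  "flux_map \<xi> = mu P ((norm \<xi>)\<^sup>2) *\<^sub>R \<xi>"

text \<open>The integrand of the energy as a function of the length of the gradient. For positive
  \<open>t\<close> its derivative is \<open>mu P (t\<^sup>2) * t\<close>, the function that the
  growth condition controls.\<close>

definition energy_density :: "real \<Rightarrow> real" where
  "energy_density t = 1/2 * integral {0..t\<^sup>2} (mu P)"

lemma L_nonneg: "0 \<le> L"
  using growth_upper[of 0 1] growth_mono[of 0 1] by simp

lemma mu_times_le: "0 \<le> t \<Longrightarrow> mu P (t\<^sup>2) * t \<le> L / 3 * t"
  using growth_upper[of 0 t] by simp

lemma mu_le: "0 < t \<Longrightarrow> mu P (t\<^sup>2) \<le> L / 3"
  using mu_times_le[of t] by simp

text \<open>With s = |\<xi>| and t = |\<eta>|, the difference is mu(s^2) (\<xi> - \<eta>) + (mu(s^2)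
  - mu(t^2)) \<eta>. The first term costs L/3 because mu(s^2) \<le> L/3 for s > 0. The second costs
  2 L/3: one part from the growth condition, the other from mu(s^2) (t - s).\<close>

lemma flux_map_lipschitz: "norm (flux_map \<xi> - flux_map \<eta>) \<le> L * norm (\<xi> - \<eta>)"
proof (cases "\<xi> = 0")
  case True
  have "norm (flux_map \<eta>) \<le> L / 3 * norm \<eta>"
    using mu_times_le[of "norm \<eta>"] mu_nonneg by (simp add: flux_map_def)
  also have "\<dots> \<le> L * norm \<eta>" using L_nonneg by (intro mult_right_mono) auto
  finally show ?thesis using True by (simp add: flux_map_def)
next
  case False
  let ?s = "norm \<xi>" and ?t = "norm \<eta>"
  have ms: "mu P (?s\<^sup>2) \<le> L / 3" "0 \<le> mu P (?s\<^sup>2)" using False mu_le mu_nonneg by auto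
  have st: "\<bar>?s - ?t\<bar> \<le> norm (\<xi> - \<eta>)" by (rule norm_triangle_ineq3)
  have h: "\<bar>mu P (?s\<^sup>2) * ?s - mu P (?t\<^sup>2) * ?t\<bar> \<le> L / 3 * \<bar>?s - ?t\<bar>"
    using growth_mono[of ?s ?t] growth_upper[of ?s ?t] growth_mono[of ?t ?s] growth_upper[of ?t ?s]
    by (cases "?s \<le> ?t") auto
  have "flux_map \<xi> - flux_map \<eta> = mu P (?s\<^sup>2) *\<^sub>R (\<xi> - \<eta>) + (mu P (?s\<^sup>2) - mu P (?t\<^sup>2)) *\<^sub>R \<eta>"
    by (simp add: flux_map_def algebra_simps)
  then have "norm (flux_map \<xi> - flux_map \<eta>) \<le> mu P (?s\<^sup>2) * norm (\<xi> - \<eta>) + \<bar>mu P (?s\<^sup>2) - mu P (?t\<^sup>2)\<bar> * ?t"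
    using norm_triangle_ineq[of "mu P (?s\<^sup>2) *\<^sub>R (\<xi> - \<eta>)" "(mu P (?s\<^sup>2) - mu P (?t\<^sup>2)) *\<^sub>R \<eta>"] ms
    by simp
  also have "\<bar>mu P (?s\<^sup>2) - mu P (?t\<^sup>2)\<bar> * ?t = \<bar>(mu P (?s\<^sup>2) * ?s - mu P (?t\<^sup>2) * ?t) + mu P (?s\<^sup>2) * (?t - ?s)\<bar>"
  proof -
    have "(mu P (?s\<^sup>2) * ?s - mu P (?t\<^sup>2) * ?t) + mu P (?s\<^sup>2) * (?t - ?s) = (mu P (?s\<^sup>2) - mu P (?t\<^sup>2)) * ?t"
      by (simp add: algebra_simps)
    then show ?thesis by (simp add: abs_mult)
  qed
  also have "\<dots> \<le> L / 3 * \<bar>?s - ?t\<bar> + mu P (?s\<^sup>2) * \<bar>?s - ?t\<bar>"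
    using h ms abs_mult[of "mu P (?s\<^sup>2)" "?t - ?s"] abs_minus_commute[of ?s ?t]
      abs_triangle_ineq[of "mu P (?s\<^sup>2) * ?s - mu P (?t\<^sup>2) * ?t" "mu P (?s\<^sup>2) * (?t - ?s)"]
    by simp
  also have "\<dots> \<le> L / 3 * norm (\<xi> - \<eta>) + L / 3 * norm (\<xi> - \<eta>)"
    using st ms L_nonneg by (intro add_mono mult_mono) auto
  finally have "norm (flux_map \<xi> - flux_map \<eta>) \<le> mu P (?s\<^sup>2) * norm (\<xi> - \<eta>) + (L / 3 * norm (\<xi> - \<eta>) + L / 3 * norm (\<xi> - \<eta>))"
    by simp
  moreover have "mu P (?s\<^sup>2) * norm (\<xi> - \<eta>) \<le> L / 3 * norm (\<xi> - \<eta>)"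
    using ms by (intro mult_right_mono) auto
  ultimately show ?thesis by (simp add: field_simps)
qed

lemma mu_integrable: "mu P integrable_on {0..t}"
  by (rule integrable_continuous_interval) (rule continuous_on_subset[OF mu_continuous], auto)

lemma mono_integral_mu: "mono (\<lambda>t. integral {0..t} (mu P))"
  by (rule monoI, rule integral_subset_le) (auto simp: mu_integrable mu_nonneg)

lemma energy_density_deriv:
  assumes "0 < t"
  shows "(energy_density has_real_derivative mu P (t\<^sup>2) * t) (at t)"
proof -
  have "((\<lambda>x. integral {0..x} (mu P)) has_real_derivative mu P (t\<^sup>2)) (at (t\<^sup>2) within {0..t\<^sup>2 + 1})"
    by (rule integral_has_real_derivative) (auto intro: continuous_on_subset[OF mu_continuous])
  then have "((\<lambda>x. integral {0..x} (mu P)) has_real_derivative mu P (t\<^sup>2)) (at (t\<^sup>2))"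
    using assms by (subst (asm) at_within_interior) auto
  then have "((\<lambda>x. integral {0..x\<^sup>2} (mu P)) has_real_derivative mu P (t\<^sup>2) * (2 * t)) (at t)"
    by (rule DERIV_chain2) (auto intro!: derivative_eq_intros)
  then have "((\<lambda>x. 1/2 * integral {0..x\<^sup>2} (mu P)) has_real_derivative 1/2 * (mu P (t\<^sup>2) * (2 * t))) (at t)"
    by (rule DERIV_cmult)
  then show ?thesis by (simp add: energy_density_def[abs_def])
qed

lemma energy_density_continuous: "continuous_on {0..t} energy_density"
proof -
  have "continuous_on {0..t\<^sup>2} (\<lambda>x. integral {0..x} (mu P))"
    by (rule indefinite_integral_continuous_1[OF mu_integrable])
  then have "continuous_on {0..t} (\<lambda>x. integral {0..x\<^sup>2} (mu P))"
    by (rule continuous_on_compose2) (auto intro!: continuous_intros power_mono)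
  then show ?thesis unfolding energy_density_def[abs_def] by (intro continuous_intros)
qed

text \<open>The right-hand side minus the energy density is a function of \<open>r\<close> whose
  derivative is nonnegative for r > s and nonpositive for r < s, by the upper growth bound. Its
  minimum is therefore at r = s.\<close>

lemma energy_density_le_quadratic:
  assumes "0 \<le> s" "0 \<le> t"
  shows "energy_density t - energy_density s \<le> mu P (s\<^sup>2) * s * (t - s) + L / 6 * (t - s)\<^sup>2"
proof -
  define \<phi> where "\<phi> r = mu P (s\<^sup>2) * s * (r - s) + L / 6 * (r - s)\<^sup>2 - energy_density r" for r
  have D: "(\<phi> has_real_derivative mu P (s\<^sup>2) * s + L / 3 * (r - s) - mu P (r\<^sup>2) * r) (at r)" if "0 < r" for r
    unfolding \<phi>_def using energy_density_deriv[OF that]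
    by (auto intro!: derivative_eq_intros simp: field_simps)
  \<comment> \<open>The derivative is only computed for r > 0. Continuity up to 0 allows the
    monotonicity criteria that ask for derivatives in the open interval only.\<close>
  have c: "continuous_on {a..b} \<phi>" if "0 \<le> a" for a b
    unfolding \<phi>_def
    by (intro continuous_intros continuous_on_subset[OF energy_density_continuous[of b]]) (use that in auto)
  have "\<phi> s \<le> \<phi> t"
  proof (cases "s \<le> t")
    case True
    then show ?thesis
    proof (rule DERIV_nonneg_imp_increasing_open)
      fix r assume "s < r" "r < t"
      then show "\<exists>y. (\<phi> has_real_derivative y) (at r) \<and> 0 \<le> y"
        using D[of r] growth_upper[of s r] assms by (intro exI[of _ "mu P (s\<^sup>2) * s + L / 3 * (r - s) - mu P (r\<^sup>2) * r"] conjI) auto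
    qed (use c assms in auto)
  next
    case False
    then have "t \<le> s" by simp
    then show ?thesis
    proof (rule DERIV_nonpos_imp_decreasing_open)
      fix r assume "t < r" "r < s"
      then show "\<exists>y. (\<phi> has_real_derivative y) (at r) \<and> y \<le> 0"
        using D[of r] growth_upper[of r s] assms by (intro exI[of _ "mu P (s\<^sup>2) * s + L / 3 * (r - s) - mu P (r\<^sup>2) * r"] conjI) (auto simp: field_simps)
    qed (use c assms in auto)
  qed
  then show ?thesis by (simp add: \<phi>_def)
qed

text \<open>Compared with the estimate for lengths, both terms change by a multiple of the
  Cauchy-Schwarz defect g = |\<xi>| |\<eta>| - \<xi> . \<eta>. The quadratic term gains L/3 g and
  the flux term loses mu(|\<xi>|^2) g \<le> L/3 g, where g = 0 if \<xi> = 0.\<close>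

lemma energy_density_le:
  "energy_density (norm \<eta>) - energy_density (norm \<xi>)
    \<le> flux_map \<xi> \<bullet> (\<eta> - \<xi>) + L / 6 * (norm (\<eta> - \<xi>))\<^sup>2"
proof -
  let ?s = "norm \<xi>" and ?t = "norm \<eta>"
  define g where "g = ?s * ?t - \<xi> \<bullet> \<eta>"
  have g: "0 \<le> g" using norm_cauchy_schwarz[of \<xi> \<eta>] by (simp add: g_def)
  have sq: "(norm (\<eta> - \<xi>))\<^sup>2 = (?t - ?s)\<^sup>2 + 2 * g"
  proof -
    have "(norm (\<eta> - \<xi>))\<^sup>2 = ?t\<^sup>2 - 2 * (\<xi> \<bullet> \<eta>) + ?s\<^sup>2"
      by (simp add: power2_norm_eq_inner inner_diff_left inner_diff_right inner_commute[of \<eta> \<xi>])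
    then show ?thesis by (simp add: g_def power2_diff algebra_simps)
  qed
  have fl: "flux_map \<xi> \<bullet> (\<eta> - \<xi>) = mu P (?s\<^sup>2) * ?s * (?t - ?s) - mu P (?s\<^sup>2) * g"
    by (simp add: flux_map_def g_def inner_diff_right dot_square_norm)
      (simp add: power2_eq_square algebra_simps)
  have "mu P (?s\<^sup>2) * g \<le> L / 3 * g"
  proof (cases "\<xi> = 0")
    case False
    then show ?thesis using g mu_le[of ?s] by (intro mult_right_mono) auto
  qed (simp add: g_def)
  then show ?thesis
    using energy_density_le_quadratic[of ?s ?t] unfolding sq fl by (simp add: algebra_simps)
qed

lemma energy_density_bounds: "0 \<le> energy_density t" "0 \<le> t \<Longrightarrow> energy_density t \<le> L / 6 * t\<^sup>2"
proof -
  show "0 \<le> energy_density t"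
    using integral_nonneg[OF mu_integrable] mu_nonneg by (simp add: energy_density_def)
  show "energy_density t \<le> L / 6 * t\<^sup>2" if "0 \<le> t"
    using energy_density_le_quadratic[of 0 t] that by (simp add: energy_density_def)
qed

lemma sq_int_flux_map:
  assumes "sq_int (Omega P) g"
  shows "sq_int (Omega P) (\<lambda>x. flux_map (g x))"
proof (rule l2norm_mono(1)[OF assms])
  \<comment> \<open>\<open>mu P\<close> is continuous on the nonnegative half-line only; truncating
    the argument gives a continuous, hence Borel measurable, function on the whole line.\<close>
  have "continuous_on UNIV (\<lambda>t. mu P (max 0 t))"
    by (rule continuous_on_compose2[OF mu_continuous]) (auto intro!: continuous_intros)
  then have "(\<lambda>t. mu P (max 0 t)) \<in> borel_measurable borel" by (rule borel_measurable_continuous_onI)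
  then have "(\<lambda>x. mu P (max 0 ((norm (g x))\<^sup>2))) \<in> borel_measurable (lebesgue_on (Omega P))"
    by (rule measurable_compose[rotated]) (use assms in measurable)
  then have "(\<lambda>x. mu P ((norm (g x))\<^sup>2)) \<in> borel_measurable (lebesgue_on (Omega P))" by simp
  then show "(\<lambda>x. flux_map (g x)) \<in> borel_measurable (lebesgue_on (Omega P))"
    unfolding flux_map_def by (rule borel_measurable_scaleR) (rule sq_int_measurable[OF assms])
  show "AE x in lebesgue_on (Omega P). norm (flux_map (g x)) \<le> L * norm (g x)"
    using flux_map_lipschitz[of _ 0] by (simp add: flux_map_def)
qed (rule L_nonneg)

lemma integrable_energy_density:
  assumes "sq_int (Omega P) g"
  shows "integrable (lebesgue_on (Omega P)) (\<lambda>x. energy_density (norm (g x)))"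
proof (rule Bochner_Integration.integrable_bound)
  show "integrable (lebesgue_on (Omega P)) (\<lambda>x. L / 6 * (norm (g x))\<^sup>2)"
    using assms by (simp add: sq_int_def)
  have "(\<lambda>x. integral {0..(norm (g x))\<^sup>2} (mu P)) \<in> borel_measurable (lebesgue_on (Omega P))"
    by (rule measurable_compose[OF _ borel_measurable_mono[OF mono_integral_mu]]) (use assms in measurable)
  then show "(\<lambda>x. energy_density (norm (g x))) \<in> borel_measurable (lebesgue_on (Omega P))"
    unfolding energy_density_def by measurable
  show "AE x in lebesgue_on (Omega P). norm (energy_density (norm (g x))) \<le> norm (L / 6 * (norm (g x))\<^sup>2)"
    using energy_density_bounds L_nonneg by (intro AE_I2) simp
qed

section \<open>Norm, load and energy on \<open>Xspace\<close>\<close>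

lemma enorm_eq: "enorm P v = l2norm (Omega P) (wgrad (Omega P) v)"
  by (simp add: enorm_def l2norm_def)

lemma Xspace_H1: "v \<in> Xspace P \<Longrightarrow> v \<in> H1 (Omega P)"
  by (simp add: Xspace_def H10_iff)

lemmas Xspace_wgrad = H1_wgrad[OF Xspace_H1]

lemma Xspace_diff: "u \<in> Xspace P \<Longrightarrow> v \<in> Xspace P \<Longrightarrow> u - v \<in> Xspace P"
  unfolding Xspace_def by (rule H10_diff[OF open_domain bounded_domain])

lemma wgrad_diff:
  "u \<in> Xspace P \<Longrightarrow> v \<in> Xspace P \<Longrightarrow>
    AE x in lebesgue_on (Omega P). wgrad (Omega P) (u - v) x = wgrad (Omega P) u x - wgrad (Omega P) v x"
  by (intro H1_diff(2) open_domain bounded_domain Xspace_H1)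

lemma enorm_nonneg [simp]: "0 \<le> enorm P v"
  by (simp add: enorm_eq)

lemma enorm_diff:
  assumes "u \<in> Xspace P" "v \<in> Xspace P"
  shows "enorm P (u - v) = l2norm (Omega P) (\<lambda>x. wgrad (Omega P) u x - wgrad (Omega P) v x)"
  unfolding enorm_eq using assms
  by (intro l2norm_cong_AE wgrad_diff sq_int_diff Xspace_wgrad Xspace_diff)

lemma enorm_minus_commute:
  "u \<in> Xspace P \<Longrightarrow> v \<in> Xspace P \<Longrightarrow> enorm P (u - v) = enorm P (v - u)"
  by (simp add: enorm_diff l2norm_minus_commute[of _ "wgrad (Omega P) u"])

lemma enorm_triangle:
  assumes "u \<in> Xspace P" "v \<in> Xspace P" "w \<in> Xspace P"
  shows "enorm P (u - w) \<le> enorm P (u - v) + enorm P (v - w)"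
  using l2norm_add_le[of "Omega P" "\<lambda>x. wgrad (Omega P) u x - wgrad (Omega P) v x"
      "\<lambda>x. wgrad (Omega P) v x - wgrad (Omega P) w x"] assms
  by (simp add: enorm_diff sq_int_diff Xspace_wgrad)

lemma enorm_diff_eq_0_iff:
  assumes u: "u \<in> Xspace P" and v: "v \<in> Xspace P"
  shows "enorm P (u - v) = 0 \<longleftrightarrow> eq_ae (Omega P) u v"
proof
  assume "enorm P (u - v) = 0"
  then have "AE x in lebesgue_on (Omega P). (u - v) x = 0"
    using Xspace_diff[OF u v] H10_eq_ae_zero[OF open_domain bounded_domain, of "u - v"]
    by (simp only: Xspace_def enorm_eq)
  then show "eq_ae (Omega P) u v" by (simp add: eq_ae_def)
next
  assume "eq_ae (Omega P) u v"
  then have "wgrad (Omega P) u = wgrad (Omega P) v"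
    using u v by (intro wgrad_cong_eq_ae Xspace_H1 open_domain bounded_domain)
  then show "enorm P (u - v) = 0" using u v by (simp add: enorm_diff l2norm_def)
qed

lemma load_integrable:
  assumes "v \<in> Xspace P"
  shows "integrable (lebesgue_on (Omega P)) (\<lambda>x. src P x * v x)"
    "integrable (lebesgue_on (Omega P)) (\<lambda>x. vsrc P x \<bullet> wgrad (Omega P) v x)"
  using sq_int_inner[OF data(1) Xspace_wgrad(1)[OF assms]] sq_int_inner[OF data(2) Xspace_wgrad(2)[OF assms]]
  by auto

lemma integral_inner_wgrad_diff:
  assumes "sq_int (Omega P) F" "u \<in> Xspace P" "v \<in> Xspace P"
  shows "(LINT x|lebesgue_on (Omega P). F x \<bullet> wgrad (Omega P) (u - v) x) =
    (LINT x|lebesgue_on (Omega P). F x \<bullet> wgrad (Omega P) u x) -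
    (LINT x|lebesgue_on (Omega P). F x \<bullet> wgrad (Omega P) v x)"
proof -
  note i = sq_int_inner[OF assms(1) Xspace_wgrad(2)]
  have "(LINT x|lebesgue_on (Omega P). F x \<bullet> wgrad (Omega P) (u - v) x) =
      (LINT x|lebesgue_on (Omega P). F x \<bullet> wgrad (Omega P) u x - F x \<bullet> wgrad (Omega P) v x)"
    using wgrad_diff[OF assms(2,3)]
    by (intro integral_cong_AE borel_measurable_integrable i Bochner_Integration.integrable_diff assms Xspace_diff)
       (auto simp: inner_diff_right)
  then show ?thesis using i[OF assms(2)] i[OF assms(3)] by simp
qed

lemma load_diff:
  assumes "u \<in> Xspace P" "v \<in> Xspace P"
  shows "load P (u - v) = load P u - load P v"
  using load_integrable(1)[OF assms(1)] load_integrable(1)[OF assms(2)]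
  by (simp add: load_def integral_inner_wgrad_diff[OF data(2) assms] algebra_simps)

lemma dsq_eq_ae:
  assumes u: "u \<in> Xspace P" and v: "v \<in> Xspace P" and ae: "eq_ae (Omega P) u v"
  shows "dsq P u v = 0"
proof -
  have w: "wgrad (Omega P) u = wgrad (Omega P) v"
    using u v ae by (intro wgrad_cong_eq_ae Xspace_H1 open_domain bounded_domain)
  have "(LINT x|lebesgue_on (Omega P). src P x * u x) = (LINT x|lebesgue_on (Omega P). src P x * v x)"
    using ae unfolding eq_ae_def
    by (intro integral_cong_AE borel_measurable_integrable load_integrable u v) auto
  then show ?thesis by (simp add: dsq_def energy_def load_def w)
qed

lemma flux_eq: "flux P v = (\<lambda>x. flux_map (wgrad (Omega P) v x))"
  by (simp add: flux_def[abs_def] flux_map_def)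

lemma sq_int_flux: "v \<in> Xspace P \<Longrightarrow> sq_int (Omega P) (flux P v)"
  unfolding flux_eq by (intro sq_int_flux_map Xspace_wgrad)

lemma Aop_lipschitz:
  assumes u: "u \<in> Xspace P" and v: "v \<in> Xspace P" and w: "w \<in> Xspace P"
  shows "\<bar>Aop P u w - Aop P v w\<bar> \<le> L * enorm P (u - v) * enorm P w"
proof -
  have f: "sq_int (Omega P) (\<lambda>x. flux P u x - flux P v x)" by (intro sq_int_diff sq_int_flux u v)
  have "Aop P u w - Aop P v w = (LINT x|lebesgue_on (Omega P). (flux P u x - flux P v x) \<bullet> wgrad (Omega P) w x)"
    using sq_int_inner[OF sq_int_flux[OF u] Xspace_wgrad(2)[OF w]] sq_int_inner[OF sq_int_flux[OF v] Xspace_wgrad(2)[OF w]]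
    by (simp add: Aop_def inner_diff_left)
  then have "\<bar>Aop P u w - Aop P v w\<bar> \<le> l2norm (Omega P) (\<lambda>x. flux P u x - flux P v x) * enorm P w"
    using l2_Cauchy_Schwarz[OF f Xspace_wgrad(2)[OF w]] by (simp add: enorm_eq)
  also have "\<dots> \<le> (L * enorm P (u - v)) * enorm P w"
  proof (rule mult_right_mono)
    show "l2norm (Omega P) (\<lambda>x. flux P u x - flux P v x) \<le> L * enorm P (u - v)"
      unfolding enorm_diff[OF u v]
      by (rule l2norm_mono(2)[OF sq_int_diff[OF Xspace_wgrad(2)[OF u] Xspace_wgrad(2)[OF v]]
            sq_int_measurable[OF f] L_nonneg])
         (simp add: flux_eq flux_map_lipschitz)
  qed simp
  finally show ?thesis .
qed

lemma energy_eq: "energy P v = (LINT x|lebesgue_on (Omega P). energy_density (norm (wgrad (Omega P) v x))) - load P v"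
  by (simp add: energy_def energy_density_def)

text \<open>The pointwise estimate \<open>energy_density_le\<close>, applied to the two gradients,
  is integrated over the domain. The load is linear and contributes nothing to the quadratic
  term.\<close>

lemma energy_diff_le:
  assumes u: "u \<in> Xspace P" and v: "v \<in> Xspace P"
  shows "energy P v - energy P u \<le> Aop P u (v - u) - load P (v - u) + L / 6 * (enorm P (v - u))\<^sup>2"
proof -
  let ?g = "wgrad (Omega P)"
  note U = Xspace_wgrad(2)[OF u] and V = Xspace_wgrad(2)[OF v] and F = sq_int_flux[OF u]
  note VU = sq_int_diff[OF V U]
  have "(LINT x|lebesgue_on (Omega P). energy_density (norm (?g v x)) - energy_density (norm (?g u x)))
      \<le> (LINT x|lebesgue_on (Omega P). flux P u x \<bullet> (?g v x - ?g u x) + L / 6 * (norm (?g v x - ?g u x))\<^sup>2)"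
    using VU energy_density_le
    by (intro integral_mono Bochner_Integration.integrable_diff Bochner_Integration.integrable_add
        integrable_energy_density sq_int_inner F V U VU)
      (auto simp: sq_int_def flux_eq)
  also have "\<dots> = (LINT x|lebesgue_on (Omega P). flux P u x \<bullet> (?g v x - ?g u x)) + L / 6 * (enorm P (v - u))\<^sup>2"
    unfolding enorm_diff[OF v u] l2norm_sq
    using VU by (subst Bochner_Integration.integral_add) (auto intro!: sq_int_inner F VU simp: sq_int_def)
  finally have le: "(LINT x|lebesgue_on (Omega P). energy_density (norm (?g v x)) - energy_density (norm (?g u x)))
      \<le> (LINT x|lebesgue_on (Omega P). flux P u x \<bullet> (?g v x - ?g u x)) + L / 6 * (enorm P (v - u))\<^sup>2" .
  have "(LINT x|lebesgue_on (Omega P). flux P u x \<bullet> (?g v x - ?g u x)) = Aop P u (v - u)"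
    unfolding Aop_def integral_inner_wgrad_diff[OF F v u] inner_diff_right
    by (intro Bochner_Integration.integral_diff sq_int_inner F U V)
  moreover have "(LINT x|lebesgue_on (Omega P). energy_density (norm (?g v x)) - energy_density (norm (?g u x)))
      = (LINT x|lebesgue_on (Omega P). energy_density (norm (?g v x))) - (LINT x|lebesgue_on (Omega P). energy_density (norm (?g u x)))"
    by (intro Bochner_Integration.integral_diff integrable_energy_density U V)
  ultimately show ?thesis
    using le unfolding energy_eq load_diff[OF v u] by linarith
qed

text \<open>With e = |||s - u|||, the energy of \<open>v\<close> exceeds that of \<open>s\<close> by
  at most (L + C + L/6) \<delta> e^2, while |||v - u||| \<le> (1 + \<delta>) e. The hypothesis
  \<open>small\<close> balances these two effects against the energy decrease Cs e^2 of
  \<open>s\<close>.\<close>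

lemma dsq_lower_bound_perturbed:
  assumes X: "XH \<subseteq> Xspace P" "\<And>v w. v \<in> XH \<Longrightarrow> w \<in> XH \<Longrightarrow> v - w \<in> XH"
    and u: "u \<in> XH" and v: "v \<in> XH" and s: "linearized_solution P a XH u s"
    and bil: "sym_bilinear_on (Xspace P) (a u)"
    and cnt: "\<And>v w. v \<in> Xspace P \<Longrightarrow> w \<in> Xspace P \<Longrightarrow> \<bar>a u v w\<bar> \<le> C * enorm P v * enorm P w"
    and Cs: "Cs * (enorm P (s - u))\<^sup>2 \<le> dsq P s u" and C: "0 < C" and C': "0 \<le> C'"
    and \<delta>: "0 \<le> \<delta>" "\<delta> \<le> 1" "enorm P (s - v) \<le> \<delta> * enorm P (s - u)"
    and small: "C' * (1 + \<delta>)\<^sup>2 \<le> Cs - (L + C + L / 6) * \<delta>"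
  shows "C' * (enorm P (v - u))\<^sup>2 \<le> dsq P v u"
proof -
  have sXH: "s \<in> XH" using s by (simp add: linearized_solution_def)
  note uX = X(1)[THEN subsetD, OF u] and vX = X(1)[THEN subsetD, OF v] and sX = X(1)[THEN subsetD, OF sXH]
  define e where "e = enorm P (s - u)"
  define d where "d = enorm P (v - s)"
  have e: "0 \<le> e" and d: "0 \<le> d" "d \<le> \<delta> * e"
    using \<delta>(3) enorm_minus_commute[OF sX vX] by (auto simp: e_def d_def)
  have wXH: "v - s \<in> XH" by (rule X(2)[OF v sXH])
  note wX = X(1)[THEN subsetD, OF wXH]
  have lin: "a u s (v - s) = a u u (v - s) + load P (v - s) - Aop P u (v - s)"
    using s wXH by (simp add: linearized_solution_def)
  have "a u (\<lambda>x. 1 * s x + (- 1) * u x) (v - s) = 1 * a u s (v - s) + (- 1) * a u u (v - s)"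
    using bil sX uX wX unfolding sym_bilinear_on_def by blast
  then have bl: "a u (s - u) (v - s) = a u s (v - s) - a u u (v - s)" by (simp add: fun_diff_def)
  have "energy P v - energy P s \<le> Aop P s (v - s) - load P (v - s) + L / 6 * d\<^sup>2"
    using energy_diff_le[OF sX vX] by (simp add: d_def)
  \<comment> \<open>The equation for \<open>s\<close>, tested with v - s, eliminates the load. What
    remains are two differences in s - u, bounded by Lipschitz continuity (\<open>L\<close>) and by
    continuity of the bilinear form (\<open>C\<close>).\<close>
  also have "Aop P s (v - s) - load P (v - s) = (Aop P s (v - s) - Aop P u (v - s)) - a u (s - u) (v - s)"
    using lin bl by simp
  also have "\<dots> \<le> L * e * d + C * e * d"
    using Aop_lipschitz[OF sX uX wX] cnt[OF Xspace_diff[OF sX uX] wX] by (simp add: e_def d_def)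
  finally have "energy P v - energy P s \<le> (L + C) * (e * d) + L / 6 * d\<^sup>2" by (simp add: algebra_simps)
  \<comment> \<open>Since \<delta> \<le> 1, the square of \<delta> in the quadratic term may be
    replaced by \<delta>, so that the whole loss is proportional to \<delta>.\<close>
  also have "\<dots> \<le> (L + C) * (e * (\<delta> * e)) + L / 6 * (\<delta> * e\<^sup>2)"
  proof (intro add_mono mult_left_mono d(2) e)
    have "d\<^sup>2 \<le> (\<delta> * e)\<^sup>2" using d by (intro power_mono)
    also have "\<dots> = \<delta> * (\<delta> * e\<^sup>2)" by (simp add: power2_eq_square)
    also have "\<dots> \<le> 1 * (\<delta> * e\<^sup>2)" using \<delta> by (intro mult_right_mono) auto
    finally show "d\<^sup>2 \<le> \<delta> * e\<^sup>2" by simp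
  qed (use L_nonneg C in auto)
  also have "\<dots> = (L + C + L / 6) * \<delta> * e\<^sup>2" by (simp add: power2_eq_square algebra_simps)
  finally have E: "energy P v - energy P s \<le> (L + C + L / 6) * \<delta> * e\<^sup>2" .
  have "enorm P (v - u) \<le> d + e"
    using enorm_triangle[OF vX sX uX] by (simp add: e_def d_def)
  also have "\<dots> \<le> (1 + \<delta>) * e" using d by (simp add: algebra_simps)
  finally have "(enorm P (v - u))\<^sup>2 \<le> ((1 + \<delta>) * e)\<^sup>2" by (intro power_mono) auto
  then have "C' * (enorm P (v - u))\<^sup>2 \<le> C' * ((1 + \<delta>) * e)\<^sup>2" using C' by (rule mult_left_mono)
  also have "\<dots> = (C' * (1 + \<delta>)\<^sup>2) * e\<^sup>2" by (simp add: power_mult_distrib)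
  also have "\<dots> \<le> (Cs - (L + C + L / 6) * \<delta>) * e\<^sup>2" using small by (rule mult_right_mono) simp
  also have "\<dots> \<le> dsq P v u" using Cs E by (simp add: dsq_def e_def algebra_simps)
  finally show ?thesis .
qed

end

section \<open>Finite element spaces and their nestedness\<close>

lemma poly_fun_diff:
  assumes "poly_fun p q" "poly_fun p r"
  shows "poly_fun p (\<lambda>x. q x - r x)"
  using assms unfolding poly_fun_def
proof (elim exE)
  fix c d
  let ?S = "\<lambda>c x. \<Sum>m | m \<in> Basis \<rightarrow>\<^sub>E {..p} \<and> sum m Basis \<le> p. c m * (\<Prod>b\<in>Basis. (x \<bullet> b) ^ m b)"
  assume "\<forall>x. q x = ?S c x" "\<forall>x. r x = ?S d x"
  moreover have "?S (\<lambda>m. c m - d m) x = ?S c x - ?S d x" for x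
    by (simp only: sum_subtractf left_diff_distrib)
  ultimately show "\<exists>c. \<forall>x. q x - r x = ?S c x"
    by (intro exI[of _ "\<lambda>m. c m - d m"] allI) (simp only:)
qed

lemma (in monotone_problem) fe_space_diff:
  assumes "u \<in> fe_space P p T" "v \<in> fe_space P p T"
  shows "u - v \<in> fe_space P p T"
proof -
  have "\<exists>q. poly_fun p q \<and> eq_ae (elt_set t) (u - v) q" if t: "t \<in> T" for t
  proof -
    obtain q r where "poly_fun p q" "eq_ae (elt_set t) u q" "poly_fun p r" "eq_ae (elt_set t) v r"
      using assms t unfolding fe_space_def by blast
    then show ?thesis
      by (intro exI[of _ "\<lambda>x. q x - r x"]) (auto intro: poly_fun_diff simp: eq_ae_def)
  qed
  then show ?thesis using assms Xspace_diff by (auto simp: fe_space_def)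
qed

lemma eq_ae_subset:
  assumes "eq_ae S u v" "T \<subseteq> S" "S \<in> sets lebesgue" "T \<in> sets lebesgue"
  shows "eq_ae T u v"
  using assms by (auto simp: eq_ae_def AE_restrict_space_iff elim: eventually_mono)

lemma elt_set_lebesgue: "elt_set t \<in> sets lebesgue"
  by (simp add: elt_set_def verts_def compact_convex_hull finite_imp_compact lmeasurable_compact fmeasurableD)

text \<open>The vertices of a child are vertices of the parent and the midpoint of its refinement
  edge. Nonemptiness of the vertex list gives \<open>hd\<close> and \<open>last\<close> their
  meaning and is inherited, so it can be carried through a chain of bisections.\<close>

lemma children_subset:
  assumes "t' \<in> children t" "fst t \<noteq> []"
  shows "fst t' \<noteq> []" "elt_set t' \<subseteq> elt_set t"
proof -
  let ?C = "convex hull set (fst t)"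
  have ends: "hd (fst t) \<in> ?C" "last (fst t) \<in> ?C"
    using assms(2) by (auto simp: hull_inc)
  then have m: "midpoint (hd (fst t)) (last (fst t)) \<in> ?C"
    by (rule midpoints_in_convex_hull)
  have ys: "y \<in> ?C" if "y \<in> set (butlast (tl (fst t)))" for y
    using that assms(2) by (auto intro!: hull_inc dest!: in_set_butlastD list.set_sel(2))
  have "set (fst t') \<subseteq> ?C"
    using assms ends m by (auto simp: children_def Let_def dest: ys in_set_takeD[THEN ys] in_set_dropD[THEN ys])
  then show "elt_set t' \<subseteq> elt_set t"
    unfolding elt_set_def verts_def by (simp add: hull_minimal)
  show "fst t' \<noteq> []" using assms by (auto simp: children_def Let_def)
qed

lemma nvb_le_refines:
  assumes "nvb_le T T'" "\<forall>t\<in>T. fst t \<noteq> []"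
  shows "\<forall>t'\<in>T'. fst t' \<noteq> [] \<and> (\<exists>t\<in>T. elt_set t' \<subseteq> elt_set t)"
  using assms(1) unfolding nvb_le_def
proof (induction rule: rtranclp_induct)
  case base
  then show ?case using assms(2) by auto
next
  case (step T1 T2)
  then obtain t where t: "t \<in> T1" "T2 = (T1 - {t}) \<union> children t" by (auto simp: nvb_step_def)
  show ?case
  proof
    fix t' assume "t' \<in> T2"
    then consider "t' \<in> T1" | "t' \<in> children t" using t by auto
    then show "fst t' \<noteq> [] \<and> (\<exists>t\<in>T. elt_set t' \<subseteq> elt_set t)"
    proof cases
      case 1
      then show ?thesis using step.IH by blast
    next
      case 2
      obtain t0 where "t0 \<in> T" "elt_set t \<subseteq> elt_set t0" "fst t \<noteq> []" using step.IH t(1) by blast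
      then show ?thesis using children_subset[OF 2] by (intro conjI bexI[of _ t0]) simp_all
    qed
  qed
qed

text \<open>This is needed because the final iterate on one mesh becomes the initial iterate on the
  next, where it must again be a discrete function.\<close>

lemma fe_space_mono:
  assumes "nvb_le T T'" "\<forall>t\<in>T. fst t \<noteq> []"
  shows "fe_space P p T \<subseteq> fe_space P p T'"
proof
  fix v assume v: "v \<in> fe_space P p T"
  have "\<exists>q. poly_fun p q \<and> eq_ae (elt_set t') v q" if t': "t' \<in> T'" for t'
  proof -
    obtain t where t: "t \<in> T" "elt_set t' \<subseteq> elt_set t" using nvb_le_refines[OF assms] t' by blast
    then obtain q where "poly_fun p q" "eq_ae (elt_set t) v q" using v unfolding fe_space_def by blast
    then show ?thesis using eq_ae_subset[OF _ t(2) elt_set_lebesgue elt_set_lebesgue] by blast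
  qed
  then show "v \<in> fe_space P p T'" using v by (simp add: fe_space_def)
qed

section \<open>The adaptive algorithm\<close>

text \<open>Beyond j = 1 the index \<open>j\<close> grows only by the rule \<open>next_j\<close>, so
  every smaller positive index was reached as well and none of the exit tests held there.\<close>

lemma Qset_prefix:
  assumes "(l, k, j) \<in> Qset P A R"
  shows "(l, k, 0) \<in> Qset P A R" "1 \<le> j \<Longrightarrow> 1 \<le> k"
    "\<And>i. 1 \<le> i \<Longrightarrow> i < j \<Longrightarrow> (l, k, i) \<in> Qset P A R \<and> \<not> tau_stop P A R l k i \<and> \<not> leave_j P R l k i"
proof -
  have "(l, k, 0) \<in> Qset P A R \<and> (1 \<le> j \<longrightarrow> 1 \<le> k) \<and>
    (\<forall>i. 1 \<le> i \<and> i < j \<longrightarrow> (l, k, i) \<in> Qset P A R \<and> \<not> tau_stop P A R l k i \<and> \<not> leave_j P R l k i)"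
    using assms
  proof (induction l k j rule: Qset.induct)
    case start
    then show ?case by (auto intro: Qset.start[simplified])
  next
    case (first_k l)
    then show ?case by (auto intro: Qset.first_k[simplified])
  next
    case (first_j l k)
    then show ?case by auto
  next
    case (next_j l k j)
    then show ?case by (auto simp: less_Suc_eq)
  next
    case (next_k l k j)
    then show ?case by (auto intro: Qset.next_k[simplified])
  next
    case (next_l l k j)
    then show ?case by (auto intro: Qset.next_l[simplified])
  qed
  then show "(l, k, 0) \<in> Qset P A R" "1 \<le> j \<Longrightarrow> 1 \<le> k"
    "\<And>i. 1 \<le> i \<Longrightarrow> i < j \<Longrightarrow> (l, k, i) \<in> Qset P A R \<and> \<not> tau_stop P A R l k i \<and> \<not> leave_j P R l k i"
    by blast+
qed

lemma j_done_last:
  assumes "j_done P A R l k j" "(l, k, i) \<in> Qset P A R"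
  shows "i \<le> j"
proof (rule ccontr)
  assume "\<not> i \<le> j"
  then show False using assms(1) Qset_prefix(3)[OF assms(2), of j] by (simp add: j_done_def)
qed

lemma j_done_unique:
  assumes "j_done P A R l k j" "(l, k, j) \<in> Qset P A R" "j_done P A R l k i" "(l, k, i) \<in> Qset P A R"
  shows "i = j"
  using assms j_done_last by (metis antisym)

lemma tau_stop_not_j_done:
  assumes "tau_stop P A R l k j" "(l, k, j) \<in> Qset P A R" "1 \<le> j" "(l, k, i) \<in> Qset P A R"
  shows "\<not> j_done P A R l k i"
proof
  assume d: "j_done P A R l k i"
  show False
    using j_done_last[OF d assms(2)] Qset_prefix(3)[OF assms(4) assms(3)] assms(1) d
    by (cases "j = i") (auto simp: j_done_def)
qed

lemma jlast_eqI:
  assumes "(l, k, j) \<in> Qset P A R" "\<And>i. (l, k, i) \<in> Qset P A R \<Longrightarrow> i \<le> j"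
  shows "jlast P A R l k = enat j" "iter_last P A R l k = iter R l k j"
proof -
  show "jlast P A R l k = enat j"
    unfolding jlast_def using assms by (intro antisym SUP_least SUP_upper2[of j]) auto
  then show "iter_last P A R l k = iter R l k j" by (simp add: iter_last_def)
qed

text \<open>\<open>loop_no P A R n l k\<close> says that the \<open>n\<close>-th executed \<open>j\<close>-loop has the indices \<open>(l, k)\<close>.\<close>

inductive loop_no :: "'a::euclidean_space problem \<Rightarrow> params \<Rightarrow> 'a run \<Rightarrow> nat \<Rightarrow> nat \<Rightarrow> nat \<Rightarrow> bool"
  for P A R where
  first: "loop_no P A R 0 0 1"
| again: "loop_no P A R n l k \<Longrightarrow> (l, k, j) \<in> Qset P A R \<Longrightarrow> j_done P A R l k j \<Longrightarrow>
    \<not> leave_k P A R l k j \<Longrightarrow> loop_no P A R (Suc n) l (Suc k)"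
| refined: "loop_no P A R n l k \<Longrightarrow> (l, k, j) \<in> Qset P A R \<Longrightarrow> j_done P A R l k j \<Longrightarrow>
    leave_k P A R l k j \<Longrightarrow> loop_no P A R (Suc n) (Suc l) 1"

text \<open>A \<open>j\<close>-loop has a unique regular end by \<open>j_done_unique\<close>, and
  \<open>leave_k\<close> at that end decides between the two possible successors.\<close>

lemma loop_no_unique: "loop_no P A R n l k \<Longrightarrow> loop_no P A R n l' k' \<Longrightarrow> l = l' \<and> k = k'"
proof (induction arbitrary: l' k' rule: loop_no.induct)
  case first
  then show ?case by (auto elim: loop_no.cases)
next
  case (again n l k j)
  from again.prems show ?case
    by (cases rule: loop_no.cases) (use again j_done_unique in blast)+
next
  case (refined n l k j)
  from refined.prems show ?case
    by (cases rule: loop_no.cases) (use refined j_done_unique in blast)+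
qed

text \<open>An index with k = 0 precedes the first \<open>j\<close>-loop of its level and is
  attributed to that loop; this explains the maximum.\<close>

lemma Qset_loop_no: "(l, k, j) \<in> Qset P A R \<Longrightarrow> \<exists>n. loop_no P A R n l (max k 1)"
proof (induction l k j rule: Qset.induct)
  case start
  then show ?case using loop_no.first by auto
next
  case (next_k l k j)
  then have "max k 1 = k" by (simp add: j_done_def)
  then show ?case using next_k loop_no.again by (metis max.absorb1 le_SucI max.cobounded2)
next
  case (next_l l k j)
  then have "max k 1 = k" by (simp add: j_done_def)
  then show ?case using next_l loop_no.refined by (metis max_0L)
qed auto

section \<open>The control variables \<open>alpha_min\<close> and \<open>Jmax\<close> along the
  run\<close>

locale ailfem_loop =
  fixes P :: "'a::euclidean_space problem" and A :: params and R :: "'a run" and c :: real and J :: nat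
  assumes alpha_min_init: "alpha_min R 0 1 = alpha_min0 A" and Jmax_init: "Jmax R 0 1 = Jmax0 A"
    and again_upd: "\<And>l k j. (l, k, j) \<in> Qset P A R \<Longrightarrow> j_done P A R l k j \<Longrightarrow> \<not> leave_k P A R l k j \<Longrightarrow>
      alpha_min R l (Suc k) = alpha_min_upd A R l k j \<and> Jmax R l (Suc k) = Jmax_upd R l k j"
    and refined_upd: "\<And>l k j. (l, k, j) \<in> Qset P A R \<Longrightarrow> j_done P A R l k j \<Longrightarrow> leave_k P A R l k j \<Longrightarrow>
      alpha_min R (Suc l) 1 = alpha_min_upd A R l k j \<and> Jmax R (Suc l) 1 = Jmax_upd R l k j"
    and rho: "0 < rho A" "rho A < 1" and alpha_min0_pos: "0 < alpha_min0 A"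
    and c_pos: "0 < c" and J_pos: "1 \<le> J"
    and quot_ge: "\<And>l k j. (l, k, j) \<in> Qset P A R \<Longrightarrow> J \<le> j \<Longrightarrow>
      \<not> eq_ae (Omega P) (iter R l k j) (iter R l k 0) \<Longrightarrow> c \<le> alpha_quot P R l k j"
begin

text \<open>From \<open>J\<close> on, \<open>alpha_quot\<close> is positive unless the iterate
  equals the initial one, which is an exit by itself. The third exit test therefore holds at the
  first index that is both at least \<open>J\<close> and larger than \<open>Jmax\<close>.\<close>

lemma j_le: "(l, k, j) \<in> Qset P A R \<Longrightarrow> j \<le> max J (Suc (Jmax R l k))"
proof (rule ccontr)
  assume Q: "(l, k, j) \<in> Qset P A R" and "\<not> j \<le> max J (Suc (Jmax R l k))"
  then obtain i where i: "J \<le> i" "Jmax R l k < i" "1 \<le> i" "i < j" by (intro that[of "j - 1"]) auto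
  then have "(l, k, i) \<in> Qset P A R" "\<not> leave_j P R l k i"
    using Qset_prefix(3)[OF Q] by auto
  moreover from this have "c \<le> alpha_quot P R l k i" using i by (intro quot_ge) (auto simp: leave_j_def)
  ultimately show False using i(2) c_pos by (auto simp: leave_j_def)
qed

text \<open>Once \<open>alpha_min\<close> is at most \<open>c\<close>, the first exit test holds at
  \<open>J\<close>, independently of \<open>Jmax\<close>.\<close>

lemma j_le_J: "(l, k, j) \<in> Qset P A R \<Longrightarrow> alpha_min R l k \<le> c \<Longrightarrow> j \<le> J"
proof (rule ccontr)
  assume Q: "(l, k, j) \<in> Qset P A R" and le: "alpha_min R l k \<le> c" and "\<not> j \<le> J"
  then have i: "(l, k, J) \<in> Qset P A R" "\<not> leave_j P R l k J"
    using Qset_prefix(3)[OF Q, of J] J_pos by auto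
  then have "c \<le> alpha_quot P R l k J" by (intro quot_ge) (auto simp: leave_j_def)
  then show False using i(2) le by (auto simp: leave_j_def)
qed

text \<open>Here \<open>m\<close> counts the late exits so far. As long as m < N, a late exit raises
  the bound for \<open>Jmax\<close> by at most one; afterwards \<open>alpha_min\<close> is at most
  \<open>c\<close> and j \<le> J. Conversely, each late exit raises \<open>Jmax\<close> by at least
  one, so m \<le> \<open>Jmax\<close> and the number of late exits is bounded too.\<close>

lemma invariant_upd:
  assumes N: "alpha_min0 A * rho A ^ N \<le> c" and Q: "(l, k, j) \<in> Qset P A R"
    and inv: "alpha_min R l k = alpha_min0 A * rho A ^ m" "m \<le> Jmax R l k" "Jmax R l k \<le> max (Jmax0 A) J + min m N"
  shows "\<exists>m. alpha_min_upd A R l k j = alpha_min0 A * rho A ^ m \<and> m \<le> Jmax_upd R l k j \<and>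
    Jmax_upd R l k j \<le> max (Jmax0 A) J + min m N"
proof (cases "j > Jmax R l k")
  case True
  have "j \<le> max (Jmax0 A) J + min (Suc m) N"
  proof (cases "m < N")
    case True
    then show ?thesis using j_le[OF Q] inv(3) by auto
  next
    case False
    then have "alpha_min R l k \<le> alpha_min0 A * rho A ^ N"
      using rho alpha_min0_pos by (simp add: inv(1) power_decreasing)
    then show ?thesis using j_le_J[OF Q] N by auto
  qed
  then show ?thesis using True inv
    by (intro exI[of _ "Suc m"]) (auto simp: alpha_min_upd_def Jmax_upd_def)
next
  case False
  then show ?thesis using inv by (auto simp: alpha_min_upd_def Jmax_upd_def)
qed

lemma invariant:
  assumes N: "alpha_min0 A * rho A ^ N \<le> c" and "loop_no P A R n l k"
  shows "\<exists>m. alpha_min R l k = alpha_min0 A * rho A ^ m \<and> m \<le> Jmax R l k \<and>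
    Jmax R l k \<le> max (Jmax0 A) J + min m N"
  using assms(2)
proof (induction rule: loop_no.induct)
  case first
  then show ?case using alpha_min_init Jmax_init by (intro exI[of _ 0]) simp
next
  case (again n l k j)
  then show ?case using invariant_upd[OF N again.hyps(2)] again_upd[OF again.hyps(2-4)] by auto
next
  case (refined n l k j)
  then show ?case using invariant_upd[OF N refined.hyps(2)] refined_upd[OF refined.hyps(2-4)] by auto
qed

lemma uniform_bounds:
  obtains B am where "0 < am" "\<And>l k j. (l, k, j) \<in> Qset P A R \<Longrightarrow> j \<le> B"
    "\<And>l k j. (l, k, j) \<in> Qset P A R \<Longrightarrow> 1 \<le> k \<Longrightarrow> am \<le> alpha_min R l k \<and> Jmax R l k \<le> B"
proof -
  obtain N where "rho A ^ N < c / alpha_min0 A"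
    using real_arch_pow_inv[of "c / alpha_min0 A" "rho A"] rho c_pos alpha_min0_pos by auto
  then have N: "alpha_min0 A * rho A ^ N \<le> c" using alpha_min0_pos by (simp add: field_simps)
  \<comment> \<open>One more than the bound on \<open>Jmax\<close> from the invariant, since a loop
    may run to \<open>Jmax\<close> + 1. The same number bounds the count of late exits and hence the
    power of \<open>rho A\<close> in \<open>alpha_min\<close>.\<close>
  define B where "B = Suc (max (Jmax0 A) J + N)"
  have *: "alpha_min0 A * rho A ^ B \<le> alpha_min R l k \<and> Jmax R l k < B"
    if Q: "(l, k, j) \<in> Qset P A R" and k: "1 \<le> k" for l k j
  proof -
    obtain n where "loop_no P A R n l k" using Qset_loop_no[OF Q] k by (auto simp: max_def)
    from invariant[OF N this] obtain m where m: "alpha_min R l k = alpha_min0 A * rho A ^ m"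
      "m \<le> Jmax R l k" "Jmax R l k \<le> max (Jmax0 A) J + min m N" by blast
    then have "m \<le> B" by (auto simp: B_def)
    then have "rho A ^ B \<le> rho A ^ m" using rho by (intro power_decreasing) auto
    then show ?thesis using m alpha_min0_pos by (auto simp: B_def)
  qed
  have "j \<le> B" if Q: "(l, k, j) \<in> Qset P A R" for l k j
  proof (cases "1 \<le> j")
    case True
    then show ?thesis using *[OF Q Qset_prefix(2)[OF Q True]] j_le[OF Q] by (auto simp: B_def)
  qed (simp add: B_def)
  then show thesis
    using * rho alpha_min0_pos by (intro that[of "alpha_min0 A * rho A ^ B" B]) (auto simp: less_imp_le)
qed

text \<open>A \<open>j\<close>-loop left after more than \<open>Jmax\<close> steps increases \<open>Jmax\<close>, which is uniformly bounded;
  a \<open>j\<close>-loop in which the tolerance is reached is the last one.\<close>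

definition precedes :: "nat \<Rightarrow> nat \<Rightarrow> nat \<Rightarrow> nat \<Rightarrow> bool" where
  "precedes x l k j \<longleftrightarrow> Jmax R l k \<le> x \<and> (j_done P A R l k j \<and> Jmax R l k < j \<longrightarrow> Jmax R l k < x) \<and>
     \<not> (1 \<le> j \<and> tau_stop P A R l k j)"

lemma precedes_mono: "precedes x l k j \<Longrightarrow> x \<le> y \<Longrightarrow> precedes y l k j"
  by (auto simp: precedes_def)

lemma precedes_Jmax_upd:
  assumes "(l, k, i) \<in> Qset P A R" "j_done P A R l k i" "(l, k, j) \<in> Qset P A R"
  shows "precedes (Jmax_upd R l k i) l k j"
  unfolding precedes_def
proof (intro conjI)
  show "Jmax R l k \<le> Jmax_upd R l k i" by (simp add: Jmax_upd_def)
  show "j_done P A R l k j \<and> Jmax R l k < j \<longrightarrow> Jmax R l k < Jmax_upd R l k i"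
    using j_done_unique[OF assms(2,1) _ assms(3)] by (auto simp: Jmax_upd_def)
  show "\<not> (1 \<le> j \<and> tau_stop P A R l k j)"
    using tau_stop_not_j_done[OF _ assms(3) _ assms(1)] assms(2) by auto
qed

text \<open>\<open>Jmax\<close> never decreases from one loop to the next, and a late exit increases
  it strictly. A loop that stops by the tolerance has no successor, so it cannot be an earlier
  one.\<close>

lemma loop_no_precedes:
  assumes "loop_no P A R n l k" "m < n" "loop_no P A R m l' k'" "(l', k', j') \<in> Qset P A R"
  shows "precedes (Jmax R l k) l' k' j'"
  using assms
proof (induction arbitrary: m l' k' j' rule: loop_no.induct)
  case first
  then show ?case by simp
next
  case (again n l k j)
  have "Jmax R l k \<le> Jmax_upd R l k j" by (simp add: Jmax_upd_def)
  moreover consider "m < n" | "m = n" using again.prems(1) by linarith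
  then have "precedes (Jmax_upd R l k j) l' k' j'"
  proof cases
    case 1
    then show ?thesis using again.IH again.prems precedes_mono calculation by blast
  next
    case 2
    then have "l = l'" "k = k'" using loop_no_unique again.hyps(1) again.prems(2) by blast+
    then show ?thesis using precedes_Jmax_upd again.hyps again.prems(3) by blast
  qed
  ultimately show ?case using again_upd[OF again.hyps(2-4)] by simp
next
  case (refined n l k j)
  have "Jmax R l k \<le> Jmax_upd R l k j" by (simp add: Jmax_upd_def)
  moreover consider "m < n" | "m = n" using refined.prems(1) by linarith
  then have "precedes (Jmax_upd R l k j) l' k' j'"
  proof cases
    case 1
    then show ?thesis using refined.IH refined.prems precedes_mono calculation by blast
  next
    case 2
    then have "l = l'" "k = k'" using loop_no_unique refined.hyps(1) refined.prems(2) by blast+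
    then show ?thesis using precedes_Jmax_upd refined.hyps refined.prems(3) by blast
  qed
  ultimately show ?case using refined_upd[OF refined.hyps(2-4)] by simp
qed

text \<open>Loops with a late exit have pairwise different values of \<open>Jmax\<close>, all of
  them at most \<open>B\<close>. At most one loop reaches the tolerance.\<close>

lemma finite_exceptional:
  "finite {(l, k). \<exists>j. (l, k, j) \<in> Qset P A R \<and> 1 \<le> j \<and>
     (tau_stop P A R l k j \<or> j_done P A R l k j \<and> Jmax R l k < j)}"
proof -
  obtain am B where B: "\<And>l k j. (l, k, j) \<in> Qset P A R \<Longrightarrow> 1 \<le> k \<Longrightarrow> am \<le> alpha_min R l k \<and> Jmax R l k \<le> B"
    by (rule uniform_bounds) blast
  define S where "S D = {(l, k). \<exists>j. (l, k, j) \<in> Qset P A R \<and> 1 \<le> j \<and> D l k j}" for D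
  have no: "\<exists>n. loop_no P A R n l k" if "(l, k, j) \<in> Qset P A R" "1 \<le> j" for l k j
    using Qset_loop_no[OF that(1)] Qset_prefix(2)[OF that] by (auto simp: max_def)
  \<comment> \<open>Two different loops are ordered by their numbers, so
    \<open>loop_no_precedes\<close> applies in one direction. For the tolerance the map
    \<open>f\<close> is constant, and injectivity then says that there is at most one such
    loop.\<close>
  have inj: "inj_on f (S D)"
    if D: "\<And>l k j l' k' j'. D l k j \<Longrightarrow> D l' k' j' \<Longrightarrow> (l, k, j) \<in> Qset P A R \<Longrightarrow> 1 \<le> j \<Longrightarrow>
      precedes (Jmax R l' k') l k j \<Longrightarrow> f (l, k) \<noteq> f (l', k')" for D and f :: "nat \<times> nat \<Rightarrow> nat"
  proof (rule inj_onI)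
    fix x y assume xy: "x \<in> S D" "y \<in> S D" and eq: "f x = f y"
    obtain l k j where 1: "x = (l, k)" "(l, k, j) \<in> Qset P A R" "1 \<le> j" "D l k j"
      using xy(1) by (auto simp: S_def)
    obtain l' k' j' where 2: "y = (l', k')" "(l', k', j') \<in> Qset P A R" "1 \<le> j'" "D l' k' j'"
      using xy(2) by (auto simp: S_def)
    obtain m where m: "loop_no P A R m l k" using no[OF 1(2,3)] by blast
    obtain n where n: "loop_no P A R n l' k'" using no[OF 2(2,3)] by blast
    have "\<not> m < n" using D[OF 1(4) 2(4) 1(2,3)] loop_no_precedes[OF n _ m 1(2)] eq 1(1) 2(1) by blast
    moreover have "\<not> n < m" using D[OF 2(4) 1(4) 2(2,3)] loop_no_precedes[OF m _ n 2(2)] eq 1(1) 2(1) by metis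
    ultimately have "m = n" by simp
    then show "x = y" using loop_no_unique[OF m] n 1(1) 2(1) by simp
  qed
  have "finite (S (tau_stop P A R))"
    by (rule inj_on_finite[OF inj[of _ "\<lambda>_. 0"], of _ "{0}"]) (auto simp: precedes_def)
  moreover have "finite (S (\<lambda>l k j. j_done P A R l k j \<and> Jmax R l k < j))"
  proof (rule inj_on_finite[OF inj[of _ "\<lambda>(l, k). Jmax R l k"], of _ "{..B}"])
    show "(\<lambda>(l, k). Jmax R l k) ` S (\<lambda>l k j. j_done P A R l k j \<and> Jmax R l k < j) \<subseteq> {..B}"
      using B Qset_prefix(2) by (fastforce simp: S_def)
  qed (auto simp: precedes_def)
  ultimately show ?thesis
    by (rule finite_subset[OF _ finite_UnI, rotated]) (auto simp: S_def)
qed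

end

lemma eta_nonneg: "0 \<le> eta P T U v"
proof -
  have "0 \<le> eta_elt_sq P T t v" for t
    unfolding eta_elt_sq_def set_lebesgue_integral_def
    by (intro add_nonneg_nonneg mult_nonneg_nonneg sum_nonneg integral_nonneg_AE AE_I2) auto
  then show ?thesis by (simp add: eta_def sum_nonneg)
qed

lemma nvb_meshes_refine:
  assumes "nvb_admissible T0" "T \<in> nvb_meshes T0" "M \<subseteq> T"
  shows "refine T M \<in> nvb_meshes T0" "nvb_le T (refine T M)"
proof -
  have "\<exists>!T'. is_refine T M T'" using assms unfolding nvb_admissible_def by blast
  then have "is_refine T M (refine T M)" unfolding refine_def by (rule theI')
  then have r: "nvb_le T (refine T M)" "conforming (refine T M)"
    unfolding is_refine_def nvb_meshes_def by blast+
  then show "nvb_le T (refine T M)" by simp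
  have "nvb_le T0 T" using assms(2) unfolding nvb_meshes_def by blast
  then have "nvb_le T0 (refine T M)" using r(1) unfolding nvb_le_def by (rule rtranclp_trans)
  then show "refine T M \<in> nvb_meshes T0" using r(2) unfolding nvb_meshes_def by blast
qed

section \<open>Application to a run of the adaptive algorithm\<close>

locale ailfem = monotone_problem P L
  for P :: "'a::euclidean_space problem" and L :: real +
  fixes Ccnt Cnrg_star qalg :: real and p :: nat and T0 :: "'a mesh"
    and a :: "('a \<Rightarrow> real) \<Rightarrow> ('a \<Rightarrow> real) \<Rightarrow> ('a \<Rightarrow> real) \<Rightarrow> real"
    and \<Phi> :: "'a mesh \<Rightarrow> ('a \<Rightarrow> real) \<Rightarrow> 'a \<Rightarrow> real"
    and \<Psi> :: "'a mesh \<Rightarrow> ('a \<Rightarrow> real) \<Rightarrow> ('a \<Rightarrow> real) \<Rightarrow> 'a \<Rightarrow> real"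
    and A :: params and u0 :: "'a \<Rightarrow> real" and R :: "'a run"
  assumes initial_mesh: "conforming T0" "\<And>t. t \<in> T0 \<Longrightarrow> fst t \<noteq> []" "nvb_admissible T0"
    and Ccnt: "0 < Ccnt"
    and a_bilinear: "\<And>u. u \<in> Xspace P \<Longrightarrow> sym_bilinear_on (Xspace P) (a u)"
    and a_bounded: "\<And>u v w. u \<in> Xspace P \<Longrightarrow> v \<in> Xspace P \<Longrightarrow> w \<in> Xspace P \<Longrightarrow>
        \<bar>a u v w\<bar> \<le> Ccnt * enorm P v * enorm P w"
    and \<Phi>: "\<And>T u. T \<in> nvb_meshes T0 \<Longrightarrow> u \<in> fe_space P p T \<Longrightarrow>
        linearized_solution P a (fe_space P p T) u (\<Phi> T u)"
    and Cnrg_star_pos: "0 < Cnrg_star"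
    and Cnrg_star: "\<And>T u. T \<in> nvb_meshes T0 \<Longrightarrow> u \<in> fe_space P p T \<Longrightarrow>
        Cnrg_star * (enorm P (\<Phi> T u - u))\<^sup>2 \<le> dsq P (\<Phi> T u) u"
    and qalg: "0 < qalg" "qalg < 1"
    and \<Psi>: "\<And>T. T \<in> nvb_meshes T0 \<Longrightarrow> contractive_solver P p T \<Phi> \<Psi> qalg"
    and rho_A: "0 < rho A" "rho A < 1" and alpha_min0_A: "0 < alpha_min0 A"
    and u0: "u0 \<in> fe_space P p T0"
    and run: "ailfem_run P T0 \<Phi> \<Psi> u0 A R"
begin

lemma run_start:
  "meshes R 0 = T0" "iter R 0 0 0 = u0" "alpha_min R 0 1 = alpha_min0 A" "Jmax R 0 1 = Jmax0 A"
  using run unfolding ailfem_run_def by blast+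

lemma run_first_k: "(l, 0, 0) \<in> Qset P A R \<Longrightarrow> iter R l 1 0 = iter R l 0 0"
  using run unfolding ailfem_run_def by blast

lemma run_solver_step:
  assumes "(l, k, Suc j) \<in> Qset P A R"
  shows "iter R l k (Suc j) = \<Psi> (meshes R l) (\<Phi> (meshes R l) (iter R l k 0)) (iter R l k j)"
proof -
  have "star R l k = \<Phi> (meshes R l) (iter R l k 0)"
    using run Qset_prefix(1,2)[OF assms] unfolding ailfem_run_def by simp
  moreover have "iter R l k (Suc j) = \<Psi> (meshes R l) (star R l k) (iter R l k j)"
    using run assms unfolding ailfem_run_def by blast
  ultimately show ?thesis by simp
qed

lemma run_again:
  assumes "(l, k, j) \<in> Qset P A R" "j_done P A R l k j" "\<not> leave_k P A R l k j"
  shows "iter R l (Suc k) 0 = iter R l k j" "alpha_min R l (Suc k) = alpha_min_upd A R l k j"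
    "Jmax R l (Suc k) = Jmax_upd R l k j"
  using run assms unfolding ailfem_run_def by blast+

lemma run_refined:
  assumes "(l, k, j) \<in> Qset P A R" "j_done P A R l k j" "leave_k P A R l k j"
  shows "marked R l \<subseteq> meshes R l" "meshes R (Suc l) = refine (meshes R l) (marked R l)"
    "iter R (Suc l) 0 0 = iter R l k j" "alpha_min R (Suc l) 1 = alpha_min_upd A R l k j"
    "Jmax R (Suc l) 1 = Jmax_upd R l k j"
  using run assms unfolding ailfem_run_def doerfler_def by blast+

text \<open>The final estimates refer to the last iterate of the previous loop, the exit tests to
  \<open>iter R l k 0\<close>. For k = 1 the previous loop is degenerate, with 0 as its only
  index.\<close>

lemma previous_iter_last:
  assumes Q: "(l, k, 0) \<in> Qset P A R" and k: "1 \<le> k"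
  shows "iter_last P A R l (k - 1) = iter R l k 0"
  using Q
proof (cases rule: Qset.cases)
  case first_k
  have "i \<le> 0" if "(l, 0, i) \<in> Qset P A R" for i using Qset_prefix(2)[OF that] by (cases i) auto
  from jlast_eqI(2)[OF first_k(2) this] show ?thesis
    using run_first_k[OF first_k(2)] first_k(1) by simp
next
  case (next_k k' j)
  have "iter_last P A R l k' = iter R l k' j"
    by (rule jlast_eqI(2)[OF next_k(2) j_done_last[OF next_k(3)]])
  then show ?thesis using run_again(1)[OF next_k(2-4)] next_k(1) by simp
qed (use k in simp_all)

text \<open>The initial iterate of the loop is part of the claim because each solver step depends on
  it through \<Phi>. On passing to a new mesh, nestedness of the spaces enters.\<close>

lemma run_in_fe_space:
  "(l, k, j) \<in> Qset P A R \<Longrightarrow> meshes R l \<in> nvb_meshes T0 \<and> iter R l k 0 \<in> fe_space P p (meshes R l) \<and>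
    iter R l k j \<in> fe_space P p (meshes R l)"
proof (induction l k j rule: Qset.induct)
  case start
  then show ?case using u0 initial_mesh(1) by (simp add: run_start nvb_meshes_def nvb_le_def)
next
  case (first_k l)
  then show ?case unfolding run_first_k[OF first_k.hyps(1)] by simp
next
  case (first_j l k)
  then show ?case
    using run_solver_step[of l k 0] Qset.first_j[OF first_j.hyps] \<Psi>[of "meshes R l"]
    by (simp add: contractive_solver_def)
next
  case (next_j l k j)
  then show ?case
    using run_solver_step[OF Qset.next_j[OF next_j.hyps]] \<Psi>[of "meshes R l"]
    by (simp add: contractive_solver_def)
next
  case (next_k l k j)
  then show ?case by (simp add: run_again[OF next_k.hyps])
next
  case (next_l l k j)
  note * = run_refined[OF next_l.hyps]
  note ref = nvb_meshes_refine[OF initial_mesh(3) _ *(1)]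
  have "nvb_le T0 (meshes R l)" using next_l.IH by (simp add: nvb_meshes_def)
  then have "\<forall>t\<in>meshes R l. fst t \<noteq> []" using nvb_le_refines initial_mesh(2) by blast
  then show ?case using next_l.IH ref fe_space_mono unfolding *(2,3) by blast
qed

lemma run_in_Xspace: "(l, k, j) \<in> Qset P A R \<Longrightarrow> iter R l k j \<in> Xspace P"
  using run_in_fe_space by (auto simp: fe_space_def)

lemma iter_eq_funpow:
  "(l, k, j) \<in> Qset P A R \<Longrightarrow> iter R l k j = (\<Psi> (meshes R l) (\<Phi> (meshes R l) (iter R l k 0)) ^^ j) (iter R l k 0)"
proof (induction j)
  case (Suc j)
  have prev: "(l, k, j) \<in> Qset P A R"
    using Qset_prefix(1)[OF Suc.prems] Qset_prefix(3)[OF Suc.prems, of j] by (cases "j = 0") auto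
  show ?case using Suc.IH[OF prev] run_solver_step[OF Suc.prems] by simp
qed simp

lemma solver_contraction:
  assumes Q: "(l, k, j) \<in> Qset P A R" and k: "1 \<le> k"
  shows "enorm P (\<Phi> (meshes R l) (iter R l k 0) - iter R l k j)
    \<le> qalg ^ j * enorm P (\<Phi> (meshes R l) (iter R l k 0) - iter R l k 0)"
proof -
  let ?T = "meshes R l" and ?u = "iter R l k 0"
  have "contractive_solver P p ?T \<Phi> \<Psi> qalg" "?u \<in> fe_space P p ?T"
    using run_in_fe_space[OF Q] \<Psi> by auto
  then have step: "enorm P (\<Phi> ?T ?u - (\<Psi> ?T (\<Phi> ?T ?u) ^^ Suc i) ?u) \<le> qalg * enorm P (\<Phi> ?T ?u - (\<Psi> ?T (\<Phi> ?T ?u) ^^ i) ?u)" for i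
    unfolding contractive_solver_def by blast
  have "enorm P (\<Phi> ?T ?u - (\<Psi> ?T (\<Phi> ?T ?u) ^^ i) ?u) \<le> qalg ^ i * enorm P (\<Phi> ?T ?u - ?u)" for i
  proof (induction i)
    case (Suc i)
    have "qalg * enorm P (\<Phi> ?T ?u - (\<Psi> ?T (\<Phi> ?T ?u) ^^ i) ?u) \<le> qalg * (qalg ^ i * enorm P (\<Phi> ?T ?u - ?u))"
      by (intro mult_left_mono Suc.IH less_imp_le[OF qalg(1)])
    then show ?case using step[of i] by (simp add: fun_diff_def)
  qed simp
  then show ?thesis unfolding iter_eq_funpow[OF Q] .
qed

lemma dsq_ge_eventually:
  assumes C': "0 < C'" "C' < Cnrg_star"
  obtains J where "1 \<le> J" "\<And>l k j. (l, k, j) \<in> Qset P A R \<Longrightarrow> J \<le> j \<Longrightarrow>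
    C' * (enorm P (iter R l k j - iter R l k 0))\<^sup>2 \<le> dsq P (iter R l k j) (iter R l k 0)"
proof -
  let ?K = "L + Ccnt + L / 6"
  \<comment> \<open>This is the condition \<open>small\<close> of
    \<open>dsq_lower_bound_perturbed\<close> with \<delta> = qalg^j. The expression tends to C',
    which is below \<open>Cnrg_star\<close>, so one index \<open>J\<close> serves all loops.\<close>
  have "(\<lambda>j. C' * (1 + qalg ^ j)\<^sup>2 + ?K * qalg ^ j) \<longlonglongrightarrow> C' * (1 + 0)\<^sup>2 + ?K * 0"
    using qalg by (intro tendsto_intros LIMSEQ_power_zero) auto
  then have "\<forall>\<^sub>F j in sequentially. C' * (1 + qalg ^ j)\<^sup>2 + ?K * qalg ^ j < Cnrg_star"
    using C' by (intro order_tendstoD) auto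
  then obtain J where J: "\<And>j. J \<le> j \<Longrightarrow> C' * (1 + qalg ^ j)\<^sup>2 + ?K * qalg ^ j < Cnrg_star"
    by (auto simp: eventually_sequentially)
  have "C' * (enorm P (iter R l k j - iter R l k 0))\<^sup>2 \<le> dsq P (iter R l k j) (iter R l k 0)"
    if Q: "(l, k, j) \<in> Qset P A R" and j: "max 1 J \<le> j" for l k j
  proof -
    have k: "1 \<le> k" using Qset_prefix(2)[OF Q] j by simp
    note fe = run_in_fe_space[OF Q]
    have X: "iter R l k 0 \<in> Xspace P" by (rule run_in_Xspace[OF Qset_prefix(1)[OF Q]])
    show ?thesis
    proof (rule dsq_lower_bound_perturbed[where XH="fe_space P p (meshes R l)" and a=a and C=Ccnt and Cs=Cnrg_star and \<delta>="qalg ^ j"])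
      show "enorm P (\<Phi> (meshes R l) (iter R l k 0) - iter R l k j)
          \<le> qalg ^ j * enorm P (\<Phi> (meshes R l) (iter R l k 0) - iter R l k 0)"
        by (rule solver_contraction[OF Q k])
      show "C' * (1 + qalg ^ j)\<^sup>2 \<le> Cnrg_star - ?K * qalg ^ j"
        using J[of j] j by simp
      show "fe_space P p (meshes R l) \<subseteq> Xspace P" by (auto simp: fe_space_def)
      show "qalg ^ j \<le> 1" using qalg by (simp add: power_le_one)
    qed (use fe \<Phi> Cnrg_star a_bilinear a_bounded X Ccnt C' qalg fe_space_diff in auto)
  qed
  then show thesis by (intro that[of "max 1 J"]) auto
qed

lemma enorm_iter_eq_0_iff:
  assumes "(l, k, j) \<in> Qset P A R"
  shows "enorm P (iter R l k j - iter R l k 0) = 0 \<longleftrightarrow> eq_ae (Omega P) (iter R l k j) (iter R l k 0)"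
  by (intro enorm_diff_eq_0_iff run_in_Xspace assms Qset_prefix(1)[OF assms])

text \<open>The denominator of \<open>alpha_quot\<close> is positive because the norm separates
  functions that are not equal almost everywhere.\<close>

lemma le_alpha_quot_iff:
  assumes "(l, k, j) \<in> Qset P A R" "\<not> eq_ae (Omega P) (iter R l k j) (iter R l k 0)"
  shows "c \<le> alpha_quot P R l k j \<longleftrightarrow>
    c * (enorm P (iter R l k j - iter R l k 0))\<^sup>2 \<le> dsq P (iter R l k j) (iter R l k 0)"
  using enorm_iter_eq_0_iff[OF assms(1)] assms(2) by (simp add: alpha_quot_def pos_le_divide_eq)

text \<open>Any constant strictly between 0 and \<open>Cnrg_star\<close> would serve; half of
  \<open>Cnrg_star\<close> is taken.\<close>

lemma ailfem_loop_exists: "\<exists>c J. ailfem_loop P A R c J"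
proof -
  obtain J where J: "1 \<le> J" "\<And>l k j. (l, k, j) \<in> Qset P A R \<Longrightarrow> J \<le> j \<Longrightarrow>
    (Cnrg_star / 2) * (enorm P (iter R l k j - iter R l k 0))\<^sup>2 \<le> dsq P (iter R l k j) (iter R l k 0)"
    by (rule dsq_ge_eventually[of "Cnrg_star / 2"]) (use Cnrg_star_pos in auto)
  have "ailfem_loop P A R (Cnrg_star / 2) J"
  proof
    show "Cnrg_star / 2 \<le> alpha_quot P R l k j"
      if "(l, k, j) \<in> Qset P A R" "J \<le> j" "\<not> eq_ae (Omega P) (iter R l k j) (iter R l k 0)" for l k j
      using J(2)[OF that(1,2)] le_alpha_quot_iff[OF that(1,3)] by simp
  qed (use run_start run_again run_refined rho_A alpha_min0_A Cnrg_star_pos J(1) in auto)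
  then show ?thesis by blast
qed

lemma Qset_bounded:
  obtains B where "\<And>l k j. (l, k, j) \<in> Qset P A R \<Longrightarrow> j \<le> B"
proof -
  obtain c J where "ailfem_loop P A R c J" using ailfem_loop_exists by blast
  from ailfem_loop.uniform_bounds[OF this] show thesis using that by metis
qed

text \<open>The bound provides a largest index \<open>j\<close> of the loop. There the rule
  \<open>next_j\<close> cannot apply, so one of the exit tests must hold.\<close>

lemma jlast_cases:
  assumes B: "\<And>j. (l, k, j) \<in> Qset P A R \<Longrightarrow> j \<le> B" and Q: "(l, k, 0) \<in> Qset P A R" and k: "1 \<le> k"
  obtains j where "(l, k, j) \<in> Qset P A R" "1 \<le> j" "iter_last P A R l k = iter R l k j"
    "tau_stop P A R l k j \<or> j_done P A R l k j"
proof -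
  let ?S = "{j. (l, k, j) \<in> Qset P A R}"
  have fin: "finite ?S" using B by (intro finite_subset[of ?S "{..B}"]) auto
  have one: "1 \<in> ?S" using Qset.first_j[OF Q k] by simp
  define j where "j = Max ?S"
  have j: "(l, k, j) \<in> Qset P A R" using Max_in[OF fin] one unfolding j_def by blast
  have max: "i \<le> j" if "(l, k, i) \<in> Qset P A R" for i unfolding j_def using that fin by simp
  have "1 \<le> j" using max one by simp
  moreover have "tau_stop P A R l k j \<or> j_done P A R l k j"
  proof (rule ccontr)
    assume "\<not> ?thesis"
    then have "(l, k, Suc j) \<in> Qset P A R"
      using \<open>1 \<le> j\<close> k by (intro Qset.next_j[OF j]) (auto simp: j_done_def)
    then show False using max by fastforce
  qed
  ultimately show thesis using that j jlast_eqI(2)[OF j max] by blast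
qed

text \<open>The constant is the minimum of \<open>Cnrg_star / 2\<close>, which keeps it below
  \<open>Cnrg_star\<close>, the lower bound \<open>am\<close> of \<open>alpha_min\<close> for loops
  left by the first exit test, and the positive quotients of the finitely many exceptional
  loops.\<close>

lemma uniform_constant:
  "\<exists>c. 0 < c \<and> c < Cnrg_star \<and> (\<forall>l k j. (l, k, j) \<in> Qset P A R \<and> 1 \<le> j \<and>
     (tau_stop P A R l k j \<or> j_done P A R l k j) \<and> \<not> tau_stop_without_decrease P A R l k \<longrightarrow>
     c * (enorm P (iter R l k j - iter R l k 0))\<^sup>2 \<le> dsq P (iter R l k j) (iter R l k 0))"
proof -
  obtain c0 J where "ailfem_loop P A R c0 J" using ailfem_loop_exists by blast
  then interpret ailfem_loop P A R c0 J .
  obtain am B where am: "0 < am" and B: "\<And>l k j. (l, k, j) \<in> Qset P A R \<Longrightarrow> j \<le> B"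
    "\<And>l k j. (l, k, j) \<in> Qset P A R \<Longrightarrow> 1 \<le> k \<Longrightarrow> am \<le> alpha_min R l k \<and> Jmax R l k \<le> B"
    by (rule uniform_bounds) blast
  define E where "E = {(l, k). \<exists>j. (l, k, j) \<in> Qset P A R \<and> 1 \<le> j \<and>
     (tau_stop P A R l k j \<or> j_done P A R l k j \<and> Jmax R l k < j)}"
  \<comment> \<open>Finiteness follows from finitely many loops with at most \<open>B\<close> steps
    each. Only positive quotients are collected, so that the minimum is positive.\<close>
  define Z where "Z = {alpha_quot P R l k j |l k j. (l, k) \<in> E \<and> j \<le> B \<and> 0 < alpha_quot P R l k j}"
  have "Z \<subseteq> (\<lambda>((l, k), j). alpha_quot P R l k j) ` (E \<times> {..B})" by (force simp: Z_def)
  then have "finite Z" using finite_exceptional by (auto simp: E_def intro: finite_subset)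
  define c where "c = Min (insert (Cnrg_star / 2) (insert am Z))"
  have c: "0 < c" "c < Cnrg_star" "c \<le> am" "\<And>z. z \<in> Z \<Longrightarrow> c \<le> z"
  proof -
    have "c \<in> insert (Cnrg_star / 2) (insert am Z)"
      unfolding c_def using \<open>finite Z\<close> by (intro Min_in) auto
    then show "0 < c" using Cnrg_star_pos am by (auto simp: Z_def)
    have le: "c \<le> z" if "z \<in> insert (Cnrg_star / 2) (insert am Z)" for z
      unfolding c_def using \<open>finite Z\<close> that by (intro Min_le) auto
    show "c \<le> am" "\<And>z. z \<in> Z \<Longrightarrow> c \<le> z" using le by auto
    show "c < Cnrg_star" using le[of "Cnrg_star / 2"] Cnrg_star_pos by simp
  qed
  have "c * (enorm P (iter R l k j - iter R l k 0))\<^sup>2 \<le> dsq P (iter R l k j) (iter R l k 0)"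
    if Q: "(l, k, j) \<in> Qset P A R" and j: "1 \<le> j" and fin: "tau_stop P A R l k j \<or> j_done P A R l k j"
      and dec: "\<not> tau_stop_without_decrease P A R l k" for l k j
  proof (cases "eq_ae (Omega P) (iter R l k j) (iter R l k 0)")
    case True
    \<comment> \<open>If the iterates agree almost everywhere, both sides of the estimate
      vanish.\<close>
    have "dsq P (iter R l k j) (iter R l k 0) = 0"
      by (intro dsq_eq_ae run_in_Xspace Q Qset_prefix(1)[OF Q] True)
    then show ?thesis using True enorm_iter_eq_0_iff[OF Q] by simp
  next
    case False
    have e: "0 < enorm P (iter R l k j - iter R l k 0)"
      using enorm_iter_eq_0_iff[OF Q] False enorm_nonneg[of "iter R l k j - iter R l k 0"] by linarith
    have Z: "alpha_quot P R l k j \<in> Z" if "(l, k) \<in> E" "0 < alpha_quot P R l k j"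
      unfolding Z_def using that B(1)[OF Q] by blast
    have "c \<le> alpha_quot P R l k j"
    proof (cases "tau_stop P A R l k j")
      case True
      \<comment> \<open>The sum in the termination test contains the positive norm \<open>e\<close>
        and otherwise nonnegative terms. With a positive tolerance, the negation of
        \<open>tau_stop_without_decrease\<close> provides a strict decrease of the energy.\<close>
      have "0 < tau A"
        using True eta_nonneg[of P "meshes R l" "meshes R l" "iter R l k j"] e
          enorm_nonneg[of "iter R l k j - iter R l k (j - 1)"] unfolding tau_stop_def by linarith
      then have "0 < dsq P (iter R l k j) (iter R l k 0)"
        using dec Q j True False unfolding tau_stop_without_decrease_def by force
      then have "0 < alpha_quot P R l k j" using e by (simp add: alpha_quot_def)
      moreover have "(l, k) \<in> E" using True Q j unfolding E_def by blast
      ultimately show ?thesis using Z c(4) by blast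
    next
      case False': False
      then have jd: "j_done P A R l k j" using fin by blast
      then consider "alpha_min R l k \<le> alpha_quot P R l k j" | "0 < alpha_quot P R l k j" "Jmax R l k < j"
        using False by (auto simp: j_done_def leave_j_def)
      then show ?thesis
      proof cases
        case 1
        then show ?thesis using B(2)[OF Q Qset_prefix(2)[OF Q j]] c(3) by simp
      next
        case 2
        then have "(l, k) \<in> E" using jd Q j unfolding E_def by blast
        then show ?thesis using 2(1) Z c(4) by blast
      qed
    qed
    then show ?thesis using le_alpha_quot_iff[OF Q False] by simp
  qed
  then show ?thesis using c by blast
qed

lemma energy_decrease_eventually:
  assumes "0 < C'" "C' < Cnrg_star"
  shows "\<exists>j0'\<ge>1. \<forall>l k j. (l, k, j) \<in> Qset P A R \<and> j0' \<le> j \<longrightarrow>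
    C' * (enorm P (iter R l k j - iter_last P A R l (k - 1)))\<^sup>2
      \<le> dsq P (iter R l k j) (iter_last P A R l (k - 1))"
proof -
  obtain J where J: "1 \<le> J" "\<And>l k j. (l, k, j) \<in> Qset P A R \<Longrightarrow> J \<le> j \<Longrightarrow>
    C' * (enorm P (iter R l k j - iter R l k 0))\<^sup>2 \<le> dsq P (iter R l k j) (iter R l k 0)"
    by (rule dsq_ge_eventually[OF assms]) blast
  show ?thesis
  proof (intro exI[of _ J] conjI J(1) allI impI, elim conjE)
    fix l k j assume Q: "(l, k, j) \<in> Qset P A R" and j: "J \<le> j"
    have "1 \<le> k" by (rule Qset_prefix(2)[OF Q]) (use J(1) j in simp)
    note last = previous_iter_last[OF Qset_prefix(1)[OF Q] this]
    show "C' * (enorm P (iter R l k j - iter_last P A R l (k - 1)))\<^sup>2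
        \<le> dsq P (iter R l k j) (iter_last P A R l (k - 1))"
      unfolding last by (rule J(2)[OF Q j])
  qed
qed

lemma solver_steps_bounded:
  "\<exists>j0\<ge>1. \<forall>l k. (l, k, 0) \<in> Qset P A R \<longrightarrow> jlast P A R l k \<le> enat j0"
proof -
  obtain B where B: "\<And>l k j. (l, k, j) \<in> Qset P A R \<Longrightarrow> j \<le> B" by (rule Qset_bounded) blast
  have "jlast P A R l k \<le> enat (max 1 B)" for l k
    unfolding jlast_def
  proof (rule SUP_least)
    fix j assume "j \<in> {j. (l, k, j) \<in> Qset P A R}"
    then have "j \<le> B" using B by blast
    then show "enat j \<le> enat (max 1 B)" by simp
  qed
  then show ?thesis by (intro exI[of _ "max 1 B"]) simp
qed

lemma energy_decrease_last:
  "\<exists>Cnrg. 0 < Cnrg \<and> Cnrg < Cnrg_star \<and>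
    (\<forall>l k. (l, k, 0) \<in> Qset P A R \<and> 1 \<le> k \<and> \<not> tau_stop_without_decrease P A R l k \<longrightarrow>
       Cnrg * (enorm P (iter_last P A R l k - iter_last P A R l (k - 1)))\<^sup>2
         \<le> dsq P (iter_last P A R l k) (iter_last P A R l (k - 1)))"
proof -
  obtain B where B: "\<And>l k j. (l, k, j) \<in> Qset P A R \<Longrightarrow> j \<le> B" by (rule Qset_bounded) blast
  from uniform_constant obtain c where c: "0 < c" "c < Cnrg_star"
    and le: "\<forall>l k j. (l, k, j) \<in> Qset P A R \<and> 1 \<le> j \<and>
     (tau_stop P A R l k j \<or> j_done P A R l k j) \<and> \<not> tau_stop_without_decrease P A R l k \<longrightarrow>
     c * (enorm P (iter R l k j - iter R l k 0))\<^sup>2 \<le> dsq P (iter R l k j) (iter R l k 0)"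
    by (elim exE conjE)
  show ?thesis
  proof (intro exI[of _ c] conjI c allI impI, elim conjE)
    fix l k assume Q: "(l, k, 0) \<in> Qset P A R" "1 \<le> k" and dec: "\<not> tau_stop_without_decrease P A R l k"
    obtain j where j: "(l, k, j) \<in> Qset P A R" "1 \<le> j" "iter_last P A R l k = iter R l k j"
      "tau_stop P A R l k j \<or> j_done P A R l k j"
      by (rule jlast_cases[OF B Q])
    show "c * (enorm P (iter_last P A R l k - iter_last P A R l (k - 1)))\<^sup>2
        \<le> dsq P (iter_last P A R l k) (iter_last P A R l (k - 1))"
      unfolding j(3) previous_iter_last[OF Q]
      by (rule le[rule_format]) (intro conjI j dec)
  qed
qed

end

theorem proposition4:
  fixes P :: "'a::euclidean_space problem"
    and \<alpha> L Cell Ccnt Cnrg_star qalg :: real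
    and p :: nat
    and T0 :: "'a mesh"
    and a :: "('a \<Rightarrow> real) \<Rightarrow> ('a \<Rightarrow> real) \<Rightarrow> ('a \<Rightarrow> real) \<Rightarrow> real"
    and \<Phi> :: "'a mesh \<Rightarrow> ('a \<Rightarrow> real) \<Rightarrow> 'a \<Rightarrow> real"
    and \<Psi> :: "'a mesh \<Rightarrow> ('a \<Rightarrow> real) \<Rightarrow> ('a \<Rightarrow> real) \<Rightarrow> 'a \<Rightarrow> real"
    and A :: params
    and u0 :: "'a \<Rightarrow> real"
    and R :: "'a run"
  assumes domain: "bounded_lipschitz_domain (Omega P)"
    and mu_nonneg: "\<And>t. 0 \<le> t \<Longrightarrow> 0 \<le> mu P t"
    and mu_C1: "C1_on_nonneg (mu P)"
    and \<alpha>_L: "0 < \<alpha>" "\<alpha> \<le> L / 3"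
    and mu_growth: "\<And>s t. 0 \<le> s \<Longrightarrow> s \<le> t \<Longrightarrow>
        \<alpha> * (t - s) \<le> mu P (t\<^sup>2) * t - mu P (s\<^sup>2) * s \<and>
        mu P (t\<^sup>2) * t - mu P (s\<^sup>2) * s \<le> L / 3 * (t - s)"
    and data: "sq_int (Omega P) (src P)" "sq_int (Omega P) (vsrc P)"
    and initial_mesh: "conforming_mesh_of (Omega P) T0" "nvb_admissible T0"
    and degree: "1 \<le> p"
    and a_constants: "0 < Cell" "0 < Ccnt"
    and a_bilinear: "\<And>u. u \<in> Xspace P \<Longrightarrow> sym_bilinear_on (Xspace P) (a u)"
    and a_elliptic: "\<And>u v. u \<in> Xspace P \<Longrightarrow> v \<in> Xspace P \<Longrightarrow>
        Cell * (enorm P v)\<^sup>2 \<le> a u v v"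
    and a_bounded: "\<And>u v w. u \<in> Xspace P \<Longrightarrow> v \<in> Xspace P \<Longrightarrow> w \<in> Xspace P \<Longrightarrow>
        \<bar>a u v w\<bar> \<le> Ccnt * enorm P v * enorm P w"
    and \<Phi>: "\<And>T u. T \<in> nvb_meshes T0 \<Longrightarrow> u \<in> fe_space P p T \<Longrightarrow>
        linearized_solution P a (fe_space P p T) u (\<Phi> T u)"
    and Cnrg_star_pos: "0 < Cnrg_star"
    and Cnrg_star: "\<And>T u. T \<in> nvb_meshes T0 \<Longrightarrow> u \<in> fe_space P p T \<Longrightarrow>
        Cnrg_star * (enorm P (\<Phi> T u - u))\<^sup>2 \<le> dsq P (\<Phi> T u) u"
    and qalg: "0 < qalg" "qalg < 1"
    and \<Psi>: "\<And>T. T \<in> nvb_meshes T0 \<Longrightarrow> contractive_solver P p T \<Phi> \<Psi> qalg"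
    and estimator: "\<And>T v. T \<in> nvb_meshes T0 \<Longrightarrow> v \<in> fe_space P p T \<Longrightarrow> eta_well_defined P T v"
    and parameters: "0 < theta A" "theta A \<le> 1" "1 \<le> Cmark A" "0 < lambda_lin A"
        "0 < rho A" "rho A < 1" "0 < alpha_min0 A" "1 \<le> Jmax0 A" "0 \<le> tau A"
    and u0: "u0 \<in> fe_space P p T0"
    and run: "ailfem_run P T0 \<Phi> \<Psi> u0 A R"
  shows "(\<forall>C'. 0 < C' \<and> C' < Cnrg_star \<longrightarrow>
            (\<exists>j0'\<ge>1. \<forall>l k j. (l, k, j) \<in> Qset P A R \<and> j0' \<le> j \<longrightarrow>
               C' * (enorm P (iter R l k j - iter_last P A R l (k - 1)))\<^sup>2
                 \<le> dsq P (iter R l k j) (iter_last P A R l (k - 1))))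
       \<and> (\<exists>j0\<ge>1. \<forall>l k. (l, k, 0) \<in> Qset P A R \<longrightarrow> jlast P A R l k \<le> enat j0)
       \<and> (\<exists>Cnrg. 0 < Cnrg \<and> Cnrg < Cnrg_star \<and>
            (\<forall>l k. (l, k, 0) \<in> Qset P A R \<and> 1 \<le> k \<and> \<not> tau_stop_without_decrease P A R l k \<longrightarrow>
               Cnrg * (enorm P (iter_last P A R l k - iter_last P A R l (k - 1)))\<^sup>2
                 \<le> dsq P (iter_last P A R l k) (iter_last P A R l (k - 1))))"
proof -
  obtain m' where m': "\<forall>t\<ge>0. (mu P has_real_derivative m' t) (at t within {0..})"
    using mu_C1 by (auto simp: C1_on_nonneg_def)
  interpret ailfem P L Ccnt Cnrg_star qalg p T0 a \<Phi> \<Psi> A u0 R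
  proof
    show "continuous_on {0..} (mu P)"
      using m' by (auto simp: continuous_on_eq_continuous_within intro: DERIV_continuous)
    show "mu P (s\<^sup>2) * s \<le> mu P (t\<^sup>2) * t" if "0 \<le> s" "s \<le> t" for s t
      using mu_growth[OF that] mult_nonneg_nonneg[of \<alpha> "t - s"] \<alpha>_L(1) that(2) by linarith
    show "fst t \<noteq> []" if "t \<in> T0" for t
      using initial_mesh(1) that by (auto simp: conforming_mesh_of_def tagged_simplex_def)
  qed (use assms in \<open>auto simp: bounded_lipschitz_domain_def conforming_mesh_of_def\<close>)
  show ?thesis
    using energy_decrease_eventually solver_steps_bounded energy_decrease_last by blast
qed

end
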